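(* Let $\bar\pi:\overline{\mathcal M}\to\mathcal P$ be a proper continuous map from a Hausdorff space to a locally path-connected metric space $\mathcal P$. Suppose that there is a dense subset $\mathcal P^*$ of $\mathcal P$ and an assignment $$p\mapsto\alpha_p\in\check{\mathcal H}_*(\overline{\mathcal M}_p)$$ defined for $p\in\mathcal P^*$ such that, for each $p,q\in\mathcal P^*$, the assignment is consistent along all paths in some dense subset of the space of paths in $\mathcal P$ from $p$ to $q$. Then the assignment extends to all $p\in\mathcal P$ so that it is consistent along all paths $\gamma$ in $\mathcal P$, and this extension is unique.
   Context: On compact Hausdorff spaces, $\check{\mathcal H}_*(X)$ denotes any one of: Čech homology $\check H_*(X;\mathbb Z)$; dual Čech cohomology $\mathrm{Hom}(\check H^*(X;\mathbb Z),\mathbb Z)$; rational Čech homology $\check H_*(X;\mathbb Q)$. For a nested sequence (more generally an inverse sequence) $\{Y_m\}$ of compact Hausdorff spaces with inverse limit $Y$, each satisfies $\check{\mathcal H}_*(Y)\cong\varprojlim\check{\mathcal H}_*(Y_m)$. Write $\overline{\mathcal M}_p=\bar\pi^{-1}(p)$. For a path (continuous map) $\gamma:[0,1]\to\mathcal P$ from $p$ to $q$, let $\overline{\mathcal M}_\gamma=\{(x,y)\in[0,1]\times\overline{\mathcal M}:\gamma(x)=\bar\pi(y)\}$, with the inclusions $\iota_0:\overline{\mathcal M}_p\to\overline{\mathcal M}_\gamma$ and $\iota_1:\overline{\mathcal M}_q\to\overline{\mathcal M}_\gamma$ of the fibers over the endpoints $0$ and $1$. Path spaces carry the $C^0$ topology.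 An assignment $p\mapsto\alpha_p\in\check{\mathcal H}_*(\overline{\mathcal M}_p)$ is consistent along a path $\gamma$ from $p$ to $q$ if $(\iota_0)_*\alpha_p=(\iota_1)_*\alpha_q$ in $\check{\mathcal H}_*(\overline{\mathcal M}_\gamma)$. *)

theory Defs
  imports
    "HOL-Analysis.Analysis"
    "HOL-Library.Poly_Mapping"
    "HOL-Algebra.Coset"
    "HOL-Algebra.Product_Groups"
    "HOL-Algebra.Elementary_Groups"
begin

section \<open>Simplicial homology and cohomology of ordered chains\<close>

text \<open>
  An abstract simplicial complex is given by its set \<open>K\<close> of (finite, nonempty) simplices.
  We use the ordered chain complex: an ordered \<open>n\<close>-simplex is a list of \<open>n + 1\<close> vertices,
  repetitions allowed, that span a simplex. It computes the same homology and cohomology as the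
  oriented chain complex. Chains are finite linear combinations with coefficients in \<open>'c\<close>.
\<close>

definition ordered_simplices :: "nat \<Rightarrow> 'v set set \<Rightarrow> 'v list set" where
  "ordered_simplices n K = {vs. length vs = Suc n \<and> set vs \<in> K}"

definition face :: "nat \<Rightarrow> 'v list \<Rightarrow> 'v list" where
  "face i vs = take i vs @ drop (Suc i) vs"

definition chain_group ::
    "nat \<Rightarrow> 'v set set \<Rightarrow> ('v list \<Rightarrow>\<^sub>0 'c::comm_ring_1) monoid" where
  "chain_group n K =
     \<lparr>carrier = {c. Poly_Mapping.keys c \<subseteq> ordered_simplices n K}, monoid.mult = (+), one = 0\<rparr>"

definition boundary ::
    "nat \<Rightarrow> ('v list \<Rightarrow>\<^sub>0 'c::comm_ring_1) \<Rightarrow> ('v list \<Rightarrow>\<^sub>0 'c)" where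
  "boundary n c =
     (if n = 0 then 0
      else \<Sum>vs\<in>Poly_Mapping.keys c. \<Sum>i\<le>n.
             Poly_Mapping.single (face i vs) ((-1) ^ i * Poly_Mapping.lookup c vs))"

definition cycles :: "nat \<Rightarrow> 'v set set \<Rightarrow> ('v list \<Rightarrow>\<^sub>0 'c::comm_ring_1) set" where
  "cycles n K = {c \<in> carrier (chain_group n K). boundary n c = 0}"

definition boundaries :: "nat \<Rightarrow> 'v set set \<Rightarrow> ('v list \<Rightarrow>\<^sub>0 'c::comm_ring_1) set" where
  "boundaries n K = boundary (Suc n) ` carrier (chain_group (Suc n) K)"

definition simplicial_homology ::
    "nat \<Rightarrow> 'v set set \<Rightarrow> ('v list \<Rightarrow>\<^sub>0 'c::comm_ring_1) set monoid" where
  "simplicial_homology n K = (chain_group n K)\<lparr>carrier := cycles n K\<rparr> Mod boundaries n K"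

definition chain_map ::
    "('v \<Rightarrow> 'w) \<Rightarrow> ('v list \<Rightarrow>\<^sub>0 'c::comm_ring_1) \<Rightarrow> ('w list \<Rightarrow>\<^sub>0 'c)" where
  "chain_map s c =
     (\<Sum>vs\<in>Poly_Mapping.keys c. Poly_Mapping.single (map s vs) (Poly_Mapping.lookup c vs))"

text \<open>The map \<open>s\<^sub>*\<close> into the homology of \<open>L\<close>: the coset of \<open>z\<close> goes to the coset of
  \<open>chain_map s z\<close>.\<close>

definition simplicial_homology_induced ::
    "nat \<Rightarrow> 'w set set \<Rightarrow> ('v \<Rightarrow> 'w)
      \<Rightarrow> ('v list \<Rightarrow>\<^sub>0 'c::comm_ring_1) set \<Rightarrow> ('w list \<Rightarrow>\<^sub>0 'c) set" where
  "simplicial_homology_induced n L s A = boundaries n L <#>\<^bsub>chain_group n L\<^esub> (chain_map s ` A)"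

text \<open>Integral cochains are functions on the ordered simplices, extended by \<open>0\<close> to all lists.\<close>

definition cochain_group :: "nat \<Rightarrow> 'v set set \<Rightarrow> ('v list \<Rightarrow> int) monoid" where
  "cochain_group n K =
     \<lparr>carrier = {\<phi>. \<forall>vs. vs \<notin> ordered_simplices n K \<longrightarrow> \<phi> vs = 0},
      monoid.mult = (\<lambda>\<phi> \<psi> vs. \<phi> vs + \<psi> vs), one = (\<lambda>vs. 0)\<rparr>"

definition coboundary :: "nat \<Rightarrow> 'v set set \<Rightarrow> ('v list \<Rightarrow> int) \<Rightarrow> ('v list \<Rightarrow> int)" where
  "coboundary n K \<phi> =
     (\<lambda>vs. if vs \<in> ordered_simplices (Suc n) K
           then \<Sum>i\<le>Suc n. (-1) ^ i * \<phi> (face i vs) else 0)"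

definition cocycles :: "nat \<Rightarrow> 'v set set \<Rightarrow> ('v list \<Rightarrow> int) set" where
  "cocycles n K = {\<phi> \<in> carrier (cochain_group n K). coboundary n K \<phi> = (\<lambda>vs. 0)}"

definition coboundaries :: "nat \<Rightarrow> 'v set set \<Rightarrow> ('v list \<Rightarrow> int) set" where
  "coboundaries n K =
     (case n of 0 \<Rightarrow> {\<lambda>vs. 0} | Suc m \<Rightarrow> coboundary m K ` carrier (cochain_group m K))"

definition simplicial_cohomology :: "nat \<Rightarrow> 'v set set \<Rightarrow> ('v list \<Rightarrow> int) set monoid" where
  "simplicial_cohomology n K =
     (cochain_group n K)\<lparr>carrier := cocycles n K\<rparr> Mod coboundaries n K"

definition cochain_map ::
    "nat \<Rightarrow> 'v set set \<Rightarrow> ('v \<Rightarrow> 'w) \<Rightarrow> ('w list \<Rightarrow> int) \<Rightarrow> ('v list \<Rightarrow> int)" where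
  "cochain_map n K s \<phi> = (\<lambda>vs. if vs \<in> ordered_simplices n K then \<phi> (map s vs) else 0)"

text \<open>The map \<open>s\<^sup>*\<close> into the cohomology of \<open>K\<close>.\<close>

definition simplicial_cohomology_induced ::
    "nat \<Rightarrow> 'v set set \<Rightarrow> ('v \<Rightarrow> 'w) \<Rightarrow> ('w list \<Rightarrow> int) set \<Rightarrow> ('v list \<Rightarrow> int) set" where
  "simplicial_cohomology_induced n K s A =
     coboundaries n K <#>\<^bsub>cochain_group n K\<^esub> (cochain_map n K s ` A)"


section \<open>Open covers and nerves\<close>

definition open_covers :: "'a topology \<Rightarrow> 'a set set set" where
  "open_covers X = {U. (\<forall>u\<in>U. openin X u) \<and> \<Union>U = topspace X}"

definition nerve :: "'a set set \<Rightarrow> 'a set set set" where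
  "nerve U = {\<sigma>. finite \<sigma> \<and> \<sigma> \<noteq> {} \<and> \<sigma> \<subseteq> U \<and> \<Inter>\<sigma> \<noteq> {}}"

text \<open>
  A vertex map \<open>s\<close> from the cover \<open>V\<close> to the cover \<open>U\<close> carrying \<open>f\<close>. For \<open>f = id\<close> this says
  that \<open>V\<close> refines \<open>U\<close> and that \<open>s\<close> is a refinement projection. For given \<open>f\<close>, \<open>V\<close> and \<open>U\<close> any
  two such \<open>s\<close> are contiguous as maps of nerves, so they agree on homology and cohomology.
\<close>

definition carries :: "('a \<Rightarrow> 'b) \<Rightarrow> 'a set set \<Rightarrow> 'b set set \<Rightarrow> ('a set \<Rightarrow> 'b set) \<Rightarrow> bool" where
  "carries f V U s \<longleftrightarrow> (\<forall>v\<in>V. s v \<in> U \<and> f ` v \<subseteq> s v)"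

definition preimage_cover :: "'a topology \<Rightarrow> ('a \<Rightarrow> 'b) \<Rightarrow> 'b set set \<Rightarrow> 'a set set" where
  "preimage_cover X f U = (\<lambda>u. {x \<in> topspace X. f x \<in> u}) ` U"

definition preimage_cover_map ::
    "'a topology \<Rightarrow> ('a \<Rightarrow> 'b) \<Rightarrow> 'b set set \<Rightarrow> 'a set \<Rightarrow> 'b set" where
  "preimage_cover_map X f U w = (SOME u. u \<in> U \<and> {x \<in> topspace X. f x \<in> u} = w)"


section \<open>Cech homology\<close>

text \<open>The inverse limit, over all open covers ordered by refinement, of the homology of the
  nerves.\<close>

type_synonym ('a, 'c) cech_class = "'a set set \<Rightarrow> ('a set list \<Rightarrow>\<^sub>0 'c) set"

definition cech_homology :: "nat \<Rightarrow> 'a topology \<Rightarrow> ('a, 'c::comm_ring_1) cech_class monoid" where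
  "cech_homology n X =
     (let G = product_group (open_covers X) (\<lambda>U. simplicial_homology n (nerve U)) in
      G\<lparr>carrier :=
          {\<alpha> \<in> carrier G. \<forall>U\<in>open_covers X. \<forall>V\<in>open_covers X. \<forall>s. carries id V U s \<longrightarrow>
             simplicial_homology_induced n (nerve U) s (\<alpha> V) = \<alpha> U}\<rparr>)"

definition cech_homology_induced ::
    "nat \<Rightarrow> 'a topology \<Rightarrow> 'b topology \<Rightarrow> ('a \<Rightarrow> 'b)
      \<Rightarrow> ('a, 'c::comm_ring_1) cech_class \<Rightarrow> ('b, 'c) cech_class" where
  "cech_homology_induced n X Y f \<alpha> =
     (\<lambda>U\<in>open_covers Y.
        simplicial_homology_induced n (nerve U) (preimage_cover_map X f U)
          (\<alpha> (preimage_cover X f U)))"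


section \<open>Cech cohomology and its dual\<close>

text \<open>
  The direct limit of the cohomology of the nerves: pairs \<open>(U, a)\<close>, with \<open>a\<close> a class of the
  nerve of the open cover \<open>U\<close>, are identified when they agree on a common refinement.
\<close>

type_synonym 'a cech_coclass = "('a set set \<times> ('a set list \<Rightarrow> int) set) set"

definition cech_cohomology_reps ::
    "nat \<Rightarrow> 'a topology \<Rightarrow> ('a set set \<times> ('a set list \<Rightarrow> int) set) set" where
  "cech_cohomology_reps n X =
     (SIGMA U:open_covers X. carrier (simplicial_cohomology n (nerve U)))"

definition cech_cohomology_rel ::
    "nat \<Rightarrow> 'a topology \<Rightarrow> ('a set set \<times> ('a set list \<Rightarrow> int) set) rel" where
  "cech_cohomology_rel n X =
     {((U, a), (V, b)).
        (U, a) \<in> cech_cohomology_reps n X \<and> (V, b) \<in> cech_cohomology_reps n X \<and>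
        (\<exists>W\<in>open_covers X. \<exists>s t. carries id W U s \<and> carries id W V t \<and>
           simplicial_cohomology_induced n (nerve W) s a =
           simplicial_cohomology_induced n (nerve W) t b)}"

text \<open>Two classes are added by choosing representatives over the same cover \<open>W\<close>; all such choices
  give the same class, so the union below is a single equivalence class.\<close>

definition cech_cohomology :: "nat \<Rightarrow> 'a topology \<Rightarrow> 'a cech_coclass monoid" where
  "cech_cohomology n X =
     \<lparr>carrier = cech_cohomology_reps n X // cech_cohomology_rel n X,
      monoid.mult = (\<lambda>A B. \<Union>{cech_cohomology_rel n X ``
                                {(W, a \<otimes>\<^bsub>simplicial_cohomology n (nerve W)\<^esub> b)} | W a b.
                              (W, a) \<in> A \<and> (W, b) \<in> B}),
      one = cech_cohomology_rel n X ``
              {({topspace X}, \<one>\<^bsub>simplicial_cohomology n (nerve {topspace X})\<^esub>)}\<rparr>"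

text \<open>The pullback \<open>f\<^sup>*\<close> from the cohomology of the target of \<open>f\<close> to that of its source \<open>X\<close>.\<close>

definition cech_cohomology_induced ::
    "nat \<Rightarrow> 'a topology \<Rightarrow> ('a \<Rightarrow> 'b) \<Rightarrow> 'b cech_coclass \<Rightarrow> 'a cech_coclass" where
  "cech_cohomology_induced n X f A =
     (\<Union>(U, a)\<in>A. cech_cohomology_rel n X ``
        {(preimage_cover X f U,
          simplicial_cohomology_induced n (nerve (preimage_cover X f U))
            (preimage_cover_map X f U) a)})"

text \<open>Homomorphisms to the integers are made extensional, so that equality of functions is equality
  of homomorphisms.\<close>

definition dual_cech_cohomology :: "nat \<Rightarrow> 'a topology \<Rightarrow> ('a cech_coclass \<Rightarrow> int) monoid" where
  "dual_cech_cohomology n X =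
     \<lparr>carrier = hom (cech_cohomology n X) integer_group
                  \<inter> extensional (carrier (cech_cohomology n X)),
      monoid.mult = (\<lambda>\<phi> \<psi>. \<lambda>A\<in>carrier (cech_cohomology n X). \<phi> A + \<psi> A),
      one = (\<lambda>A\<in>carrier (cech_cohomology n X). 0)\<rparr>"

definition dual_cech_cohomology_induced ::
    "nat \<Rightarrow> 'a topology \<Rightarrow> 'b topology \<Rightarrow> ('a \<Rightarrow> 'b)
      \<Rightarrow> ('a cech_coclass \<Rightarrow> int) \<Rightarrow> ('b cech_coclass \<Rightarrow> int)" where
  "dual_cech_cohomology_induced n X Y f \<phi> =
     (\<lambda>A\<in>carrier (cech_cohomology n Y). \<phi> (cech_cohomology_induced n X f A))"


section \<open>Paths, fibers and consistent assignments\<close>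

text \<open>The paths from \<open>p\<close> to \<open>q\<close> with the topology of uniform convergence. They are extensional
  functions on \<open>[0,1]\<close>.\<close>

definition path_space :: "'p metric \<Rightarrow> 'p \<Rightarrow> 'p \<Rightarrow> (real \<Rightarrow> 'p) topology" where
  "path_space P p q =
     subtopology (mtopology_of (cfunspace (top_of_set {0..1}) P)) {\<gamma>. \<gamma> 0 = p \<and> \<gamma> 1 = q}"

definition dense_in :: "'a topology \<Rightarrow> 'a set \<Rightarrow> bool" where
  "dense_in X D \<longleftrightarrow> D \<subseteq> topspace X \<and> X closure_of D = topspace X"

definition fiber :: "'m topology \<Rightarrow> ('m \<Rightarrow> 'p) \<Rightarrow> 'p \<Rightarrow> 'm topology" where
  "fiber M \<pi> p = subtopology M {y. \<pi> y = p}"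

definition path_fiber :: "'m topology \<Rightarrow> ('m \<Rightarrow> 'p) \<Rightarrow> (real \<Rightarrow> 'p) \<Rightarrow> (real \<times> 'm) topology" where
  "path_fiber M \<pi> \<gamma> = subtopology (prod_topology (top_of_set {0..1}) M) {(x, y). \<gamma> x = \<pi> y}"

text \<open>
  In the next two definitions \<open>H n X\<close> is the degree \<open>n\<close> part of a graded homology theory and
  \<open>push n X Y f\<close> is the map induced by \<open>f\<close> in degree \<open>n\<close>. An element of the graded group is the
  family of its components \<open>n \<mapsto> \<alpha>\<^sub>n\<close>. No finiteness is imposed on the family: inverse limits of
  graded groups are taken degree by degree and do not commute with the direct sum over all degrees.
\<close>

definition assignments ::
    "(nat \<Rightarrow> 'm topology \<Rightarrow> 'h monoid) \<Rightarrow> 'm topology \<Rightarrow> ('m \<Rightarrow> 'p) \<Rightarrow> 'p set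
      \<Rightarrow> ('p \<Rightarrow> nat \<Rightarrow> 'h) set" where
  "assignments H M \<pi> S = (\<Pi>\<^sub>E p\<in>S. \<Pi> n\<in>UNIV. carrier (H n (fiber M \<pi> p)))"

definition consistent_along ::
    "(nat \<Rightarrow> 'm topology \<Rightarrow> (real \<times> 'm) topology \<Rightarrow> ('m \<Rightarrow> real \<times> 'm) \<Rightarrow> 'h \<Rightarrow> 'k)
      \<Rightarrow> 'm topology \<Rightarrow> ('m \<Rightarrow> 'p) \<Rightarrow> (real \<Rightarrow> 'p) \<Rightarrow> ('p \<Rightarrow> nat \<Rightarrow> 'h) \<Rightarrow> bool" where
  "consistent_along push M \<pi> \<gamma> \<alpha> \<longleftrightarrow>
     (\<forall>n. push n (fiber M \<pi> (\<gamma> 0)) (path_fiber M \<pi> \<gamma>) (\<lambda>y. (0, y)) (\<alpha> (\<gamma> 0) n) =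
          push n (fiber M \<pi> (\<gamma> 1)) (path_fiber M \<pi> \<gamma>) (\<lambda>y. (1, y)) (\<alpha> (\<gamma> 1) n))"

end

theory Submission
  imports Defs "HOL-Library.Function_Algebras"
begin

text \<open>
  Each of the three theories is functorial and continuous: for a decreasing sequence of compact sets
  in a Hausdorff space, its value on the intersection is the inverse limit. The reason is that a
  cover of a compact set extends to a neighbourhood without new simplices of the nerve.

  Everything lives over compact subsets \<open>E\<close> of \<open>\<real> \<times> P\<close>; two points that are joined by a path
  in \<open>E\<close> along which the assignment is consistent give the same class over \<open>E\<close>. If \<open>E\<^sub>k\<close> decreases
  to \<open>E\<close>, equality over every \<open>E\<^sub>k\<close> implies equality over \<open>E\<close>. With the graph of \<open>\<gamma>\<close> and of all but
  finitely many terms of a sequence of paths converging to it as \<open>E\<^sub>k\<close>, consistency passes from a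
  dense set of paths to all paths. For \<open>p\<close> outside the dense set, let \<open>E\<^sub>k\<close> consist of \<open>p\<close> and
  of short paths from \<open>p\<close> to points \<open>p\<^sub>j\<close> of the dense set with \<open>j \<ge> k\<close>: the classes of the \<open>\<alpha>\<close> at
  \<open>p\<^sub>j\<close> form an element of the inverse limit, hence a class over \<open>p\<close>, the only possible one. Attaching
  such short paths to both ends of a path \<open>\<gamma>\<close> proves consistency along \<open>\<gamma>\<close>.
\<close>

section \<open>Cosets and additive maps\<close>

text \<open>The extra real coordinate keeps the sheets of a self-intersecting path apart:
  \<open>path_fiber\<close> is exactly the part of the product over a graph, so the spaces compared
  in the statement already have the form that the limit argument wants. A path in \<open>E\<close>
  need not be a graph; its first coordinate supplies a map carrying the graph of its second
  coordinate into \<open>E\<close>. Properness of \<pi> makes the space over a compact set compact,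
  and the metric gives Lebesgue numbers, so that uniformly close paths have graphs in a prescribed
  neighbourhood of the limit graph. Two points of the dense set may be joined through a point
  outside it, since consistency along a path reads only the values at its ends; this is why the
  classes of the \<alpha> at the \<open>p_j\<close> match in the inverse system. On the algebraic
  side the obstacle is that the vertex map from an extended cover back to the original is no
  refinement: away from the limit set a member may leave its image. Composites of such maps are
  compared by contiguity, with the common point always taken in the limit set.\<close>

definition coset :: "'a::ab_group_add set \<Rightarrow> 'a \<Rightarrow> 'a set" where
  "coset B z = (\<lambda>b. b + z) ` B"

definition add_subgroup :: "'a::ab_group_add set \<Rightarrow> bool" where
  "add_subgroup B \<longleftrightarrow> 0 \<in> B \<and> (\<forall>x\<in>B. \<forall>y\<in>B. x - y \<in> B)"

lemma add_subgroupD: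
  assumes "add_subgroup B"
  shows "0 \<in> B" "x \<in> B \<Longrightarrow> y \<in> B \<Longrightarrow> x - y \<in> B" "x \<in> B \<Longrightarrow> y \<in> B \<Longrightarrow> x + y \<in> B"
proof -
  show 0: "0 \<in> B" and d: "x \<in> B \<Longrightarrow> y \<in> B \<Longrightarrow> x - y \<in> B" for x y
    using assms unfolding add_subgroup_def by blast+
  show "x + y \<in> B" if "x \<in> B" "y \<in> B"
    using d[OF that(1) d[OF 0 that(2)]] by simp
qed

lemma mem_coset_iff: "x \<in> coset B z \<longleftrightarrow> x - z \<in> B"
proof
  assume "x - z \<in> B"
  then have "(x - z) + z \<in> coset B z" unfolding coset_def by (rule imageI)
  then show "x \<in> coset B z" by simp
qed (auto simp: coset_def)

lemma coset_eq_iff: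
  assumes "add_subgroup B" shows "coset B z = coset B w \<longleftrightarrow> z - w \<in> B"
proof
  assume eq: "coset B z = coset B w"
  have "z \<in> coset B z" using add_subgroupD(1)[OF assms] by (simp add: mem_coset_iff)
  then show "z - w \<in> B" unfolding eq mem_coset_iff .
next
  assume zw: "z - w \<in> B"
  have "x - z \<in> B \<longleftrightarrow> x - w \<in> B" for x
    using add_subgroupD(3)[OF assms _ zw, of "x - z"] add_subgroupD(2)[OF assms _ zw, of "x - w"]
    by auto
  then show "coset B z = coset B w" by (auto simp: mem_coset_iff)
qed

text \<open>The image of a coset of \<open>B\<close> is in general only part of a coset of
  \<open>B'\<close>; adding \<open>B'\<close> fills it up. This explains the set product in the
  induced maps of the statement and lets them be computed on representatives.\<close>

lemma set_mult_coset:
  assumes G: "monoid.mult G = (+)" and B: "add_subgroup B" and B': "add_subgroup B'"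
    and f: "Modules.additive f" and fB: "f ` B \<subseteq> B'"
  shows "B' <#>\<^bsub>G\<^esub> (f ` coset B z) = coset B' (f z)"
proof (intro equalityI subsetI)
  fix x assume "x \<in> B' <#>\<^bsub>G\<^esub> (f ` coset B z)"
  then obtain b y where bz: "b \<in> B'" "y - z \<in> B" and x: "x = b + f y"
    unfolding set_mult_def G mem_coset_iff[symmetric] by blast
  have "x - f z = b + f (y - z)" unfolding x additive.diff[OF f] by simp
  with bz fB show "x \<in> coset B' (f z)"
    unfolding mem_coset_iff using add_subgroupD(3)[OF B' bz(1)] by auto
next
  fix x assume "x \<in> coset B' (f z)"
  then have "x - f z \<in> B'" unfolding mem_coset_iff .
  moreover have "z \<in> coset B z" using add_subgroupD(1)[OF B] by (simp add: mem_coset_iff)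
  moreover have "x = (x - f z) + f z" by simp
  ultimately show "x \<in> B' <#>\<^bsub>G\<^esub> (f ` coset B z)"
    unfolding set_mult_def G by blast
qed

lemma mult_coset:
  assumes G: "monoid.mult G = (+)" and B: "add_subgroup B"
  shows "coset B z <#>\<^bsub>G\<^esub> coset B w = coset B (z + w)"
proof (intro equalityI subsetI)
  fix x assume "x \<in> coset B z <#>\<^bsub>G\<^esub> coset B w"
  then obtain y y' where y: "y - z \<in> B" "y' - w \<in> B" and x: "x = y + y'"
    unfolding set_mult_def G mem_coset_iff[symmetric] by blast
  have "x - (z + w) = (y - z) + (y' - w)" unfolding x by simp
  then show "x \<in> coset B (z + w)" unfolding mem_coset_iff using add_subgroupD(3)[OF B y] by (simp only:)
next
  fix x assume "x \<in> coset B (z + w)"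
  then have "x - w \<in> coset B z" unfolding mem_coset_iff by (simp add: diff_diff_add add.commute)
  moreover have "w \<in> coset B w" using add_subgroupD(1)[OF B] by (simp add: mem_coset_iff)
  moreover have "x = (x - w) + w" by simp
  ultimately show "x \<in> coset B z <#>\<^bsub>G\<^esub> coset B w"
    unfolding set_mult_def G by blast
qed

lemma carrier_Mod_coset:
  assumes "monoid.mult G = (+)"
  shows "carrier (G\<lparr>carrier := Z\<rparr> Mod B) = coset B ` Z"
  by (auto simp: FactGroup_def RCOSETS_def r_coset_def coset_def assms)

text \<open>The coefficient is an argument of \<open>F\<close>, additive in it, so signs sit inside
  \<open>F\<close> and the target can be any abelian group. Boundary, cone, chain map, prism and
  evaluation of cochains are all of this form.\<close>

definition linear_extension :: "('a \<Rightarrow> 'c \<Rightarrow> 'b) \<Rightarrow> ('a \<Rightarrow>\<^sub>0 'c::comm_ring_1) \<Rightarrow> 'b::ab_group_add" where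
  "linear_extension F c = (\<Sum>x\<in>Poly_Mapping.keys c. F x (Poly_Mapping.lookup c x))"

lemma additive_linear_extension [intro]:
  fixes F :: "'a \<Rightarrow> 'c::comm_ring_1 \<Rightarrow> 'b::ab_group_add"
  assumes "\<And>x. Modules.additive (F x)"
  shows "Modules.additive (linear_extension F)"
proof
  fix c d :: "'a \<Rightarrow>\<^sub>0 'c"
  have F0: "F x 0 = 0" for x using additive.zero[OF assms] .
  have Fa: "F x (a + b) = F x a + F x b" for x a b using additive.add[OF assms] .
  \<comment> \<open>Cancellation may make the keys of \<open>c + d\<close> smaller than the union,
    so all three sums are taken over \<open>S\<close>, with \<open>F x 0 = 0\<close> on the
    surplus.\<close>
  define S where "S = Poly_Mapping.keys c \<union> Poly_Mapping.keys d"
  have S: "finite S" unfolding S_def by simp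
  have ext: "linear_extension F e = (\<Sum>x\<in>S. F x (Poly_Mapping.lookup e x))"
    if "Poly_Mapping.keys e \<subseteq> S" for e
    unfolding linear_extension_def
    by (rule sum.mono_neutral_left[OF S that]) (auto simp: F0 in_keys_iff)
  have "linear_extension F (c + d) = (\<Sum>x\<in>S. F x (Poly_Mapping.lookup (c + d) x))"
    by (rule ext) (auto simp: S_def dest: set_mp[OF Poly_Mapping.keys_add])
  also have "\<dots> = (\<Sum>x\<in>S. F x (Poly_Mapping.lookup c x)) + (\<Sum>x\<in>S. F x (Poly_Mapping.lookup d x))"
    by (simp add: lookup_add Fa sum.distrib)
  also have "\<dots> = linear_extension F c + linear_extension F d"
    by (simp add: ext S_def)
  finally show "linear_extension F (c + d) = linear_extension F c + linear_extension F d" .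
qed

lemma linear_extension_single:
  assumes "Modules.additive (F x)"
  shows "linear_extension F (Poly_Mapping.single x a) = F x a"
  using additive.zero[OF assms] by (auto simp: linear_extension_def)

lemma additive_expand:
  fixes f :: "('a \<Rightarrow>\<^sub>0 'c::comm_ring_1) \<Rightarrow> 'b::ab_group_add"
  assumes "Modules.additive f"
  shows "f c = (\<Sum>x\<in>Poly_Mapping.keys c. f (Poly_Mapping.single x (Poly_Mapping.lookup c x)))"
proof -
  have "c = (\<Sum>x\<in>Poly_Mapping.keys c. Poly_Mapping.single x (Poly_Mapping.lookup c x))"
    by (rule poly_mapping_eqI)
       (auto simp: lookup_sum lookup_single when_def in_keys_iff sum.delta)
  then have "f c = f (\<Sum>x\<in>Poly_Mapping.keys c. Poly_Mapping.single x (Poly_Mapping.lookup c x))"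
    by simp
  also have "\<dots> = (\<Sum>x\<in>Poly_Mapping.keys c. f (Poly_Mapping.single x (Poly_Mapping.lookup c x)))"
    by (rule additive.sum[OF assms])
  finally show ?thesis .
qed

text \<open>An additive map is determined by its values on single simplices with arbitrary
  coefficient. Testing only the keys of \<open>c\<close> admits identities that hold on the
  simplices of one complex or of one degree.\<close>

lemma additive_eq_on:
  fixes f :: "('a \<Rightarrow>\<^sub>0 'c::comm_ring_1) \<Rightarrow> 'b::ab_group_add"
  assumes "Modules.additive f" "Modules.additive g"
    and "\<And>x a. x \<in> Poly_Mapping.keys c \<Longrightarrow> f (Poly_Mapping.single x a) = g (Poly_Mapping.single x a)"
  shows "f c = g c"
  by (subst additive_expand[OF assms(1)], subst additive_expand[OF assms(2)])
     (rule sum.cong[OF refl assms(3)])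

lemma additive_compose: "Modules.additive f \<Longrightarrow> Modules.additive g \<Longrightarrow> Modules.additive (\<lambda>x. f (g x))"
  by (auto simp: Modules.additive_def)

lemma additive_ident: "Modules.additive (\<lambda>x. x)"
  by (simp add: Modules.additive_def)

lemma additive_diff: "Modules.additive f \<Longrightarrow> Modules.additive g \<Longrightarrow> Modules.additive (\<lambda>x. f x - (g x :: 'b::ab_group_add))"
  by (auto simp: Modules.additive_def)

lemma keys_linear_extension:
  assumes "\<And>x. x \<in> Poly_Mapping.keys c \<Longrightarrow> Poly_Mapping.keys (F x (Poly_Mapping.lookup c x)) \<subseteq> S"
  shows "Poly_Mapping.keys (linear_extension F c) \<subseteq> S"
proof -
  have "Poly_Mapping.keys (linear_extension F c) \<subseteq>
      (\<Union>x\<in>Poly_Mapping.keys c. Poly_Mapping.keys (F x (Poly_Mapping.lookup c x)))"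
    unfolding linear_extension_def by (rule Poly_Mapping.keys_sum)
  then show ?thesis using assms by blast
qed

lemma additive_single: "Modules.additive (\<lambda>a. Poly_Mapping.single x a)"
  by (simp add: Modules.additive_def single_add)

lemma additive_single_mult: "Modules.additive (\<lambda>a. Poly_Mapping.single x (b * a::'c::comm_ring_1))"
  by (simp add: Modules.additive_def single_add algebra_simps)

lemma additive_sum:
  "(\<And>i. i \<in> I \<Longrightarrow> Modules.additive (f i)) \<Longrightarrow> Modules.additive (\<lambda>x. (\<Sum>i\<in>I. f i x :: 'b::ab_group_add))"
  by (auto simp: Modules.additive_def sum.distrib)

section \<open>Boundary, cone and prism operators on ordered chains\<close>

text \<open>The augmented boundary: the boundary of a vertex is the empty list. This makes the prism
  identity provable by recursion on lists.\<close>

definition bd :: "('v list \<Rightarrow>\<^sub>0 'c::comm_ring_1) \<Rightarrow> ('v list \<Rightarrow>\<^sub>0 'c)" where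
  "bd = linear_extension (\<lambda>vs a. \<Sum>i<length vs. Poly_Mapping.single (face i vs) ((-1) ^ i * a))"

text \<open>The cone with apex \<open>v\<close>. By \<open>bd_join\<close> it contracts the
  augmented complex, and every ordered simplex is an iterated cone on the empty list; the inductions
  on lists below rest on this.\<close>

definition join :: "'v \<Rightarrow> ('v list \<Rightarrow>\<^sub>0 'c::comm_ring_1) \<Rightarrow> ('v list \<Rightarrow>\<^sub>0 'c)" where
  "join v = linear_extension (\<lambda>vs a. Poly_Mapping.single (v # vs) a)"

lemma chain_map_linear_extension:
  "chain_map s = linear_extension (\<lambda>vs a. Poly_Mapping.single (map s vs) a)"
  by (rule ext) (simp add: chain_map_def linear_extension_def)

lemma additive_bd [simp]: "Modules.additive bd"
  unfolding bd_def by (intro additive_linear_extension additive_sum additive_single_mult)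

lemma additive_join [simp]: "Modules.additive (join v)"
  unfolding join_def by (intro additive_linear_extension additive_single)

lemma additive_chain_map [simp]: "Modules.additive (chain_map s)"
  unfolding chain_map_linear_extension by (intro additive_linear_extension additive_single)

lemma join_single [simp]: "join v (Poly_Mapping.single vs a) = Poly_Mapping.single (v # vs) a"
  unfolding join_def by (simp add: linear_extension_single additive_single)

lemma chain_map_single [simp]:
  "chain_map s (Poly_Mapping.single vs a) = Poly_Mapping.single (map s vs) a"
  unfolding chain_map_linear_extension by (simp add: linear_extension_single additive_single)

lemma bd_single:
  "bd (Poly_Mapping.single vs a) = (\<Sum>i<length vs. Poly_Mapping.single (face i vs) ((-1) ^ i * a))"
  unfolding bd_def
  by (subst linear_extension_single) (auto intro!: additive_sum additive_single_mult)

lemma bd_single_Nil [simp]: "bd (Poly_Mapping.single [] a) = 0"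
  by (simp add: bd_single)

text \<open>Deleting the head leaves \<open>vs\<close>; deleting a later entry gives a face of
  \<open>vs\<close> behind \<open>v\<close>, with its index raised by one and hence its sign
  reversed.\<close>

lemma bd_single_Cons:
  "bd (Poly_Mapping.single (v # vs) a) =
   Poly_Mapping.single vs a - join v (bd (Poly_Mapping.single vs a))"
proof -
  have "join v (bd (Poly_Mapping.single vs a)) =
      (\<Sum>i<length vs. Poly_Mapping.single (v # face i vs) ((-1) ^ i * a))"
    unfolding bd_single by (simp add: additive.sum[OF additive_join])
  moreover have "bd (Poly_Mapping.single (v # vs) a) =
      Poly_Mapping.single vs a + (\<Sum>i<length vs. Poly_Mapping.single (v # face i vs) (- ((-1) ^ i * a)))"
    unfolding bd_single by (simp add: face_def sum.lessThan_Suc_shift del: sum.lessThan_Suc)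
  ultimately show ?thesis by (simp add: single_uminus sum_negf)
qed

lemma bd_join: "bd (join v c) = c - join v (bd c)"
  by (rule additive_eq_on[where f = "\<lambda>c. bd (join v c)" and g = "\<lambda>c. c - join v (bd c)"])
     (simp_all add: bd_single_Cons additive_ident
       additive_compose[OF additive_bd additive_join] additive_diff
       additive_compose[OF additive_join additive_bd])

lemma chain_map_join: "chain_map s (join v c) = join (s v) (chain_map s c)"
  by (rule additive_eq_on[where f = "\<lambda>c. chain_map s (join v c)"
        and g = "\<lambda>c. join (s v) (chain_map s c)"])
     (simp_all add: additive_compose[OF additive_chain_map additive_join]
       additive_compose[OF additive_join additive_chain_map])

lemma bd_chain_map: "bd (chain_map s c) = chain_map s (bd c)"
proof (rule additive_eq_on[where f = "\<lambda>c. bd (chain_map s c)" and g = "\<lambda>c. chain_map s (bd c)"])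
  fix vs and a :: 'b
  show "bd (chain_map s (Poly_Mapping.single vs a)) = chain_map s (bd (Poly_Mapping.single vs a))"
  proof (induction vs)
    case Nil
    then show ?case by (simp add: additive.zero[OF additive_chain_map])
  next
    case (Cons v vs)
    then show ?case
      by (simp add: bd_single_Cons additive.diff[OF additive_chain_map] chain_map_join)
  qed
qed (intro additive_compose[OF additive_bd additive_chain_map]
    additive_compose[OF additive_chain_map additive_bd])+

text \<open>Unfolded, this is the usual alternating sum over \<open>i\<close> of
  \<open>[s v_0, ..., s v_i, t v_i, ..., t v_n]\<close> with sign \<open>(-1)^i\<close>; the
  subtraction of a cone produces the signs.\<close>

fun prism_simplex :: "('v \<Rightarrow> 'w) \<Rightarrow> ('v \<Rightarrow> 'w) \<Rightarrow> 'v list \<Rightarrow> 'c::comm_ring_1 \<Rightarrow> ('w list \<Rightarrow>\<^sub>0 'c)" where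
  "prism_simplex s t [] a = 0"
| "prism_simplex s t (v # vs) a =
     Poly_Mapping.single (s v # t v # map t vs) a - join (s v) (prism_simplex s t vs a)"

definition prism :: "('v \<Rightarrow> 'w) \<Rightarrow> ('v \<Rightarrow> 'w) \<Rightarrow> ('v list \<Rightarrow>\<^sub>0 'c::comm_ring_1) \<Rightarrow> ('w list \<Rightarrow>\<^sub>0 'c)" where
  "prism s t = linear_extension (prism_simplex s t)"

lemma additive_prism_simplex: "Modules.additive (prism_simplex s t vs)"
proof (induction vs)
  case Nil
  then show ?case by (simp add: Modules.additive_def)
next
  case (Cons v vs)
  show ?case unfolding prism_simplex.simps
    by (intro additive_diff additive_single additive_compose[OF additive_join Cons])
qed

lemma additive_prism [simp]: "Modules.additive (prism s t)"
  unfolding prism_def by (intro additive_linear_extension additive_prism_simplex)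

lemma prism_single [simp]: "prism s t (Poly_Mapping.single vs a) = prism_simplex s t vs a"
  unfolding prism_def by (simp add: linear_extension_single additive_prism_simplex)

lemma prism_join:
  "prism s t (join v c) = join (s v) (join (t v) (chain_map t c)) - join (s v) (prism s t c)"
  by (rule additive_eq_on[where f = "\<lambda>c. prism s t (join v c)"
        and g = "\<lambda>c. join (s v) (join (t v) (chain_map t c)) - join (s v) (prism s t c)"])
     (simp_all add: additive_compose[OF additive_prism additive_join] additive_diff
        additive_compose[OF additive_join additive_compose[OF additive_join additive_chain_map]]
        additive_compose[OF additive_join additive_prism])

lemma bd_prism: "bd (prism s t c) = chain_map t c - chain_map s c - prism s t (bd c)"
proof (rule additive_eq_on[where f = "\<lambda>c. bd (prism s t c)"
      and g = "\<lambda>c. chain_map t c - chain_map s c - prism s t (bd c)"])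
  fix vs and a :: 'b
  let ?s = "\<lambda>vs. Poly_Mapping.single vs a"
  show "bd (prism s t (?s vs)) = chain_map t (?s vs) - chain_map s (?s vs) - prism s t (bd (?s vs))"
  proof (induction vs)
    case Nil
    then show ?case by (simp add: additive.zero[OF additive_bd] additive.zero[OF additive_prism])
  next
    case (Cons v vs)
    \<comment> \<open>Read as a cone \<open>join v X\<close>, the simplex is handled by the cone
      rules and the hypothesis for \<open>X\<close>. The two copies of
      \<open>join (s v) (chain_map t X)\<close> that arise cancel.\<close>
    define X where "X = ?s vs"
    have single_X: "?s (v # vs) = join v X" unfolding X_def by simp
    have IH: "bd (prism s t X) = chain_map t X - chain_map s X - prism s t (bd X)"
      using Cons unfolding X_def .
    have "bd (prism s t (join v X)) =
        join (t v) (chain_map t X) -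
        (join (s v) (chain_map t X) - join (s v) (join (t v) (chain_map t (bd X)))) -
        (prism s t X - (join (s v) (chain_map t X) - join (s v) (chain_map s X)
          - join (s v) (prism s t (bd X))))"
      by (simp only: prism_join additive.diff[OF additive_bd] bd_join bd_chain_map IH
          additive.diff[OF additive_join])
    moreover have "prism s t (bd (join v X)) =
        prism s t X - (join (s v) (join (t v) (chain_map t (bd X))) - join (s v) (prism s t (bd X)))"
      by (simp only: bd_join additive.diff[OF additive_prism] prism_join)
    ultimately show ?case
      unfolding single_X by (simp add: chain_map_join)
  qed
qed (intro additive_compose[OF additive_bd additive_prism] additive_diff additive_chain_map
      additive_compose[OF additive_prism additive_bd])+

lemma keys_join: "Poly_Mapping.keys (join v c) \<subseteq> (#) v ` Poly_Mapping.keys c"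
  unfolding join_def by (rule keys_linear_extension) auto

text \<open>Contiguity makes the images of a simplex under \<open>s\<close> and \<open>t\<close>
  span one simplex of the target; this bound on the vertices then places every list of the prism in
  the target.\<close>

lemma keys_prism_simplex:
  "Poly_Mapping.keys (prism_simplex s t vs a) \<subseteq>
     {ws. length ws = Suc (length vs) \<and> set ws \<subseteq> s ` set vs \<union> t ` set vs}"
proof (induction vs)
  case Nil
  then show ?case by simp
next
  case (Cons v vs)
  show ?case
  proof
    fix ws assume "ws \<in> Poly_Mapping.keys (prism_simplex s t (v # vs) a)"
    then have "ws \<in> Poly_Mapping.keys (Poly_Mapping.single (s v # t v # map t vs) a) \<union>
        Poly_Mapping.keys (join (s v) (prism_simplex s t vs a))"
      using Poly_Mapping.keys_diff[of "Poly_Mapping.single (s v # t v # map t vs) a"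
          "join (s v) (prism_simplex s t vs a)"]
      unfolding prism_simplex.simps by blast
    then have "ws = s v # t v # map t vs \<or> ws \<in> (#) (s v) ` Poly_Mapping.keys (prism_simplex s t vs a)"
      using keys_join[of "s v" "prism_simplex s t vs a"] by (auto split: if_splits)
    then show "ws \<in> {ws. length ws = Suc (length (v # vs)) \<and>
        set ws \<subseteq> s ` set (v # vs) \<union> t ` set (v # vs)}"
      by (fastforce dest: subsetD[OF Cons])
  qed
qed

section \<open>Contiguous maps and simplicial homology\<close>

definition down_closed :: "'v set set \<Rightarrow> bool" where
  "down_closed K \<longleftrightarrow> (\<forall>\<sigma>\<in>K. \<forall>\<tau>. \<tau> \<subseteq> \<sigma> \<and> \<tau> \<noteq> {} \<longrightarrow> \<tau> \<in> K)"

definition simplicial_map :: "('v \<Rightarrow> 'w) \<Rightarrow> 'v set set \<Rightarrow> 'w set set \<Rightarrow> bool" where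
  "simplicial_map s K L \<longleftrightarrow> (\<forall>\<sigma>\<in>K. s ` \<sigma> \<in> L)"

definition contiguous :: "('v \<Rightarrow> 'w) \<Rightarrow> ('v \<Rightarrow> 'w) \<Rightarrow> 'v set set \<Rightarrow> 'w set set \<Rightarrow> bool" where
  "contiguous s t K L \<longleftrightarrow> (\<forall>\<sigma>\<in>K. s ` \<sigma> \<union> t ` \<sigma> \<in> L)"

lemma simplicial_map_ordered_simplices:
  "simplicial_map s K L \<Longrightarrow> vs \<in> ordered_simplices n K \<Longrightarrow> map s vs \<in> ordered_simplices n L"
  by (auto simp: simplicial_map_def ordered_simplices_def)

lemma face_ordered_simplices:
  assumes "down_closed K" "vs \<in> ordered_simplices (Suc n) K" "i \<le> Suc n"
  shows "face i vs \<in> ordered_simplices n K"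
proof -
  have len: "length (face i vs) = Suc n"
    using assms by (auto simp: face_def ordered_simplices_def)
  have "set (face i vs) \<subseteq> set vs"
    by (auto simp: face_def dest: in_set_takeD in_set_dropD)
  moreover have "set (face i vs) \<noteq> {}" using len by (metis length_0_conv nat.distinct(1) set_empty)
  ultimately show ?thesis
    using assms len unfolding down_closed_def ordered_simplices_def by blast
qed

lemma map_face: "map s (face i vs) = face i (map s vs)"
  by (simp add: face_def take_map drop_map)

lemma chain_group_mult: "monoid.mult (chain_group n K) = (+)"
  by (simp add: chain_group_def)

lemma mem_chains_iff:
  "c \<in> carrier (chain_group n K) \<longleftrightarrow> Poly_Mapping.keys c \<subseteq> ordered_simplices n K"
  by (simp add: chain_group_def)

text \<open>\<open>boundary\<close> vanishes in degree 0, where \<open>bd\<close> yields the empty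
  list, so the two are compared in positive degree. There the degree fixes the length of the lists
  and with it the range of the sum.\<close>

lemma boundary_Suc_eq_bd:
  assumes "c \<in> carrier (chain_group (Suc n) K)" shows "boundary (Suc n) c = bd c"
proof -
  have "length vs = Suc (Suc n)" if "vs \<in> Poly_Mapping.keys c" for vs
    using assms that unfolding mem_chains_iff ordered_simplices_def by blast
  then show ?thesis
    unfolding boundary_def bd_def linear_extension_def
    by (simp only: nat.distinct if_False lessThan_Suc_atMost cong: sum.cong)
qed

lemma boundaries_eq: "boundaries n K = bd ` carrier (chain_group (Suc n) K)"
  unfolding boundaries_def using boundary_Suc_eq_bd by (rule image_cong[OF refl])

lemma add_subgroup_chains: "add_subgroup (carrier (chain_group n K))"
  by (auto simp: add_subgroup_def mem_chains_iff dest!: subsetD[OF Poly_Mapping.keys_diff])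

lemma add_subgroup_image:
  assumes "Modules.additive f" "add_subgroup B" shows "add_subgroup (f ` B)"
  unfolding add_subgroup_def
proof (intro conjI ballI)
  show "0 \<in> f ` B" using add_subgroupD(1)[OF assms(2)] additive.zero[OF assms(1)] by force
  fix x y assume "x \<in> f ` B" "y \<in> f ` B"
  then obtain a b where "a \<in> B" "b \<in> B" "x = f a" "y = f b" by blast
  then have "x - y = f (a - b)" "a - b \<in> B"
    using additive.diff[OF assms(1)] add_subgroupD(2)[OF assms(2)] by auto
  then show "x - y \<in> f ` B" by blast
qed

lemma add_subgroup_boundaries: "add_subgroup (boundaries n K)"
  unfolding boundaries_eq by (rule add_subgroup_image[OF additive_bd add_subgroup_chains])

lemma chain_map_chains:
  assumes "simplicial_map s K L" "c \<in> carrier (chain_group n K)"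
  shows "chain_map s c \<in> carrier (chain_group n L)"
  unfolding mem_chains_iff chain_map_linear_extension
proof (rule keys_linear_extension)
  fix vs assume "vs \<in> Poly_Mapping.keys c"
  then have "map s vs \<in> ordered_simplices n L"
    using assms simplicial_map_ordered_simplices unfolding mem_chains_iff by blast
  then show "Poly_Mapping.keys (Poly_Mapping.single (map s vs) (Poly_Mapping.lookup c vs))
      \<subseteq> ordered_simplices n L" by simp
qed

lemma chain_map_cycles:
  assumes "simplicial_map s K L" "z \<in> cycles n K" shows "chain_map s z \<in> cycles n L"
proof -
  have c: "z \<in> carrier (chain_group n K)" and b: "boundary n z = 0"
    using assms unfolding cycles_def by auto
  have c': "chain_map s z \<in> carrier (chain_group n L)" by (rule chain_map_chains[OF assms(1) c])
  have "boundary n (chain_map s z) = 0"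
  proof (cases n)
    case 0
    then show ?thesis by (simp add: boundary_def)
  next
    case (Suc m)
    then have "bd z = 0" using b boundary_Suc_eq_bd c by metis
    then have "bd (chain_map s z) = 0"
      by (simp add: bd_chain_map additive.zero[OF additive_chain_map])
    then show ?thesis using boundary_Suc_eq_bd c' Suc by metis
  qed
  with c' show ?thesis unfolding cycles_def by blast
qed

lemma chain_map_boundaries:
  assumes "simplicial_map s K L" shows "chain_map s ` boundaries n K \<subseteq> boundaries n L"
proof
  fix x assume "x \<in> chain_map s ` boundaries n K"
  then obtain c where "c \<in> carrier (chain_group (Suc n) K)" "x = bd (chain_map s c)"
    unfolding boundaries_eq by (auto simp: bd_chain_map)
  then show "x \<in> boundaries n L"
    unfolding boundaries_eq using chain_map_chains[OF assms] by blast
qed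

text \<open>In positive degree \<open>bd z = 0\<close>. In degree 0 the augmented boundary is a
  multiple of the empty list, which the prism sends to 0 by definition.\<close>

lemma prism_bd_cycle:
  assumes "z \<in> cycles n K" shows "prism s t (bd z) = 0"
proof (cases n)
  case 0
  show ?thesis
  proof (rule additive_eq_on[where f = "\<lambda>z. prism s t (bd z)" and g = "\<lambda>z. 0"])
    fix vs and a :: 'b assume "vs \<in> Poly_Mapping.keys z"
    then have "length vs = Suc 0"
      using assms 0 unfolding cycles_def mem_chains_iff ordered_simplices_def by auto
    then obtain v where "vs = [v]" by (auto simp: length_Suc_conv)
    then show "prism s t (bd (Poly_Mapping.single vs a)) = 0"
      by (simp add: bd_single_Cons additive.zero[OF additive_join])
  qed (intro additive_compose[OF additive_prism additive_bd], simp add: Modules.additive_def)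
next
  case (Suc m)
  then have "bd z = 0" using assms boundary_Suc_eq_bd unfolding cycles_def by fastforce
  then show ?thesis by (simp add: additive.zero[OF additive_prism])
qed

lemma prism_chains:
  assumes "contiguous s t K L" "down_closed L" "c \<in> carrier (chain_group n K)"
  shows "prism s t c \<in> carrier (chain_group (Suc n) L)"
  unfolding mem_chains_iff prism_def
proof (rule keys_linear_extension)
  fix vs assume "vs \<in> Poly_Mapping.keys c"
  then have vs: "vs \<in> ordered_simplices n K" using assms unfolding mem_chains_iff by blast
  then have st: "s ` set vs \<union> t ` set vs \<in> L"
    using assms unfolding contiguous_def ordered_simplices_def by blast
  show "Poly_Mapping.keys (prism_simplex s t vs (Poly_Mapping.lookup c vs))
      \<subseteq> ordered_simplices (Suc n) L"
  proof
    fix ws assume "ws \<in> Poly_Mapping.keys (prism_simplex s t vs (Poly_Mapping.lookup c vs))"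
    then have ws: "length ws = Suc (length vs)" "set ws \<subseteq> s ` set vs \<union> t ` set vs"
      using keys_prism_simplex by blast+
    then have "set ws \<noteq> {}" by auto
    with ws st assms(2) have "set ws \<in> L" unfolding down_closed_def by blast
    with ws vs show "ws \<in> ordered_simplices (Suc n) L" by (simp add: ordered_simplices_def)
  qed
qed

lemma carrier_simplicial_homology:
  "carrier (simplicial_homology n K) = coset (boundaries n K) ` cycles n K"
  unfolding simplicial_homology_def by (rule carrier_Mod_coset[OF chain_group_mult])

lemma simplicial_homology_induced_coset:
  assumes "simplicial_map s K L"
  shows "simplicial_homology_induced n L s (coset (boundaries n K) z) =
         coset (boundaries n L) (chain_map s z)"
  unfolding simplicial_homology_induced_def
  by (rule set_mult_coset[OF chain_group_mult add_subgroup_boundaries add_subgroup_boundaries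
        additive_chain_map chain_map_boundaries[OF assms]])

lemma simplicial_homology_induced_closed:
  assumes "simplicial_map s K L" "A \<in> carrier (simplicial_homology n K)"
  shows "simplicial_homology_induced n L s A \<in> carrier (simplicial_homology n L)"
  using assms(2) unfolding carrier_simplicial_homology
  by (auto simp: simplicial_homology_induced_coset[OF assms(1)] intro: chain_map_cycles[OF assms(1)])

lemma chain_map_compose: "chain_map t (chain_map s c) = chain_map (t \<circ> s) c"
  by (rule additive_eq_on[where f = "\<lambda>c. chain_map t (chain_map s c)"])
     (simp_all add: comp_def additive_compose[OF additive_chain_map additive_chain_map])

lemma simplicial_map_compose:
  "simplicial_map s K L \<Longrightarrow> simplicial_map t L M \<Longrightarrow> simplicial_map (t \<circ> s) K M"
  unfolding simplicial_map_def image_comp[symmetric] by blast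

lemma simplicial_homology_induced_compose:
  assumes "simplicial_map s K L" "simplicial_map t L M" "A \<in> carrier (simplicial_homology n K)"
  shows "simplicial_homology_induced n M t (simplicial_homology_induced n L s A) =
         simplicial_homology_induced n M (t \<circ> s) A"
  using assms(3) simplicial_map_compose[OF assms(1,2)] assms(1,2)
  unfolding carrier_simplicial_homology
  by (auto simp: simplicial_homology_induced_coset chain_map_compose)

lemma contiguous_imp_simplicial_map:
  assumes "contiguous s t K L" "down_closed L" "{} \<notin> K"
  shows "simplicial_map s K L" "simplicial_map t K L"
  using assms unfolding contiguous_def down_closed_def simplicial_map_def
  by (metis Un_upper1 image_is_empty, metis Un_upper2 image_is_empty)

text \<open>The prism of a cycle bounds the difference of its two images.\<close>

lemma simplicial_homology_induced_contiguous:
  assumes "contiguous s t K L" "down_closed L" "{} \<notin> K" "A \<in> carrier (simplicial_homology n K)"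
  shows "simplicial_homology_induced n L s A = simplicial_homology_induced n L t A"
proof -
  note st = contiguous_imp_simplicial_map[OF assms(1-3)]
  obtain z where z: "z \<in> cycles n K" "A = coset (boundaries n K) z"
    using assms(4) unfolding carrier_simplicial_homology by blast
  have "chain_map t z - chain_map s z = bd (prism s t z)"
    by (simp add: bd_prism prism_bd_cycle[OF z(1)])
  moreover have "prism s t z \<in> carrier (chain_group (Suc n) L)"
    using prism_chains[OF assms(1,2)] z(1) unfolding cycles_def by blast
  ultimately have "chain_map t z - chain_map s z \<in> boundaries n L"
    unfolding boundaries_eq by blast
  then show ?thesis
    unfolding z simplicial_homology_induced_coset[OF st(1)] simplicial_homology_induced_coset[OF st(2)]
    using coset_eq_iff[OF add_subgroup_boundaries] by metis
qed

lemma chain_map_id_on: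
  assumes "c \<in> carrier (chain_group n K)" "\<And>v. v \<in> \<Union>K \<Longrightarrow> s v = v"
  shows "chain_map s c = c"
proof (rule additive_eq_on[OF additive_chain_map additive_ident])
  fix vs and a :: 'b assume "vs \<in> Poly_Mapping.keys c"
  then have "set vs \<in> K" using assms unfolding mem_chains_iff ordered_simplices_def by blast
  then have "map s vs = vs" using assms(2) by (auto intro!: map_idI)
  then show "chain_map s (Poly_Mapping.single vs a) = Poly_Mapping.single vs a" by simp
qed

lemma simplicial_homology_induced_id:
  assumes "\<And>v. v \<in> \<Union>K \<Longrightarrow> s v = v" "A \<in> carrier (simplicial_homology n K)"
  shows "simplicial_homology_induced n K s A = A"
proof -
  have "simplicial_map s K K"
    unfolding simplicial_map_def
  proof
    fix \<sigma> assume "\<sigma> \<in> K"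
    then have "s ` \<sigma> = \<sigma>" using assms(1) by force
    with \<open>\<sigma> \<in> K\<close> show "s ` \<sigma> \<in> K" by simp
  qed
  moreover obtain z where "z \<in> cycles n K" "A = coset (boundaries n K) z"
    using assms(2) unfolding carrier_simplicial_homology by blast
  ultimately show ?thesis
    using chain_map_id_on[of z n K s] assms(1)
    by (simp add: simplicial_homology_induced_coset cycles_def)
qed

section \<open>Simplicial cohomology\<close>

text \<open>Evaluation of cochains on chains. It turns \<open>coboundary\<close> into
  \<open>bd\<close>, so that the prism identity for chains can be dualized instead of proved
  again.\<close>

definition pairing :: "('v list \<Rightarrow> int) \<Rightarrow> ('v list \<Rightarrow>\<^sub>0 int) \<Rightarrow> int" where
  "pairing \<phi> = linear_extension (\<lambda>vs a. \<phi> vs * a)"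

lemma additive_pairing [simp]: "Modules.additive (pairing \<phi>)"
  unfolding pairing_def
  by (intro additive_linear_extension) (simp add: Modules.additive_def algebra_simps)

lemma pairing_single [simp]: "pairing \<phi> (Poly_Mapping.single vs a) = \<phi> vs * a"
  unfolding pairing_def
  by (rule linear_extension_single) (simp add: Modules.additive_def algebra_simps)

text \<open>Serves to compare a cochain composed with the prism at coefficient \<open>a\<close> with
  its value at coefficient 1.\<close>

lemma additive_int_eq_mult:
  fixes f :: "int \<Rightarrow> int" assumes "Modules.additive f" shows "f a = f 1 * a"
proof (induction a rule: int_induct[where k = 0])
  case base
  then show ?case using additive.zero[OF assms] by simp
next
  case (step1 i)
  then show ?case using additive.add[OF assms, of i 1] by (simp add: algebra_simps)
next
  case (step2 i)
  then show ?case using additive.diff[OF assms, of i 1] by (simp add: algebra_simps)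
qed

lemma pairing_bd_single:
  assumes "length vs = Suc (Suc n)"
  shows "pairing \<phi> (bd (Poly_Mapping.single vs a)) = (\<Sum>i\<le>Suc n. (-1) ^ i * \<phi> (face i vs)) * a"
  unfolding bd_single additive.sum[OF additive_pairing] assms lessThan_Suc_atMost sum_distrib_right
  by (rule sum.cong) auto

lemma coboundary_eq_pairing:
  assumes "vs \<in> ordered_simplices (Suc n) K"
  shows "coboundary n K \<phi> vs = pairing \<phi> (bd (Poly_Mapping.single vs 1))"
  using assms pairing_bd_single[of vs n \<phi> 1] by (simp add: coboundary_def ordered_simplices_def)

lemma cochain_group_mult: "monoid.mult (cochain_group n K) = (+)"
  by (simp add: cochain_group_def fun_eq_iff)

lemma mem_cochains_iff:
  "\<phi> \<in> carrier (cochain_group n K) \<longleftrightarrow> (\<forall>vs. vs \<notin> ordered_simplices n K \<longrightarrow> \<phi> vs = 0)"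
  by (simp add: cochain_group_def)

lemma add_subgroup_cochains: "add_subgroup (carrier (cochain_group n K))"
  by (simp add: add_subgroup_def mem_cochains_iff)

lemma additive_coboundary: "Modules.additive (coboundary n K)"
  by (auto simp: Modules.additive_def coboundary_def algebra_simps sum.distrib
      simp del: sum.atMost_Suc)

lemma additive_cochain_map: "Modules.additive (cochain_map n K s)"
  by (auto simp: Modules.additive_def cochain_map_def)

lemma add_subgroup_coboundaries: "add_subgroup (coboundaries n K)"
proof (cases n)
  case 0
  then show ?thesis by (simp add: coboundaries_def add_subgroup_def zero_fun_def fun_diff_def)
next
  case (Suc m)
  then show ?thesis
    by (simp add: coboundaries_def add_subgroup_image[OF additive_coboundary add_subgroup_cochains])
qed

text \<open>Cochains are cut off to 0 outside the complex. Down-closure of \<open>K\<close> keeps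
  the faces inside it, where \<open>cochain_map\<close> really is composition with
  \<open>s\<close>.\<close>

lemma coboundary_cochain_map:
  assumes "simplicial_map s K L" "down_closed K"
  shows "coboundary n K (cochain_map n K s \<phi>) = cochain_map (Suc n) K s (coboundary n L \<phi>)"
proof
  fix vs
  show "coboundary n K (cochain_map n K s \<phi>) vs = cochain_map (Suc n) K s (coboundary n L \<phi>) vs"
  proof (cases "vs \<in> ordered_simplices (Suc n) K")
    case True
    have "(\<Sum>i\<le>Suc n. (-1) ^ i * cochain_map n K s \<phi> (face i vs)) =
        (\<Sum>i\<le>Suc n. (-1) ^ i * \<phi> (face i (map s vs)))"
      by (rule sum.cong)
         (auto simp: cochain_map_def face_ordered_simplices[OF assms(2) True] map_face)
    with True simplicial_map_ordered_simplices[OF assms(1) True] show ?thesis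
      by (simp add: coboundary_def cochain_map_def del: sum.atMost_Suc)
  next
    case False
    then show ?thesis by (simp add: coboundary_def cochain_map_def)
  qed
qed

lemma cochain_map_cochains: "cochain_map n K s \<phi> \<in> carrier (cochain_group n K)"
  by (simp add: mem_cochains_iff cochain_map_def)

lemma cochain_map_cocycles:
  assumes "simplicial_map s K L" "down_closed K" "\<phi> \<in> cocycles n L"
  shows "cochain_map n K s \<phi> \<in> cocycles n K"
proof -
  have "coboundary n K (cochain_map n K s \<phi>) = (\<lambda>vs. 0)"
    unfolding coboundary_cochain_map[OF assms(1,2)]
    using assms(3) by (simp add: cocycles_def cochain_map_def)
  then show ?thesis by (simp add: cocycles_def cochain_map_cochains)
qed

lemma cochain_map_coboundaries:
  assumes "simplicial_map s K L" "down_closed K"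
  shows "cochain_map n K s ` coboundaries n L \<subseteq> coboundaries n K"
proof (cases n)
  case 0
  then show ?thesis by (auto simp: coboundaries_def cochain_map_def)
next
  case (Suc m)
  then show ?thesis
    using coboundary_cochain_map[OF assms, symmetric] cochain_map_cochains
    by (auto simp: coboundaries_def intro!: imageI)
qed

lemma carrier_simplicial_cohomology:
  "carrier (simplicial_cohomology n K) = coset (coboundaries n K) ` cocycles n K"
  unfolding simplicial_cohomology_def by (rule carrier_Mod_coset[OF cochain_group_mult])

lemma simplicial_cohomology_induced_coset:
  assumes "simplicial_map s K L" "down_closed K"
  shows "simplicial_cohomology_induced n K s (coset (coboundaries n L) \<phi>) =
         coset (coboundaries n K) (cochain_map n K s \<phi>)"
  unfolding simplicial_cohomology_induced_def
  by (rule set_mult_coset[OF cochain_group_mult add_subgroup_coboundaries add_subgroup_coboundaries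
        additive_cochain_map cochain_map_coboundaries[OF assms]])

lemma simplicial_cohomology_induced_closed:
  assumes "simplicial_map s K L" "down_closed K" "A \<in> carrier (simplicial_cohomology n L)"
  shows "simplicial_cohomology_induced n K s A \<in> carrier (simplicial_cohomology n K)"
  using assms(3) unfolding carrier_simplicial_cohomology
  by (auto simp: simplicial_cohomology_induced_coset[OF assms(1,2)]
      intro: cochain_map_cocycles[OF assms(1,2)])

lemma cochain_map_compose:
  assumes "simplicial_map s K L"
  shows "cochain_map n K s (cochain_map n L t \<phi>) = cochain_map n K (t \<circ> s) \<phi>"
  using simplicial_map_ordered_simplices[OF assms] by (auto simp: cochain_map_def)

lemma simplicial_cohomology_induced_compose:
  assumes "simplicial_map s K L" "simplicial_map t L M" "down_closed K" "down_closed L"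
    "A \<in> carrier (simplicial_cohomology n M)"
  shows "simplicial_cohomology_induced n K s (simplicial_cohomology_induced n L t A) =
         simplicial_cohomology_induced n K (t \<circ> s) A"
  using assms(5) simplicial_map_compose[OF assms(1,2)] assms(1-4)
  unfolding carrier_simplicial_cohomology
  by (auto simp: simplicial_cohomology_induced_coset cochain_map_compose)

lemma simplicial_cohomology_induced_mult:
  assumes "simplicial_map s K L" "down_closed K"
    "A \<in> carrier (simplicial_cohomology n L)" "B \<in> carrier (simplicial_cohomology n L)"
  shows "simplicial_cohomology_induced n K s (A \<otimes>\<^bsub>simplicial_cohomology n L\<^esub> B) =
         simplicial_cohomology_induced n K s A \<otimes>\<^bsub>simplicial_cohomology n K\<^esub>
         simplicial_cohomology_induced n K s B"
proof -
  have m: "coset (coboundaries n J) x \<otimes>\<^bsub>simplicial_cohomology n J\<^esub> coset (coboundaries n J) y =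
      coset (coboundaries n J) (x + y)" for J :: "'x set set" and x y
    unfolding simplicial_cohomology_def FactGroup_def
    by (simp add: mult_coset[OF cochain_group_mult add_subgroup_coboundaries])
  obtain x y where "A = coset (coboundaries n L) x" "B = coset (coboundaries n L) y"
    using assms(3,4) unfolding carrier_simplicial_cohomology by blast
  then show ?thesis
    by (simp add: m simplicial_cohomology_induced_coset[OF assms(1,2)]
        additive.add[OF additive_cochain_map])
qed

lemma simplicial_cohomology_mult_closed:
  assumes "A \<in> carrier (simplicial_cohomology n K)" "B \<in> carrier (simplicial_cohomology n K)"
  shows "A \<otimes>\<^bsub>simplicial_cohomology n K\<^esub> B \<in> carrier (simplicial_cohomology n K)"
proof -
  obtain x y where x: "x \<in> cocycles n K" "A = coset (coboundaries n K) x"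
    and y: "y \<in> cocycles n K" "B = coset (coboundaries n K) y"
    using assms unfolding carrier_simplicial_cohomology by blast
  have "x + y \<in> cocycles n K"
    using x(1) y(1) add_subgroupD(3)[OF add_subgroup_cochains]
    by (auto simp: cocycles_def additive.add[OF additive_coboundary])
  moreover have "A \<otimes>\<^bsub>simplicial_cohomology n K\<^esub> B = coset (coboundaries n K) (x + y)"
    unfolding simplicial_cohomology_def FactGroup_def x(2) y(2)
    by (simp add: mult_coset[OF cochain_group_mult add_subgroup_coboundaries])
  ultimately show ?thesis unfolding carrier_simplicial_cohomology by blast
qed

lemma pairing_cocycle_bd:
  assumes "\<phi> \<in> cocycles n L" "c \<in> carrier (chain_group (Suc n) L)"
  shows "pairing \<phi> (bd c) = 0"
proof (rule additive_eq_on[where f = "\<lambda>c. pairing \<phi> (bd c)" and g = "\<lambda>c. 0"])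
  fix vs and a :: int assume "vs \<in> Poly_Mapping.keys c"
  then have vs: "vs \<in> ordered_simplices (Suc n) L" using assms(2) unfolding mem_chains_iff by blast
  have "coboundary n L \<phi> vs = 0" using assms(1) by (simp add: cocycles_def)
  then show "pairing \<phi> (bd (Poly_Mapping.single vs a)) = 0"
    using vs pairing_bd_single[of vs n \<phi> a]
    by (simp add: coboundary_def ordered_simplices_def del: sum.atMost_Suc)
qed (intro additive_compose[OF additive_pairing additive_bd], simp add: Modules.additive_def)

lemma bd_single_chains:
  assumes "down_closed K" "vs \<in> ordered_simplices (Suc n) K"
  shows "bd (Poly_Mapping.single vs a) \<in> carrier (chain_group n K)"
proof -
  have "bd (Poly_Mapping.single vs a) =
      (\<Sum>i\<le>Suc n. Poly_Mapping.single (face i vs) ((-1) ^ i * a))"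
    unfolding bd_single using assms(2) by (simp only: ordered_simplices_def mem_Collect_eq lessThan_Suc_atMost)
  also have "Poly_Mapping.keys \<dots> \<subseteq>
      (\<Union>i\<in>{..Suc n}. Poly_Mapping.keys (Poly_Mapping.single (face i vs) ((-1) ^ i * a)))"
    by (rule Poly_Mapping.keys_sum)
  also have "\<dots> \<subseteq> ordered_simplices n K"
    using face_ordered_simplices[OF assms] by (auto split: if_splits)
  finally show ?thesis unfolding mem_chains_iff .
qed

text \<open>Dual of the prism homotopy: a cocycle kills boundaries, so the difference of the
  pullbacks at \<open>vs\<close> is \<phi> on the prism of the boundary of \<open>vs\<close>, which
  is the coboundary of \<phi> composed with the prism.\<close>

lemma cochain_map_contiguous:
  assumes st: "contiguous s t K L" and K: "down_closed K" and L: "down_closed L"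
    and \<phi>: "\<phi> \<in> cocycles n L"
  shows "cochain_map n K t \<phi> - cochain_map n K s \<phi> \<in> coboundaries n K"
proof -
  have diff: "\<phi> (map t vs) - \<phi> (map s vs) = pairing \<phi> (prism s t (bd (Poly_Mapping.single vs 1)))"
    if "vs \<in> ordered_simplices n K" for vs
  proof -
    let ?c = "Poly_Mapping.single vs (1 :: int)"
    have "?c \<in> carrier (chain_group n K)" using that by (simp add: mem_chains_iff)
    then have "pairing \<phi> (bd (prism s t ?c)) = 0"
      by (intro pairing_cocycle_bd[OF \<phi>] prism_chains[OF st L])
    then have "pairing \<phi> (chain_map t ?c) - pairing \<phi> (chain_map s ?c) - pairing \<phi> (prism s t (bd ?c)) = 0"
      unfolding bd_prism by (simp only: additive.diff[OF additive_pairing])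
    then show ?thesis by simp
  qed
  show ?thesis
  proof (cases n)
    case 0
    \<comment> \<open>Only 0 is a coboundary in degree 0. The difference vanishes because the
      augmented boundary of a vertex is the empty list, whose prism is 0.\<close>
    have "cochain_map n K t \<phi> - cochain_map n K s \<phi> = (\<lambda>vs. 0)"
    proof
      fix vs show "(cochain_map n K t \<phi> - cochain_map n K s \<phi>) vs = 0"
      proof (cases "vs \<in> ordered_simplices n K")
        case True
        then have "length vs = Suc 0" using 0 by (simp add: ordered_simplices_def)
        then obtain v where "vs = [v]" by (auto simp: length_Suc_conv)
        then show ?thesis using True diff[OF True]
          by (simp add: cochain_map_def bd_single_Cons additive.zero[OF additive_join]
              additive.zero[OF additive_pairing])
      qed (simp add: cochain_map_def)
    qed
    then show ?thesis using 0 by (simp add: coboundaries_def)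
  next
    case (Suc m)
    define \<psi> where
      "\<psi> ws = (if ws \<in> ordered_simplices m K then pairing \<phi> (prism_simplex s t ws 1) else 0)" for ws
    have pair: "pairing \<psi> c = pairing \<phi> (prism s t c)" if "c \<in> carrier (chain_group m K)" for c
    proof (rule additive_eq_on[where f = "pairing \<psi>" and g = "\<lambda>c. pairing \<phi> (prism s t c)"])
      fix ws and a :: int assume "ws \<in> Poly_Mapping.keys c"
      then have "ws \<in> ordered_simplices m K" using that unfolding mem_chains_iff by blast
      then show "pairing \<psi> (Poly_Mapping.single ws a) = pairing \<phi> (prism s t (Poly_Mapping.single ws a))"
        using additive_int_eq_mult[OF additive_compose[OF additive_pairing[of \<phi>]
              additive_prism_simplex[of s t ws]], of a]
        by (simp add: \<psi>_def)
    qed (intro additive_pairing additive_compose[OF additive_pairing additive_prism])+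
    have "cochain_map n K t \<phi> - cochain_map n K s \<phi> = coboundary m K \<psi>"
    proof
      fix vs show "(cochain_map n K t \<phi> - cochain_map n K s \<phi>) vs = coboundary m K \<psi> vs"
      proof (cases "vs \<in> ordered_simplices n K")
        case True
        then have vs: "vs \<in> ordered_simplices (Suc m) K" using Suc by simp
        show ?thesis
          using True diff[OF True] pair[OF bd_single_chains[OF K vs]] coboundary_eq_pairing[OF vs]
          by (simp add: cochain_map_def)
      next
        case False
        then show ?thesis using Suc by (simp add: cochain_map_def coboundary_def)
      qed
    qed
    moreover have "\<psi> \<in> carrier (cochain_group m K)" by (simp add: mem_cochains_iff \<psi>_def)
    ultimately show ?thesis using Suc by (simp add: coboundaries_def)
  qed
qed

lemma simplicial_cohomology_induced_contiguous:
  assumes "contiguous s t K L" "down_closed K" "down_closed L" "{} \<notin> K"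
    "A \<in> carrier (simplicial_cohomology n L)"
  shows "simplicial_cohomology_induced n K s A = simplicial_cohomology_induced n K t A"
proof -
  note st = contiguous_imp_simplicial_map[OF assms(1,3,4)]
  obtain \<phi> where \<phi>: "\<phi> \<in> cocycles n L" "A = coset (coboundaries n L) \<phi>"
    using assms(5) unfolding carrier_simplicial_cohomology by blast
  show ?thesis
    unfolding \<phi>(2) simplicial_cohomology_induced_coset[OF st(1) assms(2)]
      simplicial_cohomology_induced_coset[OF st(2) assms(2)]
    using coset_eq_iff[OF add_subgroup_coboundaries] cochain_map_contiguous[OF assms(1-3) \<phi>(1)]
    by metis
qed

lemma simplicial_cohomology_induced_id:
  assumes "\<And>v. v \<in> \<Union>K \<Longrightarrow> s v = v" "down_closed K" "A \<in> carrier (simplicial_cohomology n K)"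
  shows "simplicial_cohomology_induced n K s A = A"
proof -
  have "simplicial_map s K K"
    unfolding simplicial_map_def
  proof
    fix \<sigma> assume "\<sigma> \<in> K"
    then have "s ` \<sigma> = \<sigma>" using assms(1) by force
    with \<open>\<sigma> \<in> K\<close> show "s ` \<sigma> \<in> K" by simp
  qed
  moreover obtain \<phi> where \<phi>: "\<phi> \<in> cocycles n K" "A = coset (coboundaries n K) \<phi>"
    using assms(3) unfolding carrier_simplicial_cohomology by blast
  moreover have "cochain_map n K s \<phi> = \<phi>"
  proof
    fix vs show "cochain_map n K s \<phi> vs = \<phi> vs"
    proof (cases "vs \<in> ordered_simplices n K")
      case True
      then have "map s vs = vs" using assms(1) by (auto intro!: map_idI simp: ordered_simplices_def)
      with True show ?thesis by (simp add: cochain_map_def)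
    next
      case False
      then show ?thesis using \<phi>(1) by (simp add: cochain_map_def cocycles_def mem_cochains_iff)
    qed
  qed
  ultimately show ?thesis by (simp add: simplicial_cohomology_induced_coset assms(2))
qed

section \<open>Vertex maps between covers\<close>

lemma down_closed_nerve: "down_closed (nerve U)"
  unfolding down_closed_def
proof (intro ballI allI impI)
  fix \<sigma> \<tau> assume \<sigma>: "\<sigma> \<in> nerve U" and \<tau>: "\<tau> \<subseteq> \<sigma> \<and> \<tau> \<noteq> {}"
  then have "\<Inter>\<sigma> \<subseteq> \<Inter>\<tau>" by (intro Inter_anti_mono) blast
  with \<sigma> \<tau> show "\<tau> \<in> nerve U" using finite_subset[of \<tau> \<sigma>] by (auto simp: nerve_def)
qed

lemma empty_notin_nerve: "{} \<notin> nerve U"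
  by (simp add: nerve_def)

text \<open>If \<open>x\<close> lies in all members of a simplex, then \<open>f x\<close> lies in
  all their images under both vertex maps.\<close>

lemma carries_contiguous:
  assumes "carries f V U s" "carries f V U t" shows "contiguous s t (nerve V) (nerve U)"
  unfolding contiguous_def
proof
  fix \<sigma> assume "\<sigma> \<in> nerve V"
  then obtain x where \<sigma>: "finite \<sigma>" "\<sigma> \<noteq> {}" "\<sigma> \<subseteq> V" "\<And>v. v \<in> \<sigma> \<Longrightarrow> x \<in> v"
    unfolding nerve_def by blast
  have "f x \<in> \<Inter>(s ` \<sigma> \<union> t ` \<sigma>)"
    using \<sigma>(3,4) assms unfolding carries_def by blast
  moreover have "s ` \<sigma> \<union> t ` \<sigma> \<subseteq> U" using \<sigma>(3) assms unfolding carries_def by blast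
  ultimately show "s ` \<sigma> \<union> t ` \<sigma> \<in> nerve U" using \<sigma>(1,2) unfolding nerve_def by blast
qed

lemma carries_simplicial_map: "carries f V U s \<Longrightarrow> simplicial_map s (nerve V) (nerve U)"
  using contiguous_imp_simplicial_map(1)[OF carries_contiguous down_closed_nerve empty_notin_nerve]
  by blast

lemma carries_compose: "carries f V U s \<Longrightarrow> carries g U W t \<Longrightarrow> carries (g \<circ> f) V W (t \<circ> s)"
  unfolding carries_def image_comp[symmetric] by (simp, blast)

lemma carries_refine: "carries id V U s \<Longrightarrow> carries g U W t \<Longrightarrow> carries g V W (t \<circ> s)"
  using carries_compose[of id V U s g W t] by simp

lemma carries_coarsen: "carries f V U s \<Longrightarrow> carries id U W t \<Longrightarrow> carries f V W (t \<circ> s)"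
  using carries_compose[of f V U s id W t] by simp

text \<open>Different members of \<open>U\<close> may have the same preimage, so the vertex map back
  involves a choice. All later arguments draw on the carrying property alone.\<close>

lemma carries_preimage_cover_map: "carries f (preimage_cover X f U) U (preimage_cover_map X f U)"
  unfolding carries_def
proof
  fix v assume "v \<in> preimage_cover X f U"
  then have "\<exists>u. u \<in> U \<and> {x \<in> topspace X. f x \<in> u} = v" by (auto simp: preimage_cover_def)
  then have "preimage_cover_map X f U v \<in> U \<and>
      {x \<in> topspace X. f x \<in> preimage_cover_map X f U v} = v"
    unfolding preimage_cover_map_def by (rule someI_ex)
  then show "preimage_cover_map X f U v \<in> U \<and> f ` v \<subseteq> preimage_cover_map X f U v" by blast
qed

lemma preimage_open_cover:
  assumes "continuous_map X Y f" "U \<in> open_covers Y"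
  shows "preimage_cover X f U \<in> open_covers X"
proof -
  have "openin X {x \<in> topspace X. f x \<in> u}" if "u \<in> U" for u
    using assms that by (auto simp: open_covers_def continuous_map_def)
  moreover have "\<exists>u\<in>U. f x \<in> u" if "x \<in> topspace X" for x
    using assms that by (auto simp: open_covers_def continuous_map_def Pi_iff)
  ultimately show ?thesis by (auto simp: open_covers_def preimage_cover_def)
qed

lemma carries_id_on:
  assumes "U \<in> open_covers X" "\<And>x. x \<in> topspace X \<Longrightarrow> f x = x" shows "carries f U U id"
  unfolding carries_def
proof (intro ballI conjI image_subsetI)
  fix u x assume "u \<in> U" "x \<in> u"
  then have "x \<in> topspace X" using assms(1) by (auto simp: open_covers_def)
  with \<open>x \<in> u\<close> show "f x \<in> id u" by (simp add: assms(2))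
qed simp

text \<open>The preimage cover is the coarsest source: every open cover with a vertex map to
  \<open>V\<close> carrying \<open>f\<close> refines it.\<close>

lemma carries_into_preimage_cover:
  assumes "carries f W V m" "W \<in> open_covers X"
  shows "carries id W (preimage_cover X f V) (\<lambda>w. {x \<in> topspace X. f x \<in> m w})"
  using assms by (auto simp: carries_def preimage_cover_def open_covers_def)

lemma common_refinement:
  assumes "U \<in> open_covers X" "V \<in> open_covers X"
  obtains W s t where "W \<in> open_covers X" "carries id W U s" "carries id W V t"
proof -
  define W where "W = {u \<inter> v |u v. u \<in> U \<and> v \<in> V}"
  have "\<exists>u. u \<in> U \<and> w \<subseteq> u" "\<exists>v. v \<in> V \<and> w \<subseteq> v" if "w \<in> W" for w
    using that unfolding W_def by blast+
  then obtain s t where "\<And>w. w \<in> W \<Longrightarrow> s w \<in> U \<and> w \<subseteq> s w"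
      "\<And>w. w \<in> W \<Longrightarrow> t w \<in> V \<and> w \<subseteq> t w" by metis
  moreover have "\<Union>W = \<Union>U \<inter> \<Union>V" unfolding W_def by blast
  moreover have "openin X w" if "w \<in> W" for w
    using assms that by (auto simp: W_def open_covers_def)
  ultimately have "W \<in> open_covers X"
    using assms by (simp add: open_covers_def)
  moreover note \<open>\<And>w. w \<in> W \<Longrightarrow> s w \<in> U \<and> w \<subseteq> s w\<close> \<open>\<And>w. w \<in> W \<Longrightarrow> t w \<in> V \<and> w \<subseteq> t w\<close>
  ultimately show thesis using that[of W s t] by (simp add: carries_def)
qed

section \<open>Functoriality of Cech homology\<close>

lemma mem_cech_homology_iff:
  "\<alpha> \<in> carrier (cech_homology n X) \<longleftrightarrow>
     \<alpha> \<in> (\<Pi>\<^sub>E U\<in>open_covers X. carrier (simplicial_homology n (nerve U))) \<and>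
     (\<forall>U\<in>open_covers X. \<forall>V\<in>open_covers X. \<forall>s. carries id V U s \<longrightarrow>
        simplicial_homology_induced n (nerve U) s (\<alpha> V) = \<alpha> U)"
  by (simp add: cech_homology_def Let_def carrier_product_group)

lemma cech_homology_closed:
  "\<alpha> \<in> carrier (cech_homology n X) \<Longrightarrow> U \<in> open_covers X \<Longrightarrow>
    \<alpha> U \<in> carrier (simplicial_homology n (nerve U))"
  by (auto simp: mem_cech_homology_iff)

lemma cech_homology_compat:
  "\<alpha> \<in> carrier (cech_homology n X) \<Longrightarrow> U \<in> open_covers X \<Longrightarrow> V \<in> open_covers X \<Longrightarrow>
    carries id V U s \<Longrightarrow> simplicial_homology_induced n (nerve U) s (\<alpha> V) = \<alpha> U"
  by (auto simp: mem_cech_homology_iff)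

lemma cech_homology_eqI:
  assumes "\<alpha> \<in> carrier (cech_homology n X)" "\<beta> \<in> carrier (cech_homology n X)"
    "\<And>U. U \<in> open_covers X \<Longrightarrow> \<alpha> U = \<beta> U"
  shows "\<alpha> = \<beta>"
  using assms(1,2) unfolding mem_cech_homology_iff
  by (elim conjE) (rule PiE_ext[OF _ _ assms(3)])

text \<open>The definition uses the preimage cover and a chosen vertex map; here any cover
  \<open>W\<close> and any vertex map carrying \<open>f\<close> may replace them. \<open>W\<close>
  refines the preimage cover, and following this refinement by the chosen map is contiguous to
  \<open>m\<close>. Functoriality and continuity both exploit this freedom.\<close>

lemma cech_homology_induced_eq:
  assumes \<alpha>: "\<alpha> \<in> carrier (cech_homology n X)" and f: "continuous_map X Y f"
    and W: "W \<in> open_covers X" and V: "V \<in> open_covers Y" and m: "carries f W V m"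
  shows "cech_homology_induced n X Y f \<alpha> V = simplicial_homology_induced n (nerve V) m (\<alpha> W)"
proof -
  let ?P = "preimage_cover X f V" and ?p = "preimage_cover_map X f V"
    and ?r = "\<lambda>w. {x \<in> topspace X. f x \<in> m w}"
  note P = preimage_open_cover[OF f V] and p = carries_preimage_cover_map[of f X V]
    and r = carries_into_preimage_cover[OF m W] and \<alpha>W = cech_homology_closed[OF \<alpha> W]
  have "cech_homology_induced n X Y f \<alpha> V = simplicial_homology_induced n (nerve V) ?p (\<alpha> ?P)"
    using V by (simp add: cech_homology_induced_def)
  also have "\<dots> = simplicial_homology_induced n (nerve V) ?p
      (simplicial_homology_induced n (nerve ?P) ?r (\<alpha> W))"
    by (simp add: cech_homology_compat[OF \<alpha> P W r])
  also have "\<dots> = simplicial_homology_induced n (nerve V) (?p \<circ> ?r) (\<alpha> W)"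
    by (rule simplicial_homology_induced_compose[OF carries_simplicial_map[OF r]
          carries_simplicial_map[OF p] \<alpha>W])
  also have "\<dots> = simplicial_homology_induced n (nerve V) m (\<alpha> W)"
    by (rule simplicial_homology_induced_contiguous[OF carries_contiguous[OF
            carries_refine[OF r p] m] down_closed_nerve empty_notin_nerve \<alpha>W])
  finally show ?thesis .
qed

lemma cech_homology_induced_closed:
  assumes \<alpha>: "\<alpha> \<in> carrier (cech_homology n X)" and f: "continuous_map X Y f"
  shows "cech_homology_induced n X Y f \<alpha> \<in> carrier (cech_homology n Y)"
  unfolding mem_cech_homology_iff
proof (intro conjI ballI allI impI PiE_I)
  fix V assume V: "V \<in> open_covers Y"
  note m = carries_simplicial_map[OF carries_preimage_cover_map[of f X V]]
  show "cech_homology_induced n X Y f \<alpha> V \<in> carrier (simplicial_homology n (nerve V))"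
    using simplicial_homology_induced_closed[OF m cech_homology_closed[OF \<alpha> preimage_open_cover[OF f V]]]
      V by (simp add: cech_homology_induced_def)
next
  fix V assume "V \<notin> open_covers Y"
  then show "cech_homology_induced n X Y f \<alpha> V = undefined"
    by (simp add: cech_homology_induced_def)
next
  fix U V s assume U: "U \<in> open_covers Y" and V: "V \<in> open_covers Y" and s: "carries id V U s"
  note P = preimage_open_cover[OF f V] and p = carries_preimage_cover_map[of f X V]
  have "simplicial_homology_induced n (nerve U) s (cech_homology_induced n X Y f \<alpha> V) =
      simplicial_homology_induced n (nerve U) (s \<circ> preimage_cover_map X f V)
        (\<alpha> (preimage_cover X f V))"
    using V simplicial_homology_induced_compose[OF carries_simplicial_map[OF p]
        carries_simplicial_map[OF s] cech_homology_closed[OF \<alpha> P]]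
    by (simp add: cech_homology_induced_def)
  also have "\<dots> = cech_homology_induced n X Y f \<alpha> U"
    by (rule cech_homology_induced_eq[OF \<alpha> f P U carries_coarsen[OF p s], symmetric])
  finally show "simplicial_homology_induced n (nerve U) s (cech_homology_induced n X Y f \<alpha> V) =
      cech_homology_induced n X Y f \<alpha> U" .
qed

lemma cech_homology_induced_compose:
  assumes \<alpha>: "\<alpha> \<in> carrier (cech_homology n X)"
    and f: "continuous_map X Y f" and g: "continuous_map Y Z g"
  shows "cech_homology_induced n Y Z g (cech_homology_induced n X Y f \<alpha>) =
         cech_homology_induced n X Z (g \<circ> f) \<alpha>"
proof (rule cech_homology_eqI)
  note gf = continuous_map_compose[OF f g]
  show "cech_homology_induced n Y Z g (cech_homology_induced n X Y f \<alpha>) \<in> carrier (cech_homology n Z)"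
    by (intro cech_homology_induced_closed \<alpha> f g)
  show "cech_homology_induced n X Z (g \<circ> f) \<alpha> \<in> carrier (cech_homology n Z)"
    by (intro cech_homology_induced_closed \<alpha> gf)
  fix W assume W: "W \<in> open_covers Z"
  let ?V = "preimage_cover Y g W"
  note V = preimage_open_cover[OF g W] and U = preimage_open_cover[OF f preimage_open_cover[OF g W]]
    and p = carries_preimage_cover_map[of g Y W] and q = carries_preimage_cover_map[of f X ?V]
  have "cech_homology_induced n Y Z g (cech_homology_induced n X Y f \<alpha>) W =
      simplicial_homology_induced n (nerve W) (preimage_cover_map Y g W \<circ> preimage_cover_map X f ?V)
        (\<alpha> (preimage_cover X f ?V))"
    using W V simplicial_homology_induced_compose[OF carries_simplicial_map[OF q]
        carries_simplicial_map[OF p] cech_homology_closed[OF \<alpha> U]]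
    by (simp add: cech_homology_induced_def)
  also have "\<dots> = cech_homology_induced n X Z (g \<circ> f) \<alpha> W"
    by (rule cech_homology_induced_eq[OF \<alpha> gf U W carries_compose[OF q p], symmetric])
  finally show "cech_homology_induced n Y Z g (cech_homology_induced n X Y f \<alpha>) W =
      cech_homology_induced n X Z (g \<circ> f) \<alpha> W" .
qed

text \<open>Identity on the points of the space is all that the composites of a homeomorphism with
  its inverse provide.\<close>

lemma cech_homology_induced_id:
  assumes \<alpha>: "\<alpha> \<in> carrier (cech_homology n X)" and f: "\<And>x. x \<in> topspace X \<Longrightarrow> f x = x"
  shows "cech_homology_induced n X X f \<alpha> = \<alpha>"
proof -
  have cont: "continuous_map X X f"
    using continuous_map_eq[OF continuous_map_id] f by (metis id_apply)
  show ?thesis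
  proof (rule cech_homology_eqI[OF cech_homology_induced_closed[OF \<alpha> cont] \<alpha>])
    fix U assume U: "U \<in> open_covers X"
    have "cech_homology_induced n X X f \<alpha> U = simplicial_homology_induced n (nerve U) id (\<alpha> U)"
      by (rule cech_homology_induced_eq[OF \<alpha> cont U U carries_id_on[OF U f]])
    also have "\<dots> = \<alpha> U"
      by (rule simplicial_homology_induced_id[OF _ cech_homology_closed[OF \<alpha> U]]) simp
    finally show "cech_homology_induced n X X f \<alpha> U = \<alpha> U" .
  qed
qed

section \<open>Functoriality of Cech cohomology and of its dual\<close>

abbreviation nerve_cohomology :: "nat \<Rightarrow> 'a set set \<Rightarrow> ('a set list \<Rightarrow> int) set set" where
  "nerve_cohomology n U \<equiv> carrier (simplicial_cohomology n (nerve U))"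

abbreviation nerve_pullback ::
  "nat \<Rightarrow> 'a set set \<Rightarrow> ('a set \<Rightarrow> 'b set) \<Rightarrow> ('b set list \<Rightarrow> int) set \<Rightarrow> ('a set list \<Rightarrow> int) set" where
  "nerve_pullback n W \<equiv> simplicial_cohomology_induced n (nerve W)"

abbreviation cech_coclass_of ::
  "nat \<Rightarrow> 'a topology \<Rightarrow> 'a set set \<Rightarrow> ('a set list \<Rightarrow> int) set \<Rightarrow> 'a cech_coclass" where
  "cech_coclass_of n X U a \<equiv> cech_cohomology_rel n X `` {(U, a)}"

lemma nerve_pullback_closed:
  "simplicial_map m (nerve W) (nerve V) \<Longrightarrow> b \<in> nerve_cohomology n V \<Longrightarrow>
    nerve_pullback n W m b \<in> nerve_cohomology n W"
  by (rule simplicial_cohomology_induced_closed[OF _ down_closed_nerve])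

lemma nerve_pullback_compose:
  "simplicial_map m (nerve W) (nerve V) \<Longrightarrow> simplicial_map l (nerve V) (nerve U) \<Longrightarrow>
    a \<in> nerve_cohomology n U \<Longrightarrow>
    nerve_pullback n W m (nerve_pullback n V l a) = nerve_pullback n W (l \<circ> m) a"
  by (rule simplicial_cohomology_induced_compose[OF _ _ down_closed_nerve down_closed_nerve])

lemma nerve_pullback_unique:
  "carries f W V m \<Longrightarrow> carries f W V m' \<Longrightarrow> b \<in> nerve_cohomology n V \<Longrightarrow>
    nerve_pullback n W m b = nerve_pullback n W m' b"
  by (rule simplicial_cohomology_induced_contiguous[OF carries_contiguous down_closed_nerve
        down_closed_nerve empty_notin_nerve])

lemma mem_cech_cohomology_rel_iff:
  "((U, a), (V, b)) \<in> cech_cohomology_rel n X \<longleftrightarrow>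
     U \<in> open_covers X \<and> a \<in> nerve_cohomology n U \<and> V \<in> open_covers X \<and> b \<in> nerve_cohomology n V \<and>
     (\<exists>W\<in>open_covers X. \<exists>s t. carries id W U s \<and> carries id W V t \<and>
        nerve_pullback n W s a = nerve_pullback n W t b)"
  unfolding cech_cohomology_rel_def cech_cohomology_reps_def by auto

lemma carries_id_id: "carries id U U id"
  by (simp add: carries_def)

lemma cech_cohomology_rel_refl:
  "U \<in> open_covers X \<Longrightarrow> a \<in> nerve_cohomology n U \<Longrightarrow> ((U, a), (U, a)) \<in> cech_cohomology_rel n X"
  unfolding mem_cech_cohomology_rel_iff using carries_id_id by blast

lemma equiv_cech_cohomology_rel: "equiv (cech_cohomology_reps n X) (cech_cohomology_rel n X)"
proof (rule equivI)
  show "cech_cohomology_rel n X \<subseteq> cech_cohomology_reps n X \<times> cech_cohomology_reps n X"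
    unfolding cech_cohomology_rel_def by auto
  show "refl_on (cech_cohomology_reps n X) (cech_cohomology_rel n X)"
    by (auto simp: refl_on_def cech_cohomology_reps_def cech_cohomology_rel_refl)
  show "sym (cech_cohomology_rel n X)"
  proof (rule symI, clarify)
    fix U a V b assume "((U, a), V, b) \<in> cech_cohomology_rel n X"
    then show "((V, b), U, a) \<in> cech_cohomology_rel n X"
      unfolding mem_cech_cohomology_rel_iff by metis
  qed
  show "trans (cech_cohomology_rel n X)"
  proof (rule transI, clarify)
    fix U a V b Z c
    assume "((U, a), V, b) \<in> cech_cohomology_rel n X" "((V, b), Z, c) \<in> cech_cohomology_rel n X"
    then obtain W s t W' s' t' where
      W: "W \<in> open_covers X" "carries id W U s" "carries id W V t"
        "nerve_pullback n W s a = nerve_pullback n W t b" and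
      W': "W' \<in> open_covers X" "carries id W' V s'" "carries id W' Z t'"
        "nerve_pullback n W' s' b = nerve_pullback n W' t' c" and
      abc: "U \<in> open_covers X" "a \<in> nerve_cohomology n U" "b \<in> nerve_cohomology n V"
        "Z \<in> open_covers X" "c \<in> nerve_cohomology n Z"
      unfolding mem_cech_cohomology_rel_iff by blast
    \<comment> \<open>On a common refinement \<open>Y\<close> the class \<open>b\<close> is pulled
      back along two different vertex maps. They are contiguous, which joins the two given
      equalities.\<close>
    obtain Y p p' where Y: "Y \<in> open_covers X" "carries id Y W p" "carries id Y W' p'"
      using common_refinement[OF W(1) W'(1)] .
    note simp = carries_simplicial_map
    have "nerve_pullback n Y (s \<circ> p) a = nerve_pullback n Y (t \<circ> p) b"
      using nerve_pullback_compose[OF simp[OF Y(2)] simp[OF W(2)] abc(2)]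
        nerve_pullback_compose[OF simp[OF Y(2)] simp[OF W(3)] abc(3)] W(4) by simp
    also have "\<dots> = nerve_pullback n Y (s' \<circ> p') b"
      by (rule nerve_pullback_unique[OF carries_refine[OF Y(2) W(3)]
            carries_refine[OF Y(3) W'(2)] abc(3)])
    also have "\<dots> = nerve_pullback n Y (t' \<circ> p') c"
      using nerve_pullback_compose[OF simp[OF Y(3)] simp[OF W'(2)] abc(3)]
        nerve_pullback_compose[OF simp[OF Y(3)] simp[OF W'(3)] abc(5)] W'(4) by simp
    finally show "((U, a), Z, c) \<in> cech_cohomology_rel n X"
      unfolding mem_cech_cohomology_rel_iff
      using abc Y(1) carries_refine[OF Y(2) W(2)] carries_refine[OF Y(3) W'(3)]
      by blast
  qed
qed

lemma cech_coclass_of_eq_iff: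
  assumes "U \<in> open_covers X" "a \<in> nerve_cohomology n U"
    "V \<in> open_covers X" "b \<in> nerve_cohomology n V"
  shows "cech_coclass_of n X U a = cech_coclass_of n X V b \<longleftrightarrow>
    ((U, a), (V, b)) \<in> cech_cohomology_rel n X"
  by (rule eq_equiv_class_iff[OF equiv_cech_cohomology_rel])
     (simp_all add: cech_cohomology_reps_def assms)

lemma carrier_cech_cohomology:
  "carrier (cech_cohomology n X) =
     {cech_coclass_of n X U a |U a. U \<in> open_covers X \<and> a \<in> nerve_cohomology n U}"
  unfolding cech_cohomology_def cech_cohomology_reps_def quotient_def by auto

text \<open>Over a common refinement of \<open>W\<close> and \<open>W'\<close> both vertex maps
  carry \<open>f\<close> to \<open>V\<close>, so they pull \<open>b\<close> back to the same class
  there.\<close>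

lemma cech_coclass_of_carry:
  assumes W: "W \<in> open_covers X" "carries f W V m" and W': "W' \<in> open_covers X" "carries f W' V m'"
    and b: "b \<in> nerve_cohomology n V"
  shows "cech_coclass_of n X W (nerve_pullback n W m b) = cech_coclass_of n X W' (nerve_pullback n W' m' b)"
proof -
  obtain Y p p' where Y: "Y \<in> open_covers X" "carries id Y W p" "carries id Y W' p'"
    using common_refinement[OF W(1) W'(1)] .
  note simp = carries_simplicial_map
  have "nerve_pullback n Y p (nerve_pullback n W m b) = nerve_pullback n Y p' (nerve_pullback n W' m' b)"
    unfolding nerve_pullback_compose[OF simp[OF Y(2)] simp[OF W(2)] b]
      nerve_pullback_compose[OF simp[OF Y(3)] simp[OF W'(2)] b]
    by (rule nerve_pullback_unique[OF carries_refine[OF Y(2) W(2)]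
            carries_refine[OF Y(3) W'(2)] b])
  then show ?thesis
    using W W' Y nerve_pullback_closed[OF simp[OF W(2)] b] nerve_pullback_closed[OF simp[OF W'(2)] b]
    by (subst cech_coclass_of_eq_iff) (auto simp: mem_cech_cohomology_rel_iff)
qed

lemma cech_coclass_of_refine:
  assumes "U \<in> open_covers X" "a \<in> nerve_cohomology n U" "V \<in> open_covers X" "carries id V U s"
  shows "cech_coclass_of n X U a = cech_coclass_of n X V (nerve_pullback n V s a)"
proof -
  have "nerve_pullback n U id a = a"
    by (rule simplicial_cohomology_induced_id[OF _ down_closed_nerve assms(2)]) simp
  with cech_coclass_of_carry[OF assms(1) carries_id_id assms(3,4,2)] show ?thesis by simp
qed

text \<open>The definition is a union over all representatives. Any two agree over some cover of
  \<open>Y\<close>, and comparing over its preimage shows that they yield the same class; so the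
  union is that class, and it may be computed with any cover carrying \<open>f\<close>.\<close>

lemma cech_cohomology_induced_coclass:
  assumes f: "continuous_map X Y f" and W: "W \<in> open_covers X" and V: "V \<in> open_covers Y"
    and m: "carries f W V m" and b: "b \<in> nerve_cohomology n V"
  shows "cech_cohomology_induced n X f (cech_coclass_of n Y V b) =
         cech_coclass_of n X W (nerve_pullback n W m b)"
proof -
  note simp = carries_simplicial_map
  have eq: "cech_coclass_of n X (preimage_cover X f U)
        (nerve_pullback n (preimage_cover X f U) (preimage_cover_map X f U) a) =
      cech_coclass_of n X W (nerve_pullback n W m b)"
    if "((V, b), (U, a)) \<in> cech_cohomology_rel n Y" for U a
  proof -
    from that obtain Z s t where Z: "Z \<in> open_covers Y" "carries id Z V s" "carries id Z U t"
        "nerve_pullback n Z s b = nerve_pullback n Z t a"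
      and a: "a \<in> nerve_cohomology n U" and U: "U \<in> open_covers Y"
      unfolding mem_cech_cohomology_rel_iff by blast
    let ?Q = "preimage_cover X f Z" and ?q = "preimage_cover_map X f Z"
    note Q = preimage_open_cover[OF f Z(1)] and q = carries_preimage_cover_map[of f X Z]
    have "nerve_pullback n ?Q (t \<circ> ?q) a = nerve_pullback n ?Q (s \<circ> ?q) b"
      using nerve_pullback_compose[OF simp[OF q] simp[OF Z(2)] b]
        nerve_pullback_compose[OF simp[OF q] simp[OF Z(3)] a] Z(4) by simp
    then show ?thesis
      using cech_coclass_of_carry[OF preimage_open_cover[OF f U] carries_preimage_cover_map Q
          carries_coarsen[OF q Z(3)] a]
        cech_coclass_of_carry[OF W m Q carries_coarsen[OF q Z(2)] b] by simp
  qed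
  have "(V, b) \<in> cech_coclass_of n Y V b"
    using cech_cohomology_rel_refl[OF V b] by simp
  then show ?thesis
    unfolding cech_cohomology_induced_def using eq by fastforce
qed

lemma cech_cohomology_induced_closed:
  assumes f: "continuous_map X Y f" and A: "A \<in> carrier (cech_cohomology n Y)"
  shows "cech_cohomology_induced n X f A \<in> carrier (cech_cohomology n X)"
proof -
  obtain V b where V: "V \<in> open_covers Y" "b \<in> nerve_cohomology n V" "A = cech_coclass_of n Y V b"
    using A unfolding carrier_cech_cohomology by blast
  note m = carries_preimage_cover_map[of f X V] and W = preimage_open_cover[OF f V(1)]
  show ?thesis
    unfolding V(3) cech_cohomology_induced_coclass[OF f W V(1) m V(2)] carrier_cech_cohomology
    using W nerve_pullback_closed[OF carries_simplicial_map[OF m] V(2)] by blast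
qed

lemma cech_cohomology_induced_compose:
  assumes f: "continuous_map X Y f" and g: "continuous_map Y Z g"
    and A: "A \<in> carrier (cech_cohomology n Z)"
  shows "cech_cohomology_induced n X f (cech_cohomology_induced n Y g A) =
         cech_cohomology_induced n X (g \<circ> f) A"
proof -
  obtain W c where W: "W \<in> open_covers Z" "c \<in> nerve_cohomology n W" "A = cech_coclass_of n Z W c"
    using A unfolding carrier_cech_cohomology by blast
  let ?V = "preimage_cover Y g W"
  note simp = carries_simplicial_map
  note V = preimage_open_cover[OF g W(1)] and p = carries_preimage_cover_map[of g Y W]
  note U = preimage_open_cover[OF f V] and q = carries_preimage_cover_map[of f X ?V]
  show ?thesis
    unfolding W(3) cech_cohomology_induced_coclass[OF g V W(1) p W(2)]
      cech_cohomology_induced_coclass[OF f U V q nerve_pullback_closed[OF simp[OF p] W(2)]]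
      cech_cohomology_induced_coclass[OF continuous_map_compose[OF f g] U W(1)
        carries_compose[OF q p] W(2)]
      nerve_pullback_compose[OF simp[OF q] simp[OF p] W(2)] ..
qed

lemma cech_cohomology_induced_id:
  assumes A: "A \<in> carrier (cech_cohomology n X)" and f: "\<And>x. x \<in> topspace X \<Longrightarrow> f x = x"
  shows "cech_cohomology_induced n X f A = A"
proof -
  have cont: "continuous_map X X f"
    using continuous_map_eq[OF continuous_map_id] f by (metis id_apply)
  obtain V b where V: "V \<in> open_covers X" "b \<in> nerve_cohomology n V" "A = cech_coclass_of n X V b"
    using A unfolding carrier_cech_cohomology by blast
  from cech_cohomology_induced_coclass[OF cont V(1) V(1) carries_id_on[OF V(1) f] V(2)] show ?thesis
    using simplicial_cohomology_induced_id[OF _ down_closed_nerve V(2), of id] V(3) by simp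
qed

lemma cech_cohomology_common_cover:
  assumes "A \<in> carrier (cech_cohomology n X)" "B \<in> carrier (cech_cohomology n X)"
  obtains W a b where "W \<in> open_covers X" "a \<in> nerve_cohomology n W" "b \<in> nerve_cohomology n W"
    "A = cech_coclass_of n X W a" "B = cech_coclass_of n X W b"
proof -
  obtain U a V b where U: "U \<in> open_covers X" "a \<in> nerve_cohomology n U" "A = cech_coclass_of n X U a"
    and V: "V \<in> open_covers X" "b \<in> nerve_cohomology n V" "B = cech_coclass_of n X V b"
    using assms unfolding carrier_cech_cohomology by blast
  obtain W s t where W: "W \<in> open_covers X" "carries id W U s" "carries id W V t"
    using common_refinement[OF U(1) V(1)] .
  show thesis
    using that[OF W(1)] U V nerve_pullback_closed[OF carries_simplicial_map[OF W(2)] U(2)]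
      nerve_pullback_closed[OF carries_simplicial_map[OF W(3)] V(2)]
      cech_coclass_of_refine[OF U(1,2) W(1,2)] cech_coclass_of_refine[OF V(1,2) W(1,3)]
    by metis
qed

text \<open>Again the definition is a union over choices, here of two representatives over one
  cover, and all choices lead to one class.\<close>

lemma cech_cohomology_mult_coclass:
  assumes W: "W \<in> open_covers X" and a: "a \<in> nerve_cohomology n W" and b: "b \<in> nerve_cohomology n W"
  shows "cech_coclass_of n X W a \<otimes>\<^bsub>cech_cohomology n X\<^esub> cech_coclass_of n X W b =
         cech_coclass_of n X W (a \<otimes>\<^bsub>simplicial_cohomology n (nerve W)\<^esub> b)"
proof -
  note simp = carries_simplicial_map
  have eq: "cech_coclass_of n X V (c \<otimes>\<^bsub>simplicial_cohomology n (nerve V)\<^esub> d) =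
      cech_coclass_of n X W (a \<otimes>\<^bsub>simplicial_cohomology n (nerve W)\<^esub> b)"
    if "((W, a), (V, c)) \<in> cech_cohomology_rel n X" "((W, b), (V, d)) \<in> cech_cohomology_rel n X" for V c d
  proof -
    from that obtain Z s t Z' s' t' where
      Z: "Z \<in> open_covers X" "carries id Z W s" "carries id Z V t"
        "nerve_pullback n Z s a = nerve_pullback n Z t c" and
      Z': "Z' \<in> open_covers X" "carries id Z' W s'" "carries id Z' V t'"
        "nerve_pullback n Z' s' b = nerve_pullback n Z' t' d" and
      V: "V \<in> open_covers X" and c: "c \<in> nerve_cohomology n V" and d: "d \<in> nerve_cohomology n V"
      unfolding mem_cech_cohomology_rel_iff by blast
    obtain Y p p' where Y: "Y \<in> open_covers X" "carries id Y Z p" "carries id Y Z' p'"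
      using common_refinement[OF Z(1) Z'(1)] .
    note sp = carries_refine[OF Y(2) Z(2)] and tp = carries_refine[OF Y(2) Z(3)]
      and sp' = carries_refine[OF Y(3) Z'(2)] and tp' = carries_refine[OF Y(3) Z'(3)]
    have 1: "nerve_pullback n Y (s \<circ> p) a = nerve_pullback n Y (t \<circ> p) c"
      using nerve_pullback_compose[OF simp[OF Y(2)] simp[OF Z(2)] a]
        nerve_pullback_compose[OF simp[OF Y(2)] simp[OF Z(3)] c] Z(4) by simp
    have "nerve_pullback n Y (s' \<circ> p') b = nerve_pullback n Y (t' \<circ> p') d"
      using nerve_pullback_compose[OF simp[OF Y(3)] simp[OF Z'(2)] b]
        nerve_pullback_compose[OF simp[OF Y(3)] simp[OF Z'(3)] d] Z'(4) by simp
    \<comment> \<open>The two relations come with different refinements. Over \<open>Y\<close> the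
      primed vertex maps are exchanged for \<open>s\<close> and \<open>t\<close> by contiguity, so
      that each sum is pulled back by a single vertex map.\<close>
    then have 2: "nerve_pullback n Y (s \<circ> p) b = nerve_pullback n Y (t \<circ> p) d"
      using nerve_pullback_unique[OF sp sp' b] nerve_pullback_unique[OF tp tp' d] by simp
    have "nerve_pullback n Y (t \<circ> p) (c \<otimes>\<^bsub>simplicial_cohomology n (nerve V)\<^esub> d) =
        nerve_pullback n Y (s \<circ> p) (a \<otimes>\<^bsub>simplicial_cohomology n (nerve W)\<^esub> b)"
      unfolding simplicial_cohomology_induced_mult[OF simp[OF tp] down_closed_nerve c d]
        simplicial_cohomology_induced_mult[OF simp[OF sp] down_closed_nerve a b] 1 2 ..
    then show ?thesis
      using V W Y(1) sp tp a b c d simplicial_cohomology_mult_closed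
      by (subst cech_coclass_of_eq_iff) (auto simp: mem_cech_cohomology_rel_iff)
  qed
  have self: "(W, a) \<in> cech_coclass_of n X W a" "(W, b) \<in> cech_coclass_of n X W b"
    using cech_cohomology_rel_refl[OF W a] cech_cohomology_rel_refl[OF W b] by simp_all
  have "{cech_coclass_of n X V (c \<otimes>\<^bsub>simplicial_cohomology n (nerve V)\<^esub> d) | V c d.
        (V, c) \<in> cech_coclass_of n X W a \<and> (V, d) \<in> cech_coclass_of n X W b} =
      {cech_coclass_of n X W (a \<otimes>\<^bsub>simplicial_cohomology n (nerve W)\<^esub> b)}" (is "?L = {?r}")
  proof
    show "?L \<subseteq> {?r}" using eq by auto
    show "{?r} \<subseteq> ?L" using self by auto
  qed
  then show ?thesis unfolding cech_cohomology_def by simp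
qed

lemma cech_cohomology_mult_closed:
  assumes "A \<in> carrier (cech_cohomology n X)" "B \<in> carrier (cech_cohomology n X)"
  shows "A \<otimes>\<^bsub>cech_cohomology n X\<^esub> B \<in> carrier (cech_cohomology n X)"
proof -
  obtain W a b where W: "W \<in> open_covers X" "a \<in> nerve_cohomology n W" "b \<in> nerve_cohomology n W"
    "A = cech_coclass_of n X W a" "B = cech_coclass_of n X W b"
    using cech_cohomology_common_cover[OF assms] .
  then show ?thesis
    using simplicial_cohomology_mult_closed[OF W(2,3)]
    unfolding W(4,5) cech_cohomology_mult_coclass[OF W(1-3)] carrier_cech_cohomology by blast
qed

lemma cech_cohomology_induced_mult:
  assumes f: "continuous_map X Y f"
    and "A \<in> carrier (cech_cohomology n Y)" "B \<in> carrier (cech_cohomology n Y)"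
  shows "cech_cohomology_induced n X f (A \<otimes>\<^bsub>cech_cohomology n Y\<^esub> B) =
    cech_cohomology_induced n X f A \<otimes>\<^bsub>cech_cohomology n X\<^esub> cech_cohomology_induced n X f B"
proof -
  obtain W a b where W: "W \<in> open_covers Y" "a \<in> nerve_cohomology n W" "b \<in> nerve_cohomology n W"
    "A = cech_coclass_of n Y W a" "B = cech_coclass_of n Y W b"
    using cech_cohomology_common_cover[OF assms(2,3)] .
  note P = preimage_open_cover[OF f W(1)] and p = carries_preimage_cover_map[of f X W]
  note sp = carries_simplicial_map[OF p]
  show ?thesis
    unfolding W(4,5) cech_cohomology_mult_coclass[OF W(1-3)]
      cech_cohomology_induced_coclass[OF f P W(1) p W(2)]
      cech_cohomology_induced_coclass[OF f P W(1) p W(3)]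
      cech_cohomology_induced_coclass[OF f P W(1) p simplicial_cohomology_mult_closed[OF W(2,3)]]
      cech_cohomology_mult_coclass[OF P nerve_pullback_closed[OF sp W(2)] nerve_pullback_closed[OF sp W(3)]]
      simplicial_cohomology_induced_mult[OF sp down_closed_nerve W(2,3)] ..
qed

lemma mem_dual_cech_cohomology_iff:
  "\<phi> \<in> carrier (dual_cech_cohomology n X) \<longleftrightarrow>
     (\<forall>A\<in>carrier (cech_cohomology n X). \<forall>B\<in>carrier (cech_cohomology n X).
        \<phi> (A \<otimes>\<^bsub>cech_cohomology n X\<^esub> B) = \<phi> A + \<phi> B) \<and>
     \<phi> \<in> extensional (carrier (cech_cohomology n X))"
  by (auto simp: dual_cech_cohomology_def hom_def integer_group_def)

lemma dual_cech_cohomology_induced_closed: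
  assumes "\<phi> \<in> carrier (dual_cech_cohomology n X)" "continuous_map X Y f"
  shows "dual_cech_cohomology_induced n X Y f \<phi> \<in> carrier (dual_cech_cohomology n Y)"
  using assms cech_cohomology_induced_closed[OF assms(2)] cech_cohomology_induced_mult[OF assms(2)]
  by (simp add: mem_dual_cech_cohomology_iff dual_cech_cohomology_induced_def
      cech_cohomology_mult_closed)

lemma dual_cech_cohomology_induced_compose:
  assumes "continuous_map X Y f" "continuous_map Y Z g"
  shows "dual_cech_cohomology_induced n Y Z g (dual_cech_cohomology_induced n X Y f \<phi>) =
         dual_cech_cohomology_induced n X Z (g \<circ> f) \<phi>"
  unfolding dual_cech_cohomology_induced_def
  by (rule restrict_ext)
     (simp add: cech_cohomology_induced_closed[OF assms(2)] cech_cohomology_induced_compose[OF assms])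

lemma dual_cech_cohomology_induced_id:
  assumes "\<phi> \<in> carrier (dual_cech_cohomology n X)" "\<And>x. x \<in> topspace X \<Longrightarrow> f x = x"
  shows "dual_cech_cohomology_induced n X X f \<phi> = \<phi>"
  by (rule extensionalityI[of _ "carrier (cech_cohomology n X)"])
     (use assms in \<open>auto simp: dual_cech_cohomology_induced_def mem_dual_cech_cohomology_iff
        cech_cohomology_induced_id\<close>)

section \<open>Open covers near an intersection of compact sets\<close>

text \<open>\<open>W\<close> and the complements of the \<open>A k\<close> cover \<open>A 0\<close>.
  A finite subcover involves finitely many indices, and an upper bound of them works because the
  complements increase.\<close>

lemma decreasing_compact_subset_open:
  fixes A :: "nat \<Rightarrow> 'z set"
  assumes Z: "Hausdorff_space Z" and A: "\<And>k. compactin Z (A k)" and dec: "decseq A"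
    and W: "openin Z W" "(\<Inter>k. A k) \<subseteq> W"
  shows "\<exists>k. A k \<subseteq> W"
proof -
  let ?C = "\<lambda>k. topspace Z - A k"
  have "openin Z (?C k)" for k
    using compactin_imp_closedin[OF Z A] by blast
  moreover have "A 0 \<subseteq> \<Union>(insert W (range ?C))"
    using W compactin_subset_topspace[OF A] by fastforce
  ultimately obtain \<F> where \<F>: "finite \<F>" "\<F> \<subseteq> insert W (range ?C)" "A 0 \<subseteq> \<Union>\<F>"
    using compactinD[OF A, of "insert W (range ?C)" 0] W(1) by blast
  then have "finite (\<F> - {W})" "\<F> - {W} \<subseteq> ?C ` UNIV" by auto
  then obtain K where K: "finite K" "\<F> - {W} = ?C ` K"
    by (meson finite_subset_image)
  obtain m where m: "\<And>k. k \<in> K \<Longrightarrow> k \<le> m" using K(1) unfolding finite_nat_set_iff_bounded_le by blast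
  have "A m \<subseteq> W"
  proof
    fix x assume x: "x \<in> A m"
    then have "x \<in> A 0" using decseqD[OF dec, of 0 m] by blast
    then obtain B where B: "B \<in> \<F>" "x \<in> B" using \<F>(3) by blast
    show "x \<in> W"
    proof (rule ccontr)
      assume "x \<notin> W"
      with B K(2) have "B \<in> ?C ` K" by blast
      then obtain k where "k \<in> K" "B = ?C k" by blast
      with B(2) x m decseqD[OF dec, of k m] show False by blast
    qed
  qed
  then show ?thesis ..
qed

text \<open>Induction on the index set with \<open>C\<close> varying. The hypothesis, applied to the
  intersection of \<open>C\<close> with \<open>F j\<close>, gives an open \<open>G\<close> around
  it. The rest of \<open>C\<close> outside \<open>G\<close> is compact and disjoint from
  \<open>F j\<close>, so the two have disjoint neighbourhoods \<open>P\<close> and \<open>Q\<close>;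
  the union of \<open>G\<close> and \<open>P\<close> is the neighbourhood of \<open>C\<close>, and
  \<open>Q\<close> that of \<open>F j\<close>.\<close>

lemma separate_compact_family:
  assumes Z: "Hausdorff_space Z" and "finite I"
    and "compactin Z C" "\<And>i. i \<in> I \<Longrightarrow> compactin Z (F i)" "C \<inter> (\<Inter>i\<in>I. F i) = {}"
  shows "\<exists>G H. openin Z G \<and> C \<subseteq> G \<and> (\<forall>i\<in>I. openin Z (H i) \<and> F i \<subseteq> H i) \<and> G \<inter> (\<Inter>i\<in>I. H i) = {}"
  using assms(2-)
proof (induction I arbitrary: C rule: finite_induct)
  case empty
  then have "C = {}" by simp
  then show ?case by (intro exI[of _ "{}"]) simp
next
  case (insert j I)
  have Fj: "compactin Z (F j)" using insert.prems by simp
  have "compactin Z (C \<inter> F j)"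
    using compact_Int_closedin[OF insert.prems(1) compactin_imp_closedin[OF Z Fj]] .
  moreover have "(C \<inter> F j) \<inter> (\<Inter>i\<in>I. F i) = {}" using insert.prems(3) by (simp add: Int_assoc)
  ultimately have "\<exists>G H. openin Z G \<and> C \<inter> F j \<subseteq> G \<and> (\<forall>i\<in>I. openin Z (H i) \<and> F i \<subseteq> H i) \<and>
      G \<inter> (\<Inter>i\<in>I. H i) = {}"
    using insert.IH insert.prems(2) by simp
  then obtain G H where GH: "openin Z G" "C \<inter> F j \<subseteq> G" "\<And>i. i \<in> I \<Longrightarrow> openin Z (H i) \<and> F i \<subseteq> H i"
      "G \<inter> (\<Inter>i\<in>I. H i) = {}"
    by blast
  have "compactin Z (C \<inter> (topspace Z - G))"
    using compact_Int_closedin[OF insert.prems(1), of "topspace Z - G"] GH(1) by blast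
  moreover have "disjnt (C \<inter> (topspace Z - G)) (F j)"
    using GH(2) unfolding disjnt_def by blast
  ultimately obtain P Q where PQ: "openin Z P" "openin Z Q" "C \<inter> (topspace Z - G) \<subseteq> P" "F j \<subseteq> Q"
      "disjnt P Q"
    using Hausdorff_space_compact_sets[of Z] Z Fj by meson
  have "C \<subseteq> topspace Z" by (rule compactin_subset_topspace[OF insert.prems(1)])
  with PQ(3) have "C \<subseteq> G \<union> P" by blast
  moreover have "(G \<union> P) \<inter> (\<Inter>i\<in>insert j I. (H(j := Q)) i) = {}"
  proof -
    have "(\<Inter>i\<in>I. (H(j := Q)) i) = (\<Inter>i\<in>I. H i)" using insert.hyps(2) by (intro INF_cong) auto
    then have eq: "(\<Inter>i\<in>insert j I. (H(j := Q)) i) = Q \<inter> (\<Inter>i\<in>I. H i)"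
      by (simp only: INT_insert fun_upd_same)
    have "(G \<union> P) \<inter> (Q \<inter> R) = {}" if "G \<inter> R = {}" "P \<inter> Q = {}" for R using that by blast
    from this[OF GH(4)] PQ(5) show ?thesis unfolding eq disjnt_def .
  qed
  moreover have "\<forall>i\<in>insert j I. openin Z ((H(j := Q)) i) \<and> F i \<subseteq> (H(j := Q)) i"
    using GH(3) PQ(2,4) by auto
  moreover have "openin Z (G \<union> P)" using GH(1) PQ(1) by blast
  ultimately show ?case by blast
qed

text \<open>Each point of \<open>A\<close> has a closed neighbourhood in \<open>A\<close> inside a
  member of the cover, and finitely many of these suffice. The pieces are indexed by points, so
  several may belong to one member.\<close>

lemma compact_shrinking:
  fixes Z :: "'z topology"
  assumes Z: "Hausdorff_space Z" and A: "compactin Z A" and U: "U \<in> open_covers (subtopology Z A)"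
  obtains X :: "'z set" and F u :: "'z \<Rightarrow> 'z set" where "finite X" "A \<subseteq> (\<Union>x\<in>X. F x)"
    "\<And>x. x \<in> X \<Longrightarrow> compactin Z (F x) \<and> F x \<subseteq> A \<and> F x \<subseteq> u x \<and> u x \<in> U"
proof -
  have AZ: "A \<subseteq> topspace Z" by (rule compactin_subset_topspace[OF A])
  have "\<exists>u P Q. u \<in> U \<and> openin Z P \<and> openin Z Q \<and> x \<in> P \<and> A - u \<subseteq> Q \<and> disjnt P Q" if "x \<in> A" for x
  proof -
    have "x \<in> \<Union>U" using U that AZ by (auto simp: open_covers_def)
    then obtain u where u: "u \<in> U" "x \<in> u" by blast
    then obtain T where T: "openin Z T" "u = T \<inter> A"
      using U by (auto simp: open_covers_def openin_subtopology)
    have "A - u = A \<inter> (topspace Z - T)" using T AZ by blast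
    then have "compactin Z (A - u)"
      using compact_Int_closedin[OF A, of "topspace Z - T"] T(1) by auto
    moreover have "compactin Z {x}" using that AZ by auto
    moreover have "disjnt {x} (A - u)" using u by simp
    ultimately have "\<exists>P Q. openin Z P \<and> openin Z Q \<and> {x} \<subseteq> P \<and> A - u \<subseteq> Q \<and> disjnt P Q"
      using Hausdorff_space_compact_sets[of Z] Z by meson
    with u(1) show ?thesis by blast
  qed
  then obtain u P Q where *: "\<And>x. x \<in> A \<Longrightarrow> u x \<in> U \<and> openin Z (P x) \<and> openin Z (Q x) \<and> x \<in> P x \<and>
      A - u x \<subseteq> Q x \<and> disjnt (P x) (Q x)"
    by metis
  have "\<exists>\<F>. finite \<F> \<and> \<F> \<subseteq> P ` A \<and> A \<subseteq> \<Union>\<F>"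
    by (rule compactinD[OF A]) (use * in auto)
  then obtain X where X: "finite X" "X \<subseteq> A" "A \<subseteq> \<Union>(P ` X)"
    by (metis finite_subset_image)
  show thesis
  proof (rule that[of X "\<lambda>x. A \<inter> (topspace Z - Q x)" u])
    show "finite X" by fact
    show "A \<subseteq> (\<Union>x\<in>X. A \<inter> (topspace Z - Q x))"
    proof
      fix y assume y: "y \<in> A"
      then obtain x where x: "x \<in> X" "y \<in> P x" using X(3) by blast
      then have "disjnt (P x) (Q x)" using * X(2) by blast
      with x y AZ show "y \<in> (\<Union>x\<in>X. A \<inter> (topspace Z - Q x))" unfolding disjnt_def by blast
    qed
    fix x assume "x \<in> X"
    then have "x \<in> A" using X by blast
    note x = *[OF this]
    show "compactin Z (A \<inter> (topspace Z - Q x)) \<and> A \<inter> (topspace Z - Q x) \<subseteq> A \<and>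
        A \<inter> (topspace Z - Q x) \<subseteq> u x \<and> u x \<in> U"
      using x compact_Int_closedin[OF A, of "topspace Z - Q x"] by blast
  qed
qed

text \<open>Thicken a compact shrinking of the cover, keeping apart the thickenings of any members with
  empty intersection.\<close>

lemma nerve_extension:
  fixes Z :: "'z topology"
  assumes Z: "Hausdorff_space Z" and A: "compactin Z A" and U: "U \<in> open_covers (subtopology Z A)"
    and e: "\<And>u. u \<in> U \<Longrightarrow> openin Z (e u) \<and> u \<subseteq> e u"
  obtains V r where "A \<subseteq> \<Union>V" "\<And>v. v \<in> V \<Longrightarrow> openin Z v \<and> r v \<in> U \<and> v \<subseteq> e (r v)"
    "\<And>\<sigma>. finite \<sigma> \<Longrightarrow> \<sigma> \<noteq> {} \<Longrightarrow> \<sigma> \<subseteq> V \<Longrightarrow> \<Inter>\<sigma> \<noteq> {} \<Longrightarrow> r ` \<sigma> \<in> nerve U"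
proof -
  obtain X :: "'z set" and F u :: "'z \<Rightarrow> 'z set" where X: "finite X" "A \<subseteq> (\<Union>x\<in>X. F x)"
    and F: "\<And>x. x \<in> X \<Longrightarrow> compactin Z (F x) \<and> F x \<subseteq> A \<and> F x \<subseteq> u x \<and> u x \<in> U"
    by (rule compact_shrinking[OF Z A U]) blast
  \<comment> \<open>Index sets whose compact pieces have no common point: these are to be kept
    apart, and there are finitely many of them.\<close>
  define Bad where "Bad = {S. S \<subseteq> X \<and> A \<inter> (\<Inter>x\<in>S. F x) = {}}"
  have "finite Bad" unfolding Bad_def using X(1) by auto
  have "\<exists>G H. openin Z G \<and> A \<subseteq> G \<and> (\<forall>x\<in>S. openin Z (H x) \<and> F x \<subseteq> H x) \<and> G \<inter> (\<Inter>x\<in>S. H x) = {}"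
    if "S \<in> Bad" for S
    by (rule separate_compact_family[OF Z _ A])
       (use that F X(1) finite_subset in \<open>auto simp: Bad_def\<close>)
  then obtain G H where GH: "\<And>S. S \<in> Bad \<Longrightarrow> openin Z (G S) \<and> A \<subseteq> G S \<and>
      (\<forall>x\<in>S. openin Z (H S x) \<and> F x \<subseteq> H S x) \<and> G S \<inter> (\<Inter>x\<in>S. H S x) = {}"
    by metis
  \<comment> \<open>\<open>T x\<close> lies in the prescribed \<open>e (u x)\<close> and obeys the
    separation for every bad set at once; finiteness of \<open>Bad\<close> keeps it open.\<close>
  define T where "T x = \<Inter>(insert (e (u x)) ((\<lambda>S. if x \<in> S then G S \<inter> H S x else G S) ` Bad))" for x
  have openT: "openin Z (T x)" if "x \<in> X" for x
    unfolding T_def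
    by (rule openin_Inter) (use \<open>finite Bad\<close> GH e F[OF that] in \<open>auto intro!: openin_Int\<close>)
  have FT: "F x \<subseteq> T x" if "x \<in> X" for x
  proof -
    have "F x \<subseteq> e (u x)" using F[OF that] e by blast
    moreover have "F x \<subseteq> (if x \<in> S then G S \<inter> H S x else G S)" if "S \<in> Bad" for S
      using GH[OF that] F[OF \<open>x \<in> X\<close>] by auto
    ultimately show ?thesis unfolding T_def by blast
  qed
  \<comment> \<open>Different points may have the same thickening. A choice of index makes the
    vertex map a function of the member.\<close>
  define idx where "idx v = (SOME x. x \<in> X \<and> T x = v)" for v
  have idx: "idx v \<in> X \<and> T (idx v) = v" if "v \<in> T ` X" for v
    unfolding idx_def by (rule someI_ex) (use that in blast)
  show thesis
  proof (rule that[of "T ` X" "\<lambda>v. u (idx v)"])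
    show "A \<subseteq> \<Union>(T ` X)" using X(2) FT by blast
  next
    fix v assume "v \<in> T ` X"
    note v = idx[OF this]
    have "T (idx v) \<subseteq> e (u (idx v))" unfolding T_def by blast
    then show "openin Z v \<and> u (idx v) \<in> U \<and> v \<subseteq> e (u (idx v))"
      using v openT F by metis
  next
    fix \<sigma> assume \<sigma>: "finite \<sigma>" "\<sigma> \<noteq> {}" "\<sigma> \<subseteq> T ` X" "\<Inter>\<sigma> \<noteq> {}"
    then obtain z where z: "\<And>v. v \<in> \<sigma> \<Longrightarrow> z \<in> v" by blast
    have zT: "z \<in> T x" if "x \<in> idx ` \<sigma>" for x using that z idx \<sigma>(3) by force
    have sub: "idx ` \<sigma> \<subseteq> X" using idx \<sigma>(3) by blast
    \<comment> \<open>A common point of the thickenings would lie in the empty intersection attached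
      to a bad set. So the compact pieces themselves meet, and a point common to them lies in all
      the chosen members of \<open>U\<close>.\<close>
    have "idx ` \<sigma> \<notin> Bad"
    proof
      assume bad: "idx ` \<sigma> \<in> Bad"
      have "z \<in> G (idx ` \<sigma>) \<inter> H (idx ` \<sigma>) x" if "x \<in> idx ` \<sigma>" for x
      proof -
        have "z \<in> (if x \<in> idx ` \<sigma> then G (idx ` \<sigma>) \<inter> H (idx ` \<sigma>) x else G (idx ` \<sigma>))"
          using zT[OF that] bad unfolding T_def by blast
        then show ?thesis using that by simp
      qed
      then have "z \<in> G (idx ` \<sigma>) \<inter> (\<Inter>x\<in>idx ` \<sigma>. H (idx ` \<sigma>) x)" using \<sigma>(2) by blast
      then show False using GH[OF bad] by blast
    qed
    then obtain y where "\<And>x. x \<in> idx ` \<sigma> \<Longrightarrow> y \<in> F x" using sub unfolding Bad_def by blast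
    then have "y \<in> \<Inter>((\<lambda>v. u (idx v)) ` \<sigma>)" using F sub by blast
    moreover have "(\<lambda>v. u (idx v)) ` \<sigma> \<subseteq> U" using F sub by blast
    ultimately show "(\<lambda>v. u (idx v)) ` \<sigma> \<in> nerve U" using \<sigma>(1,2) unfolding nerve_def by blast
  qed
qed

locale compact_sequence =
  fixes Z :: "'z topology" and A :: "nat \<Rightarrow> 'z set"
  assumes Hausdorff: "Hausdorff_space Z" and compact: "compactin Z (A k)" and dec: "decseq A"
begin

abbreviation "limit_set \<equiv> \<Inter>k. A k"

abbreviation "level k \<equiv> subtopology Z (A k)"

abbreviation "limit_space \<equiv> subtopology Z limit_set"

lemma subset_topspace: "A k \<subseteq> topspace Z"
  by (rule compactin_subset_topspace[OF compact])

lemma topspace_level: "topspace (level k) = A k"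
  using subset_topspace by auto

lemma compact_limit_set: "compactin Z limit_set"
proof (rule closed_compactin[OF compact])
  show "limit_set \<subseteq> A 0" by blast
  show "closedin Z limit_set"
    using compactin_imp_closedin[OF Hausdorff compact] by (intro closedin_INT) auto
qed

lemma continuous_limit_level: "continuous_map limit_space (level k) id"
  by (rule continuous_map_from_subtopology_mono[OF _ INT_lower])
     (auto simp: continuous_map_in_subtopology continuous_map_from_subtopology)

lemma continuous_level: "k \<le> l \<Longrightarrow> continuous_map (level l) (level k) id"
  using decseqD[OF dec, of k l]
  by (auto simp: continuous_map_in_subtopology continuous_map_from_subtopology)

text \<open>Two covers \<open>V\<close> and \<open>V'\<close> are treated at once, as common refinements are needed.\<close>

lemma refine_near_limit:
  assumes U: "U \<in> open_covers limit_space"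
    and V: "V \<in> open_covers (level k)" "carries id U V c"
    and V': "V' \<in> open_covers (level k')" "carries id U V' c'"
  obtains l W \<rho> where "k \<le> l" "k' \<le> l" "W \<in> open_covers (level l)"
    "\<And>w. w \<in> W \<Longrightarrow> \<rho> w \<in> U \<and> w \<inter> limit_set \<subseteq> \<rho> w"
    "simplicial_map \<rho> (nerve W) (nerve U)"
    "carries id W V (c \<circ> \<rho>)" "carries id W V' (c' \<circ> \<rho>)"
proof -
  have "\<exists>O1 O2 O3. openin Z O1 \<and> openin Z O2 \<and> openin Z O3 \<and>
      u = O1 \<inter> limit_set \<and> c u = O2 \<inter> A k \<and> c' u = O3 \<inter> A k'" if "u \<in> U" for u
  proof -
    have "openin limit_space u" using U that by (simp add: open_covers_def)
    moreover have "openin (level k) (c u)"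
      using V that by (simp add: open_covers_def carries_def)
    moreover have "openin (level k') (c' u)"
      using V' that by (simp add: open_covers_def carries_def)
    ultimately show ?thesis by (simp only: openin_subtopology) blast
  qed
  then obtain O1 O2 O3 where O: "\<And>u. u \<in> U \<Longrightarrow> openin Z (O1 u) \<and> openin Z (O2 u) \<and> openin Z (O3 u) \<and>
      u = O1 u \<inter> limit_set \<and> c u = O2 u \<inter> A k \<and> c' u = O3 u \<inter> A k'"
    by metis
  \<comment> \<open>\<open>O1\<close> keeps the trace on the limit set inside \<open>u\<close>;
    \<open>O2\<close> and \<open>O3\<close> keep the traces on the levels inside \<open>c u\<close>
    and \<open>c' u\<close>, which makes the new cover refine \<open>V\<close> and
    \<open>V'\<close>.\<close>
  define e where "e u = O1 u \<inter> O2 u \<inter> O3 u" for u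
  have e: "openin Z (e u) \<and> u \<subseteq> e u" if "u \<in> U" for u
  proof -
    have "u \<subseteq> c u" "u \<subseteq> c' u" using that V(2) V'(2) by (auto simp: carries_def)
    with O[OF that] show ?thesis unfolding e_def by blast
  qed
  obtain T r where T: "limit_set \<subseteq> \<Union>T" "\<And>v. v \<in> T \<Longrightarrow> openin Z v \<and> r v \<in> U \<and> v \<subseteq> e (r v)"
    and nerveT: "\<And>\<sigma>. finite \<sigma> \<Longrightarrow> \<sigma> \<noteq> {} \<Longrightarrow> \<sigma> \<subseteq> T \<Longrightarrow> \<Inter>\<sigma> \<noteq> {} \<Longrightarrow> r ` \<sigma> \<in> nerve U"
    using nerve_extension[OF Hausdorff compact_limit_set U e] by blast
  have "openin Z (\<Union>T)" using T(2) by blast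
  then obtain m where m: "A m \<subseteq> \<Union>T"
    using decreasing_compact_subset_open[OF Hausdorff compact dec _ T(1)] by blast
  \<comment> \<open>Deep enough for the thickened cover to contain the level, which needs
    \<open>m\<close>, and for the level to lie in both given ones.\<close>
  define l where "l = max m (max k k')"
  have l: "k \<le> l" "k' \<le> l" "m \<le> l" unfolding l_def by auto
  have Al: "A l \<subseteq> A k" "A l \<subseteq> A k'" "A l \<subseteq> A m" "limit_set \<subseteq> A l"
    using l decseqD[OF dec] by blast+
  define W where "W = (\<lambda>v. v \<inter> A l) ` T"
  define idx where "idx w = (SOME v. v \<in> T \<and> v \<inter> A l = w)" for w
  have idx: "idx w \<in> T \<and> idx w \<inter> A l = w" if "w \<in> W" for w
    unfolding idx_def by (rule someI_ex) (use that in \<open>auto simp: W_def\<close>)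
  let ?\<rho> = "\<lambda>w. r (idx w)"
  have w: "?\<rho> w \<in> U" "w \<subseteq> e (?\<rho> w)" "w \<subseteq> A l" if "w \<in> W" for w
    using idx[OF that] T(2)[of "idx w"] by blast+
  show thesis
  proof (rule that[of l W ?\<rho>])
    show "k \<le> l" "k' \<le> l" by (fact l)+
    have "openin (level l) w" if "w \<in> W" for w
      using that T(2) by (auto simp: W_def openin_subtopology_Int)
    moreover have "\<Union>W = A l" using m Al(3) unfolding W_def by blast
    ultimately show "W \<in> open_covers (level l)" by (simp add: open_covers_def topspace_level del: topspace_subtopology)
    show "?\<rho> w \<in> U \<and> w \<inter> limit_set \<subseteq> ?\<rho> w" if "w \<in> W" for w
      using w[OF that] O[OF w(1)[OF that]] unfolding e_def by blast
    show "carries id W V (c \<circ> ?\<rho>)"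
      unfolding carries_def
    proof
      fix x assume "x \<in> W"
      note x = w[OF this]
      then show "(c \<circ> ?\<rho>) x \<in> V \<and> id ` x \<subseteq> (c \<circ> ?\<rho>) x"
        using O[OF x(1)] V(2) Al unfolding e_def carries_def by auto
    qed
    show "carries id W V' (c' \<circ> ?\<rho>)"
      unfolding carries_def
    proof
      fix x assume "x \<in> W"
      note x = w[OF this]
      then show "(c' \<circ> ?\<rho>) x \<in> V' \<and> id ` x \<subseteq> (c' \<circ> ?\<rho>) x"
        using O[OF x(1)] V'(2) Al unfolding e_def carries_def by auto
    qed
    show "simplicial_map ?\<rho> (nerve W) (nerve U)"
      unfolding simplicial_map_def
    proof
      fix \<sigma> assume "\<sigma> \<in> nerve W"
      then have \<sigma>: "finite \<sigma>" "\<sigma> \<noteq> {}" "\<sigma> \<subseteq> W" "\<Inter>\<sigma> \<noteq> {}" by (auto simp: nerve_def)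
      then obtain z where z: "\<And>v. v \<in> \<sigma> \<Longrightarrow> z \<in> v" by blast
      have "v \<subseteq> idx v" if "v \<in> \<sigma>" for v using idx \<sigma>(3) that by blast
      with z have "z \<in> \<Inter>(idx ` \<sigma>)" by blast
      moreover have "idx ` \<sigma> \<subseteq> T" using idx \<sigma>(3) by blast
      ultimately have "r ` idx ` \<sigma> \<in> nerve U"
        using nerveT[of "idx ` \<sigma>"] \<sigma>(1,2) by blast
      then show "?\<rho> ` \<sigma> \<in> nerve U" by (simp add: image_image)
    qed
  qed
qed

text \<open>\<open>r\<close> is no refinement projection: a member of \<open>V\<close> has to lie in
  its image on the limit set only. Being simplicial therefore does not follow from the inclusions
  and is part of the definition.\<close>

definition extends_cover ::
  "'z set set \<Rightarrow> nat \<Rightarrow> 'z set set \<Rightarrow> ('z set \<Rightarrow> 'z set) \<Rightarrow> bool" where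
  "extends_cover U k V r \<longleftrightarrow> V \<in> open_covers (level k) \<and> (\<forall>v\<in>V. r v \<in> U \<and> v \<inter> limit_set \<subseteq> r v) \<and>
     simplicial_map r (nerve V) (nerve U)"

lemma extends_coverD:
  assumes "extends_cover U k V r"
  shows "V \<in> open_covers (level k)" "simplicial_map r (nerve V) (nerve U)"
    "v \<in> V \<Longrightarrow> r v \<in> U" "v \<in> V \<Longrightarrow> v \<inter> limit_set \<subseteq> r v"
  using assms unfolding extends_cover_def by (elim conjE; simp)+

lemma extends_cover_exists:
  assumes U: "U \<in> open_covers limit_space" obtains k V r where "extends_cover U k V r"
proof -
  \<comment> \<open>The one-member cover of level 0, used in both places, puts no condition on the
    refinement beyond extending \<open>U\<close>.\<close>
  have V: "{A 0} \<in> open_covers (level 0)"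
    using openin_topspace[of "level 0"]
    by (simp add: open_covers_def topspace_level del: topspace_subtopology)
  have "u \<subseteq> A 0" if "u \<in> U" for u
  proof -
    have "\<Union>U \<subseteq> limit_set" using U by (auto simp: open_covers_def)
    with that show ?thesis by blast
  qed
  then have c: "carries id U {A 0} (\<lambda>_. A 0)" by (simp add: carries_def)
  obtain l W \<rho> where "W \<in> open_covers (level l)" "\<And>w. w \<in> W \<Longrightarrow> \<rho> w \<in> U \<and> w \<inter> limit_set \<subseteq> \<rho> w"
    "simplicial_map \<rho> (nerve W) (nerve U)"
    using refine_near_limit[OF U V c V c] by metis
  then have "extends_cover U l W \<rho>" unfolding extends_cover_def by blast
  then show thesis by (rule that)
qed

lemma extends_cover_carries:
  assumes "extends_cover U k V r" "T \<in> open_covers limit_space" "carries id T V p"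
  shows "carries id T U (r \<circ> p)"
  unfolding carries_def
proof
  fix t assume t: "t \<in> T"
  then have "t \<subseteq> limit_set" using assms(2) by (auto simp: open_covers_def)
  moreover have pt: "p t \<in> V" "t \<subseteq> p t" using t assms(3) by (auto simp: carries_def)
  ultimately have "t \<subseteq> r (p t)" using extends_coverD(4)[OF assms(1) pt(1)] by (meson Int_greatest subset_trans)
  then show "(r \<circ> p) t \<in> U \<and> id ` t \<subseteq> (r \<circ> p) t"
    using extends_coverD(3)[OF assms(1) pt(1)] by simp
qed

lemma trace_cover:
  assumes "V \<in> open_covers (level k)"
  obtains T p where "T \<in> open_covers limit_space" "carries id T V p"
  using that[OF preimage_open_cover[OF continuous_limit_level assms] carries_preimage_cover_map] .

section \<open>Continuity of Cech homology\<close>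

text \<open>The value at \<open>U\<close> is recovered by applying \<open>r\<close> to the pushed
  class on an extension \<open>V\<close> of \<open>U\<close>: on a cover of the limit set that
  refines \<open>V\<close>, the composite with \<open>r\<close> is a genuine refinement projection
  into \<open>U\<close>.\<close>

lemma cech_homology_limit_inj:
  assumes \<alpha>: "\<alpha> \<in> carrier (cech_homology n limit_space)" and \<beta>: "\<beta> \<in> carrier (cech_homology n limit_space)"
    and eq: "\<And>k. cech_homology_induced n limit_space (level k) id \<alpha> =
      cech_homology_induced n limit_space (level k) id \<beta>"
  shows "\<alpha> = \<beta>"
proof (rule cech_homology_eqI[OF \<alpha> \<beta>])
  fix U assume U: "U \<in> open_covers limit_space"
  obtain k V r where kVr: "extends_cover U k V r" using extends_cover_exists[OF U] .
  note V = extends_coverD(1)[OF kVr] and r = extends_coverD(2)[OF kVr]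
  obtain T p where T: "T \<in> open_covers limit_space" "carries id T V p" using trace_cover[OF V] .
  have *: "\<gamma> U = simplicial_homology_induced n (nerve U) r (cech_homology_induced n limit_space (level k) id \<gamma> V)"
    if \<gamma>: "\<gamma> \<in> carrier (cech_homology n limit_space)" for \<gamma> :: "('z, 'b::comm_ring_1) cech_class"
  proof -
    have "\<gamma> U = simplicial_homology_induced n (nerve U) (r \<circ> p) (\<gamma> T)"
      using cech_homology_compat[OF \<gamma> U T(1) extends_cover_carries[OF kVr T]] by simp
    also have "\<dots> = simplicial_homology_induced n (nerve U) r (simplicial_homology_induced n (nerve V) p (\<gamma> T))"
      using simplicial_homology_induced_compose[OF carries_simplicial_map[OF T(2)] r
          cech_homology_closed[OF \<gamma> T(1)]] by simp
    finally show ?thesis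
      by (simp add: cech_homology_induced_eq[OF \<gamma> continuous_limit_level T(1) V T(2)])
  qed
  show "\<alpha> U = \<beta> U" using *[OF \<alpha>] *[OF \<beta>] eq by simp
qed

text \<open>Both sides are pushed forward from one deep cover \<open>W\<close> along contiguous
  maps, since \<rho> sends a simplex of \<open>W\<close> to one of a cover of the limit set. With
  \<open>s\<close> a refinement this makes the limit class compatible despite the chosen extensions;
  with a cover of a level as its own extension it computes the image at that level.\<close>

lemma extends_cover_induced_eq:
  fixes a :: "nat \<Rightarrow> ('z, 'c::comm_ring_1) cech_class"
  assumes a: "\<And>k. a k \<in> carrier (cech_homology n (level k))"
    and compat: "\<And>k l. k \<le> l \<Longrightarrow> cech_homology_induced n (level l) (level k) id (a l) = a k"
    and V: "extends_cover U k V r" and V': "extends_cover U' k' V' r'"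
    and s: "simplicial_map s (nerve U') (nerve U)" "\<And>u. u \<in> U' \<Longrightarrow> s u \<in> U \<and> u \<inter> limit_set \<subseteq> s u"
  shows "simplicial_homology_induced n (nerve U) s (simplicial_homology_induced n (nerve U') r' (a k' V')) =
         simplicial_homology_induced n (nerve U) r (a k V)"
proof -
  note cov = extends_coverD(1)[OF V] extends_coverD(1)[OF V']
    and r = extends_coverD(2-4)[OF V] and r' = extends_coverD(2-4)[OF V']
  obtain T1 p1 where T1: "T1 \<in> open_covers limit_space" "carries id T1 V p1"
    using trace_cover[OF cov(1)] .
  obtain T2 p2 where T2: "T2 \<in> open_covers limit_space" "carries id T2 V' p2"
    using trace_cover[OF cov(2)] .
  obtain T q1 q2 where T: "T \<in> open_covers limit_space" "carries id T T1 q1" "carries id T T2 q2"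
    using common_refinement[OF T1(1) T2(1)] .
  \<comment> \<open>Both covers are reached from one cover \<open>T\<close> of the limit set, but
    along different vertex maps; hence the two-cover form of
    \<open>refine_near_limit\<close>.\<close>
  define c where "c = p1 \<circ> q1"
  define c' where "c' = p2 \<circ> q2"
  have c: "carries id T V c" "carries id T V' c'"
    unfolding c_def c'_def by (rule carries_refine[OF T(2) T1(2)], rule carries_refine[OF T(3) T2(2)])
  obtain l W \<rho> where W: "k \<le> l" "k' \<le> l" "W \<in> open_covers (level l)"
    "\<And>w. w \<in> W \<Longrightarrow> \<rho> w \<in> T \<and> w \<inter> limit_set \<subseteq> \<rho> w"
    "simplicial_map \<rho> (nerve W) (nerve T)"
    "carries id W V (c \<circ> \<rho>)" "carries id W V' (c' \<circ> \<rho>)"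
    using refine_near_limit[OF T(1) cov(1) c(1) cov(2) c(2)] by metis
  note aW = cech_homology_closed[OF a W(3)]
  have ak: "a k V = simplicial_homology_induced n (nerve V) (c \<circ> \<rho>) (a l W)"
    using cech_homology_induced_eq[OF a continuous_level[OF W(1)] W(3) cov(1) W(6)] compat[OF W(1)] by simp
  have ak': "a k' V' = simplicial_homology_induced n (nerve V') (c' \<circ> \<rho>) (a l W)"
    using cech_homology_induced_eq[OF a continuous_level[OF W(2)] W(3) cov(2) W(7)] compat[OF W(2)] by simp
  note m = carries_simplicial_map[OF W(6)] and m' = carries_simplicial_map[OF W(7)]
  have "contiguous (s \<circ> (r' \<circ> (c' \<circ> \<rho>))) (r \<circ> (c \<circ> \<rho>)) (nerve W) (nerve U)"
    unfolding contiguous_def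
  proof
    fix \<tau> assume \<tau>: "\<tau> \<in> nerve W"
    then have \<tau>': "finite \<tau>" "\<tau> \<noteq> {}" "\<tau> \<subseteq> W" by (auto simp: nerve_def)
    have "\<rho> ` \<tau> \<in> nerve T" using \<tau> W(5) by (simp add: simplicial_map_def)
    then have ne: "\<Inter>(\<rho> ` \<tau>) \<noteq> {}" and "\<rho> ` \<tau> \<subseteq> T" unfolding nerve_def by simp_all
    then have \<rho>T: "\<rho> w \<in> T" if "w \<in> \<tau>" for w using that by blast
    \<comment> \<open>The common point is sought in the sets \<rho> w, which lie in the limit set:
      there the inclusions for \<open>r\<close>, \<open>r'\<close> and \<open>s\<close> are
      available.\<close>
    obtain x where "x \<in> \<Inter>(\<rho> ` \<tau>)" using ne by blast
    then have x: "x \<in> \<rho> w" if "w \<in> \<tau>" for w using that by blast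
    have xw: "s (r' (c' (\<rho> w))) \<in> U \<and> x \<in> s (r' (c' (\<rho> w))) \<and> r (c (\<rho> w)) \<in> U \<and> x \<in> r (c (\<rho> w))"
      if "w \<in> \<tau>" for w
    proof -
      have xl: "x \<in> limit_set"
      proof -
        have "\<Union>T \<subseteq> limit_set" using T(1) by (auto simp: open_covers_def)
        then show ?thesis using x[OF that] \<rho>T[OF that] by blast
      qed
      have 1: "c (\<rho> w) \<in> V" "x \<in> c (\<rho> w)" "c' (\<rho> w) \<in> V'" "x \<in> c' (\<rho> w)"
        using c x[OF that] \<rho>T[OF that] unfolding carries_def by auto
      have 2: "r' (c' (\<rho> w)) \<in> U'" "x \<in> r' (c' (\<rho> w))"
        using r'(2)[OF 1(3)] subsetD[OF r'(3)[OF 1(3)] IntI[OF 1(4) xl]] by simp_all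
      show ?thesis
        using r(2)[OF 1(1)] subsetD[OF r(3)[OF 1(1)] IntI[OF 1(2) xl]]
          s(2)[OF 2(1)] subsetD[OF conjunct2[OF s(2)[OF 2(1)]] IntI[OF 2(2) xl]] by simp
    qed
    let ?\<sigma> = "(s \<circ> (r' \<circ> (c' \<circ> \<rho>))) ` \<tau> \<union> (r \<circ> (c \<circ> \<rho>)) ` \<tau>"
    have "?\<sigma> \<subseteq> U" "x \<in> \<Inter>?\<sigma>" using xw by auto
    then show "?\<sigma> \<in> nerve U" using \<tau>'(1,2) unfolding nerve_def by blast
  qed
  from simplicial_homology_induced_contiguous[OF this down_closed_nerve empty_notin_nerve aW]
  have "simplicial_homology_induced n (nerve U) (s \<circ> (r' \<circ> (c' \<circ> \<rho>))) (a l W) =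
      simplicial_homology_induced n (nerve U) (r \<circ> (c \<circ> \<rho>)) (a l W)" .
  also have "simplicial_homology_induced n (nerve U) (s \<circ> (r' \<circ> (c' \<circ> \<rho>))) (a l W) =
      simplicial_homology_induced n (nerve U) s (simplicial_homology_induced n (nerve U') r' (a k' V'))"
    unfolding ak' simplicial_homology_induced_compose[OF m' r'(1) aW]
    by (rule simplicial_homology_induced_compose[OF simplicial_map_compose[OF m' r'(1)] s(1) aW, symmetric])
  also have "simplicial_homology_induced n (nerve U) (r \<circ> (c \<circ> \<rho>)) (a l W) =
      simplicial_homology_induced n (nerve U) r (a k V)"
    unfolding ak simplicial_homology_induced_compose[OF m r(1) aW] ..
  finally show ?thesis .
qed

text \<open>Induction upwards from \<open>k\<close>; \<open>push\<close> is abstract in order to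
  serve homology and dual cohomology alike.\<close>

lemma compat_levels:
  assumes step: "\<And>k. push (Suc k) k (a (Suc k)) = a k" and id: "\<And>k. push k k (a k) = a k"
    and comp: "\<And>k l m. k \<le> l \<Longrightarrow> l \<le> m \<Longrightarrow> push l k (push m l (a m)) = push m k (a m)"
    and "k \<le> l"
  shows "push l k (a l) = a (k :: nat)"
  using \<open>k \<le> l\<close>
proof (induction l rule: dec_induct)
  case base
  show ?case by (rule id)
next
  case (step l)
  then show ?case using comp[of k l "Suc l"] assms(1)[of l] by simp
qed

lemma cech_homology_limit_surj:
  fixes a :: "nat \<Rightarrow> ('z, 'c::comm_ring_1) cech_class"
  assumes a: "\<And>k. a k \<in> carrier (cech_homology n (level k))"
    and step: "\<And>k. cech_homology_induced n (level (Suc k)) (level k) id (a (Suc k)) = a k"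
  shows "\<exists>\<alpha>\<in>carrier (cech_homology n limit_space).
    \<forall>k. cech_homology_induced n limit_space (level k) id \<alpha> = a k"
proof -
  have compat: "cech_homology_induced n (level l) (level k) id (a l) = a k" if "k \<le> l" for k l
    by (rule compat_levels[where push = "\<lambda>l k. cech_homology_induced n (level l) (level k) id"])
       (use that a step in \<open>simp_all add: cech_homology_induced_id
          cech_homology_induced_compose[OF a continuous_level continuous_level]\<close>)
  have "\<exists>k V r. extends_cover U k V r" if "U \<in> open_covers limit_space" for U
    using extends_cover_exists[OF that] by blast
  then obtain k V r where kVr: "\<And>U. U \<in> open_covers limit_space \<Longrightarrow> extends_cover U (k U) (V U) (r U)"
    by metis
  \<comment> \<open>A cover of the limit set is evaluated at a level to which it extends. By
    \<open>extends_cover_induced_eq\<close> the choices of level, cover and vertex map do not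
    matter.\<close>
  define \<alpha> where "\<alpha> = (\<lambda>U\<in>open_covers limit_space. simplicial_homology_induced n (nerve U) (r U) (a (k U) (V U)))"
  have \<alpha>: "\<alpha> \<in> carrier (cech_homology n limit_space)"
    unfolding mem_cech_homology_iff
  proof (intro conjI ballI allI impI PiE_I)
    fix U assume U: "U \<in> open_covers limit_space"
    note extends_coverD(1,2)[OF kVr[OF U]]
    then show "\<alpha> U \<in> carrier (simplicial_homology n (nerve U))"
      using U simplicial_homology_induced_closed[OF _ cech_homology_closed[OF a]] by (simp add: \<alpha>_def)
  next
    fix U U' s assume U: "U \<in> open_covers limit_space" "U' \<in> open_covers limit_space" and s: "carries id U' U s"
    have "s u \<in> U \<and> u \<inter> limit_set \<subseteq> s u" if "u \<in> U'" for u
      using s that by (auto simp: carries_def)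
    from extends_cover_induced_eq[OF a compat kVr[OF U(1)] kVr[OF U(2)] carries_simplicial_map[OF s] this]
    show "simplicial_homology_induced n (nerve U) s (\<alpha> U') = \<alpha> U" using U by (simp add: \<alpha>_def)
  qed (simp add: \<alpha>_def)
  moreover have "cech_homology_induced n limit_space (level j) id \<alpha> = a j" for j
  proof (rule cech_homology_eqI[OF cech_homology_induced_closed[OF \<alpha> continuous_limit_level] a])
    fix U assume U: "U \<in> open_covers (level j)"
    obtain T p where T: "T \<in> open_covers limit_space" "carries id T U p" using trace_cover[OF U] .
    \<comment> \<open>A cover of a level extends itself, so the comparison lemma also evaluates the
      limit class at that level.\<close>
    have self: "extends_cover U j U id" using U by (simp add: extends_cover_def simplicial_map_def)
    have "p t \<in> U \<and> t \<inter> limit_set \<subseteq> p t" if "t \<in> T" for t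
      using T that by (auto simp: carries_def)
    from extends_cover_induced_eq[OF a compat self kVr[OF T(1)] carries_simplicial_map[OF T(2)] this]
    have "simplicial_homology_induced n (nerve U) p (\<alpha> T) = simplicial_homology_induced n (nerve U) id (a j U)"
      using T by (simp add: \<alpha>_def)
    also have "\<dots> = a j U"
      by (rule simplicial_homology_induced_id[OF _ cech_homology_closed[OF a U]]) simp
    finally show "cech_homology_induced n limit_space (level j) id \<alpha> U = a j U"
      using cech_homology_induced_eq[OF \<alpha> continuous_limit_level T(1) U T(2)] by simp
  qed
  ultimately show ?thesis by blast
qed

section \<open>Continuity of the dual of Cech cohomology\<close>

text \<open>A class on the nerve of \<open>U\<close> pulls back along the vertex map of an extension
  of \<open>U\<close>, so it already exists at some level.\<close>

lemma cech_cohomology_limit_surj: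
  assumes "x \<in> carrier (cech_cohomology n limit_space)"
  shows "\<exists>k. \<exists>y\<in>carrier (cech_cohomology n (level k)). cech_cohomology_induced n limit_space id y = x"
proof -
  obtain U b where U: "U \<in> open_covers limit_space" "b \<in> nerve_cohomology n U"
    "x = cech_coclass_of n limit_space U b"
    using assms unfolding carrier_cech_cohomology by blast
  obtain k V r where kVr: "extends_cover U k V r" using extends_cover_exists[OF U(1)] .
  note V = extends_coverD(1)[OF kVr] and r = extends_coverD(2)[OF kVr]
  obtain T p where T: "T \<in> open_covers limit_space" "carries id T V p" using trace_cover[OF V] .
  have rb: "nerve_pullback n V r b \<in> nerve_cohomology n V" by (rule nerve_pullback_closed[OF r U(2)])
  have "cech_cohomology_induced n limit_space id (cech_coclass_of n (level k) V (nerve_pullback n V r b)) = x"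
    unfolding cech_cohomology_induced_coclass[OF continuous_limit_level T(1) V T(2) rb]
      nerve_pullback_compose[OF carries_simplicial_map[OF T(2)] r U(2)] U(3)
    by (rule cech_coclass_of_refine[OF U(1,2) T(1) extends_cover_carries[OF kVr T], symmetric])
  moreover have "cech_coclass_of n (level k) V (nerve_pullback n V r b) \<in> carrier (cech_cohomology n (level k))"
    unfolding carrier_cech_cohomology using V rb by blast
  ultimately show ?thesis by blast
qed

text \<open>Equality over the limit set is witnessed by one cover \<open>W\<close> with two vertex
  maps into \<open>V\<close>. Both are composed with the same \<rho> from a cover of a deeper level,
  and the equality is pulled back along it.\<close>

lemma cech_cohomology_limit_inj:
  assumes "x \<in> carrier (cech_cohomology n (level k))" "y \<in> carrier (cech_cohomology n (level k))"
    and eq: "cech_cohomology_induced n limit_space id x = cech_cohomology_induced n limit_space id y"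
  shows "\<exists>l\<ge>k. cech_cohomology_induced n (level l) id x = cech_cohomology_induced n (level l) id y"
proof -
  obtain V a b where V: "V \<in> open_covers (level k)" "a \<in> nerve_cohomology n V" "b \<in> nerve_cohomology n V"
    "x = cech_coclass_of n (level k) V a" "y = cech_coclass_of n (level k) V b"
    using cech_cohomology_common_cover[OF assms(1,2)] .
  obtain T p where T: "T \<in> open_covers limit_space" "carries id T V p" using trace_cover[OF V(1)] .
  note sp = carries_simplicial_map[OF T(2)]
  have "cech_coclass_of n limit_space T (nerve_pullback n T p a) =
      cech_coclass_of n limit_space T (nerve_pullback n T p b)"
    using eq unfolding V(4,5) cech_cohomology_induced_coclass[OF continuous_limit_level T(1) V(1) T(2) V(2)]
      cech_cohomology_induced_coclass[OF continuous_limit_level T(1) V(1) T(2) V(3)] .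
  then obtain W s t where W: "W \<in> open_covers limit_space" "carries id W T s" "carries id W T t"
    "nerve_pullback n W s (nerve_pullback n T p a) = nerve_pullback n W t (nerve_pullback n T p b)"
    using cech_coclass_of_eq_iff[OF T(1) nerve_pullback_closed[OF sp V(2)] T(1) nerve_pullback_closed[OF sp V(3)]]
    unfolding mem_cech_cohomology_rel_iff by blast
  define c where "c = p \<circ> s"
  define c' where "c' = p \<circ> t"
  have c: "carries id W V c" "carries id W V c'"
    unfolding c_def c'_def by (rule carries_refine[OF W(2) T(2)], rule carries_refine[OF W(3) T(2)])
  have cc': "nerve_pullback n W c a = nerve_pullback n W c' b"
    using W(4) unfolding c_def c'_def nerve_pullback_compose[OF carries_simplicial_map[OF W(2)] sp V(2)]
      nerve_pullback_compose[OF carries_simplicial_map[OF W(3)] sp V(3)] .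
  obtain l Y \<rho> where Y: "k \<le> l" "Y \<in> open_covers (level l)" "simplicial_map \<rho> (nerve Y) (nerve W)"
    "carries id Y V (c \<circ> \<rho>)" "carries id Y V (c' \<circ> \<rho>)"
    using refine_near_limit[OF W(1) V(1) c(1) V(1) c(2)] by metis
  have "nerve_pullback n Y (c \<circ> \<rho>) a = nerve_pullback n Y (c' \<circ> \<rho>) b"
    using nerve_pullback_compose[OF Y(3) carries_simplicial_map[OF c(1)] V(2)]
      nerve_pullback_compose[OF Y(3) carries_simplicial_map[OF c(2)] V(3)] cc' by simp
  then have "cech_cohomology_induced n (level l) id x = cech_cohomology_induced n (level l) id y"
    unfolding V(4,5) cech_cohomology_induced_coclass[OF continuous_level[OF Y(1)] Y(2) V(1) Y(4) V(2)]
      cech_cohomology_induced_coclass[OF continuous_level[OF Y(1)] Y(2) V(1) Y(5) V(3)] by simp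
  with Y(1) show ?thesis by blast
qed

lemma cech_cohomology_level_limit:
  assumes "k \<le> l" "x \<in> carrier (cech_cohomology n (level k))"
  shows "cech_cohomology_induced n limit_space id (cech_cohomology_induced n (level l) id x) =
    cech_cohomology_induced n limit_space id x"
  using cech_cohomology_induced_compose[OF continuous_limit_level continuous_level[OF assms(1)] assms(2)] by simp

lemma dual_cech_cohomology_limit_inj:
  assumes \<phi>: "\<phi> \<in> carrier (dual_cech_cohomology n limit_space)"
    and \<psi>: "\<psi> \<in> carrier (dual_cech_cohomology n limit_space)"
    and eq: "\<And>k. dual_cech_cohomology_induced n limit_space (level k) id \<phi> =
      dual_cech_cohomology_induced n limit_space (level k) id \<psi>"
  shows "\<phi> = \<psi>"
proof (rule extensionalityI[of _ "carrier (cech_cohomology n limit_space)"])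
  show "\<phi> \<in> extensional (carrier (cech_cohomology n limit_space))"
    "\<psi> \<in> extensional (carrier (cech_cohomology n limit_space))"
    using \<phi> \<psi> by (simp_all add: mem_dual_cech_cohomology_iff)
  fix x assume "x \<in> carrier (cech_cohomology n limit_space)"
  then obtain k y where y: "y \<in> carrier (cech_cohomology n (level k))"
    "cech_cohomology_induced n limit_space id y = x"
    using cech_cohomology_limit_surj by blast
  have "dual_cech_cohomology_induced n limit_space (level k) id \<phi> y =
      dual_cech_cohomology_induced n limit_space (level k) id \<psi> y" by (simp only: eq)
  then show "\<phi> x = \<psi> x" using y by (simp add: dual_cech_cohomology_induced_def)
qed

text \<open>Homomorphisms out of a direct limit form the inverse limit of the duals: a class on the
  limit set is evaluated at any level where it has a preimage.\<close>

lemma dual_cech_cohomology_limit_surj: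
  assumes a: "\<And>k. a k \<in> carrier (dual_cech_cohomology n (level k))"
    and step: "\<And>k. dual_cech_cohomology_induced n (level (Suc k)) (level k) id (a (Suc k)) = a k"
  shows "\<exists>\<phi>\<in>carrier (dual_cech_cohomology n limit_space).
    \<forall>k. dual_cech_cohomology_induced n limit_space (level k) id \<phi> = a k"
proof -
  let ?C = "\<lambda>k. carrier (cech_cohomology n (level k))"
  let ?res = "cech_cohomology_induced n limit_space id"
  have push: "dual_cech_cohomology_induced n (level l) (level k) id (a l) = a k" if "k \<le> l" for k l
    by (rule compat_levels[where push = "\<lambda>l k. dual_cech_cohomology_induced n (level l) (level k) id"])
       (use that a step in \<open>simp_all add: dual_cech_cohomology_induced_id
          dual_cech_cohomology_induced_compose[OF continuous_level continuous_level]\<close>)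
  have compat: "a k x = a l (cech_cohomology_induced n (level l) id x)"
    if "k \<le> l" "x \<in> ?C k" for k l x
    using fun_cong[OF push[OF that(1)], of x] that(2) by (simp add: dual_cech_cohomology_induced_def)
  \<comment> \<open>Both are brought to the level \<open>m\<close>. As they agree on the limit set
    they agree at some deeper level \<open>j\<close>, where compatibility compares the
    values.\<close>
  have well_defined: "a k x = a l y" if "x \<in> ?C k" "y \<in> ?C l" "?res x = ?res y" for k l x y
  proof -
    define m where "m = max k l"
    have m: "k \<le> m" "l \<le> m" unfolding m_def by auto
    let ?x = "cech_cohomology_induced n (level m) id x" and ?y = "cech_cohomology_induced n (level m) id y"
    have xy: "?x \<in> ?C m" "?y \<in> ?C m"
      using cech_cohomology_induced_closed continuous_level m that by blast+
    have "?res ?x = ?res ?y" using cech_cohomology_level_limit m that by metis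
    then obtain j where j: "m \<le> j"
      "cech_cohomology_induced n (level j) id ?x = cech_cohomology_induced n (level j) id ?y"
      using cech_cohomology_limit_inj[OF xy] by blast
    show ?thesis
      using compat[OF m(1) that(1)] compat[OF m(2) that(2)] compat[OF j(1) xy(1)] compat[OF j(1) xy(2)] j(2)
      by simp
  qed
  have "\<exists>k y. y \<in> ?C k \<and> ?res y = x" if "x \<in> carrier (cech_cohomology n limit_space)" for x
    using cech_cohomology_limit_surj[OF that] by blast
  then obtain k y where ky: "\<And>x. x \<in> carrier (cech_cohomology n limit_space) \<Longrightarrow> y x \<in> ?C (k x) \<and> ?res (y x) = x"
    by metis
  define \<phi> where "\<phi> = (\<lambda>x\<in>carrier (cech_cohomology n limit_space). a (k x) (y x))"
  have res_closed: "?res x \<in> carrier (cech_cohomology n limit_space)" if "x \<in> ?C l" for x l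
    by (rule cech_cohomology_induced_closed[OF continuous_limit_level that])
  have \<phi>_res: "\<phi> (?res x) = a l x" if "x \<in> ?C l" for x l
    using well_defined[OF _ that] ky[OF res_closed[OF that]] res_closed[OF that] by (simp add: \<phi>_def)
  have "\<phi> \<in> carrier (dual_cech_cohomology n limit_space)"
    unfolding mem_dual_cech_cohomology_iff
  proof (intro conjI ballI)
    fix x x' assume x: "x \<in> carrier (cech_cohomology n limit_space)" "x' \<in> carrier (cech_cohomology n limit_space)"
    define m where "m = max (k x) (k x')"
    have m: "k x \<le> m" "k x' \<le> m" unfolding m_def by auto
    let ?y = "cech_cohomology_induced n (level m) id (y x)"
      and ?y' = "cech_cohomology_induced n (level m) id (y x')"
    have y: "?y \<in> ?C m" "?y' \<in> ?C m"
      using cech_cohomology_induced_closed continuous_level m ky x by blast+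
    have res: "?res ?y = x" "?res ?y' = x'"
      using cech_cohomology_level_limit[OF m(1)] cech_cohomology_level_limit[OF m(2)] ky x by simp_all
    have "?res (?y \<otimes>\<^bsub>cech_cohomology n (level m)\<^esub> ?y') = x \<otimes>\<^bsub>cech_cohomology n limit_space\<^esub> x'"
      unfolding cech_cohomology_induced_mult[OF continuous_limit_level y] res ..
    then have "\<phi> (x \<otimes>\<^bsub>cech_cohomology n limit_space\<^esub> x') = a m (?y \<otimes>\<^bsub>cech_cohomology n (level m)\<^esub> ?y')"
      using \<phi>_res[OF cech_cohomology_mult_closed[OF y]] by simp
    also have "\<dots> = a m ?y + a m ?y'"
      using a[of m] y unfolding mem_dual_cech_cohomology_iff by blast
    also have "\<dots> = \<phi> x + \<phi> x'" using \<phi>_res[OF y(1)] \<phi>_res[OF y(2)] res by simp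
    finally show "\<phi> (x \<otimes>\<^bsub>cech_cohomology n limit_space\<^esub> x') = \<phi> x + \<phi> x'" .
  qed (simp add: \<phi>_def)
  moreover have "dual_cech_cohomology_induced n limit_space (level j) id \<phi> = a j" for j
  proof (rule extensionalityI[of _ "?C j"])
    show "a j \<in> extensional (?C j)" using a[of j] by (simp add: mem_dual_cech_cohomology_iff)
    show "dual_cech_cohomology_induced n limit_space (level j) id \<phi> \<in> extensional (?C j)"
      by (simp add: dual_cech_cohomology_induced_def)
    show "dual_cech_cohomology_induced n limit_space (level j) id \<phi> x = a j x" if "x \<in> ?C j" for x
      using that \<phi>_res[OF that] by (simp add: dual_cech_cohomology_induced_def)
  qed
  ultimately show ?thesis by blast
qed

end

section \<open>Sequences of sets converging to a compact set\<close>

text \<open>One-sided convergence: the \<open>C j\<close> enter every neighbourhood of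
  \<open>K\<close> without having to approach all of its points. So \<open>K\<close> may be
  enlarged, and paths shrinking to an end of a graph converge to the graph.\<close>

definition converges_to :: "'b topology \<Rightarrow> (nat \<Rightarrow> 'b set) \<Rightarrow> 'b set \<Rightarrow> bool" where
  "converges_to X C K \<longleftrightarrow> compactin X K \<and> (\<forall>j. compactin X (C j)) \<and>
     (\<forall>U. openin X U \<and> K \<subseteq> U \<longrightarrow> (\<exists>m. \<forall>j\<ge>m. C j \<subseteq> U))"

definition tail :: "(nat \<Rightarrow> 'b set) \<Rightarrow> 'b set \<Rightarrow> nat \<Rightarrow> 'b set" where
  "tail C K k = K \<union> (\<Union>j\<in>{k..}. C j)"

lemma converges_toD:
  assumes "converges_to X C K"
  shows "compactin X K" "compactin X (C j)"
    "openin X U \<Longrightarrow> K \<subseteq> U \<Longrightarrow> \<exists>m. \<forall>j\<ge>m. C j \<subseteq> U"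
  using assms unfolding converges_to_def by simp_all

lemma converges_to_mono:
  assumes "converges_to X C K" "K \<subseteq> K'" "compactin X K'" shows "converges_to X C K'"
  unfolding converges_to_def
  using assms(3) converges_toD(2,3)[OF assms(1)] subset_trans[OF assms(2)] by meson

lemma converges_to_Un:
  assumes "converges_to X C K" "converges_to X C' K" shows "converges_to X (\<lambda>j. C j \<union> C' j) K"
  unfolding converges_to_def
proof (intro conjI allI impI)
  show "compactin X K" by (rule converges_toD(1)[OF assms(1)])
  show "compactin X (C j \<union> C' j)" for j
    by (rule compactin_Un[OF converges_toD(2)[OF assms(1)] converges_toD(2)[OF assms(2)]])
  fix U assume U: "openin X U \<and> K \<subseteq> U"
  obtain m where m: "\<And>j. j \<ge> m \<Longrightarrow> C j \<subseteq> U" using converges_toD(3)[OF assms(1)] U by meson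
  obtain m' where m': "\<And>j. j \<ge> m' \<Longrightarrow> C' j \<subseteq> U" using converges_toD(3)[OF assms(2)] U by meson
  have "\<forall>j\<ge>max m m'. C j \<union> C' j \<subseteq> U" using m m' by simp
  then show "\<exists>m. \<forall>j\<ge>m. C j \<union> C' j \<subseteq> U" ..
qed

text \<open>Finitely many sets of a cover contain \<open>K\<close>, hence all but finitely many
  \<open>C j\<close>; each of the remaining ones is compact.\<close>

lemma compactin_tail:
  assumes C: "converges_to X C K" shows "compactin X (tail C K k)"
  unfolding compactin_def
proof (intro conjI allI impI)
  note K = converges_toD(1)[OF C] and Cj = converges_toD(2)[OF C]
  show "tail C K k \<subseteq> topspace X"
    unfolding tail_def using compactin_subset_topspace[OF K] compactin_subset_topspace[OF Cj] by blast
  fix \<U> assume \<U>: "(\<forall>U\<in>\<U>. openin X U) \<and> tail C K k \<subseteq> \<Union>\<U>"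
  then have sub: "K \<subseteq> \<Union>\<U>" "\<And>j. j \<ge> k \<Longrightarrow> C j \<subseteq> \<Union>\<U>" unfolding tail_def by blast+
  obtain \<F> where \<F>: "finite \<F>" "\<F> \<subseteq> \<U>" "K \<subseteq> \<Union>\<F>"
    using compactinD[OF K, of \<U>] \<U> sub by meson
  have "openin X (\<Union>\<F>)" using \<U> \<F>(2) by blast
  then obtain m where m: "\<And>j. j \<ge> m \<Longrightarrow> C j \<subseteq> \<Union>\<F>"
    using converges_toD(3)[OF C] \<F>(3) by meson
  have "\<exists>\<G>. finite \<G> \<and> \<G> \<subseteq> \<U> \<and> C j \<subseteq> \<Union>\<G>" if "j \<ge> k" for j
    using compactinD[OF Cj, of \<U>] \<U> sub(2)[OF that] by meson
  then obtain \<G> where \<G>: "\<And>j. j \<ge> k \<Longrightarrow> finite (\<G> j) \<and> \<G> j \<subseteq> \<U> \<and> C j \<subseteq> \<Union>(\<G> j)"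
    by metis
  let ?\<H> = "\<F> \<union> (\<Union>j\<in>{k..<m}. \<G> j)"
  have "C j \<subseteq> \<Union>?\<H>" if "j \<ge> k" for j
  proof (cases "j < m")
    case True
    then have "\<G> j \<subseteq> ?\<H>" using that by auto
    then show ?thesis using \<G>[OF that] by blast
  next
    case False
    then show ?thesis using m[of j] by auto
  qed
  then have "tail C K k \<subseteq> \<Union>?\<H>" unfolding tail_def using \<F>(3) by auto
  moreover have "finite ?\<H>" using \<F>(1) \<G> by simp
  moreover have "(\<Union>j\<in>{k..<m}. \<G> j) \<subseteq> \<U>" using \<G> by (intro UN_least) simp
  then have "?\<H> \<subseteq> \<U>" using \<F>(2) by blast
  ultimately show "\<exists>\<F>. finite \<F> \<and> \<F> \<subseteq> \<U> \<and> tail C K k \<subseteq> \<Union>\<F>" by blast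
qed

lemma decseq_tail: "decseq (tail C K)"
proof (rule antimonoI)
  fix k l :: nat assume "k \<le> l"
  then show "tail C K l \<subseteq> tail C K k"
    unfolding tail_def by (intro Un_mono UN_mono) auto
qed

text \<open>The complement of a point outside \<open>K\<close> is an open set around
  \<open>K\<close>, so late \<open>C j\<close> avoid the point.\<close>

lemma Inter_tail:
  assumes X: "Hausdorff_space X" and C: "converges_to X C K" shows "(\<Inter>k. tail C K k) = K"
proof
  show "K \<subseteq> (\<Inter>k. tail C K k)" unfolding tail_def by blast
  show "(\<Inter>k. tail C K k) \<subseteq> K"
  proof
    fix x assume x: "x \<in> (\<Inter>k. tail C K k)"
    show "x \<in> K"
    proof (rule ccontr)
      assume "x \<notin> K"
      have "x \<in> topspace X" using x compactin_subset_topspace[OF compactin_tail[OF C, of 0]] by blast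
      then have "openin X (topspace X - {x})"
        using closedin_Hausdorff_singleton[OF X] by blast
      moreover have "K \<subseteq> topspace X - {x}"
        using \<open>x \<notin> K\<close> compactin_subset_topspace[OF converges_toD(1)[OF C]] by blast
      ultimately obtain m where m: "\<And>j. j \<ge> m \<Longrightarrow> C j \<subseteq> topspace X - {x}"
        using converges_toD(3)[OF C] by meson
      have "x \<in> tail C K m" using x by blast
      with \<open>x \<notin> K\<close> obtain j where "j \<ge> m" "x \<in> C j" unfolding tail_def by auto
      with m[of j] show False by blast
    qed
  qed
qed

section \<open>Extension of consistent assignments\<close>

text \<open>One degree of a homology theory. A locale cannot quantify over types, so the theory is given
  separately on spaces with points in \<open>'m\<close> and in \<open>real \<times> 'm\<close>.\<close>

locale continuous_homology_theory =
  fixes H1 :: "'m topology \<Rightarrow> 'h set" and H2 :: "(real \<times> 'm) topology \<Rightarrow> 'k set"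
    and push12 :: "'m topology \<Rightarrow> (real \<times> 'm) topology \<Rightarrow> ('m \<Rightarrow> real \<times> 'm) \<Rightarrow> 'h \<Rightarrow> 'k"
    and push22 :: "(real \<times> 'm) topology \<Rightarrow> (real \<times> 'm) topology \<Rightarrow> (real \<times> 'm \<Rightarrow> real \<times> 'm) \<Rightarrow> 'k \<Rightarrow> 'k"
  assumes push12_closed: "continuous_map X Y f \<Longrightarrow> a \<in> H1 X \<Longrightarrow> push12 X Y f a \<in> H2 Y"
    and push22_push12: "continuous_map X Y f \<Longrightarrow> continuous_map Y Z g \<Longrightarrow> a \<in> H1 X \<Longrightarrow>
      push22 Y Z g (push12 X Y f a) = push12 X Z (g \<circ> f) a"
    and homeomorphism: "homeomorphic_map X Y f \<Longrightarrow> bij_betw (push12 X Y f) (H1 X) (H2 Y)"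
    and limit_inj: "compact_sequence Z A \<Longrightarrow> c \<in> H2 (subtopology Z (\<Inter>k. A k)) \<Longrightarrow>
      d \<in> H2 (subtopology Z (\<Inter>k. A k)) \<Longrightarrow>
      (\<And>k. push22 (subtopology Z (\<Inter>k. A k)) (subtopology Z (A k)) id c =
           push22 (subtopology Z (\<Inter>k. A k)) (subtopology Z (A k)) id d) \<Longrightarrow> c = d"
    and limit_surj: "compact_sequence Z A \<Longrightarrow> (\<And>k. e k \<in> H2 (subtopology Z (A k))) \<Longrightarrow>
      (\<And>k. push22 (subtopology Z (A (Suc k))) (subtopology Z (A k)) id (e (Suc k)) = e k) \<Longrightarrow>
      \<exists>c\<in>H2 (subtopology Z (\<Inter>k. A k)). \<forall>k. push22 (subtopology Z (\<Inter>k. A k)) (subtopology Z (A k)) id c = e k"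

locale proper_family = continuous_homology_theory H1 H2 push12 push22
  for H1 :: "'m topology \<Rightarrow> 'h set" and H2 :: "(real \<times> 'm) topology \<Rightarrow> 'k set" and push12 push22 +
  fixes P :: "'p metric" and M :: "'m topology" and \<pi> :: "'m \<Rightarrow> 'p"
  assumes lpc: "locally_path_connected_space (mtopology_of P)"
    and Hausdorff_M: "Hausdorff_space M"
    and cont_\<pi>: "continuous_map M (mtopology_of P) \<pi>"
    and proper_\<pi>: "proper_map M (mtopology_of P) \<pi>"
begin

section \<open>Spaces over compact subsets of \<open>real \<times> P\<close>\<close>

abbreviation "base_space \<equiv> prod_topology euclideanreal (mtopology_of P)"

abbreviation "total_space \<equiv> prod_topology euclideanreal M"

definition over :: "(real \<times> 'p) set \<Rightarrow> (real \<times> 'm) set" where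
  "over E = {z \<in> topspace total_space. (fst z, \<pi> (snd z)) \<in> E}"

text \<open>The common generalization of \<open>fiber\<close> and \<open>path_fiber\<close>.\<close>

abbreviation restricted :: "(real \<times> 'p) set \<Rightarrow> (real \<times> 'm) topology" where
  "restricted E \<equiv> subtopology total_space (over E)"

definition fiber_push :: "real \<Rightarrow> 'p \<Rightarrow> (real \<times> 'p) set \<Rightarrow> 'h \<Rightarrow> 'k" where
  "fiber_push t p E = push12 (fiber M \<pi> p) (restricted E) (\<lambda>y. (t, y))"

definition graph :: "(real \<Rightarrow> 'p) \<Rightarrow> (real \<times> 'p) set" where
  "graph \<gamma> = (\<lambda>x. (x, \<gamma> x)) ` {0..1}"

lemma Hausdorff_total: "Hausdorff_space total_space"
  using Hausdorff_M by (simp add: Hausdorff_space_prod_topology)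

lemma Hausdorff_P: "Hausdorff_space (mtopology_of P)"
  unfolding mtopology_of_def by (rule Metric_space.Hausdorff_space_mtopology[OF Metric_space_mspace_mdist])

lemma Hausdorff_base: "Hausdorff_space base_space"
  using Hausdorff_P by (simp add: Hausdorff_space_prod_topology)

text \<open>The product of the identity with \<pi> is proper.\<close>

lemma compact_over:
  assumes "compactin base_space E" shows "compactin total_space (over E)"
proof -
  have "proper_map total_space base_space (\<lambda>(x, y). (id x, \<pi> y))"
    unfolding proper_map_prod using proper_\<pi> proper_map_id by blast
  from compactin_proper_map_preimage[OF this assms] show ?thesis
    by (simp add: over_def case_prod_unfold)
qed

lemma continuous_fiber_push:
  assumes "(t, p) \<in> E" shows "continuous_map (fiber M \<pi> p) (restricted E) (\<lambda>y. (t, y))"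
  using assms
  by (auto simp: continuous_map_in_subtopology continuous_map_paired fiber_def over_def
      continuous_map_from_subtopology)

lemma fiber_push_closed:
  "(t, p) \<in> E \<Longrightarrow> a \<in> H1 (fiber M \<pi> p) \<Longrightarrow> fiber_push t p E a \<in> H2 (restricted E)"
  unfolding fiber_push_def by (rule push12_closed[OF continuous_fiber_push])

text \<open>\<open>h\<close> moves the real coordinate and fixes the point of \<open>M\<close>, so
  it carries the fibre at \<open>t\<close> to the one at \<open>h t\<close>. Continuity is asked on
  \<open>S\<close> because the typical \<open>h\<close>, the first coordinate of a path, is
  controlled on the unit interval.\<close>

lemma push_fiber_push:
  assumes h: "continuous_on S h" "fst ` E \<subseteq> S" "\<And>x q. (x, q) \<in> E \<Longrightarrow> (h x, q) \<in> E'"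
    and tp: "(t, p) \<in> E" and a: "a \<in> H1 (fiber M \<pi> p)"
  shows "push22 (restricted E) (restricted E') (\<lambda>z. (h (fst z), snd z)) (fiber_push t p E a) = fiber_push (h t) p E' a"
proof -
  have "continuous_map (restricted E) (top_of_set S) fst"
    using h(2) by (force simp: continuous_map_in_subtopology over_def
        intro: continuous_map_from_subtopology continuous_map_fst)
  from continuous_map_compose[OF this, of euclideanreal h] h(1)
  have "continuous_map (restricted E) euclideanreal (\<lambda>z. h (fst z))" by (simp add: o_def)
  moreover have "continuous_map (restricted E) M snd"
    by (rule continuous_map_from_subtopology[OF continuous_map_snd])
  ultimately have "continuous_map (restricted E) total_space (\<lambda>z. (h (fst z), snd z))"
    by (simp add: continuous_map_paired)
  then have "continuous_map (restricted E) (restricted E') (\<lambda>z. (h (fst z), snd z))"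
    using h(3) by (auto simp: continuous_map_in_subtopology over_def)
  from push22_push12[OF continuous_fiber_push[OF tp] this a] show ?thesis
    by (simp add: fiber_push_def o_def)
qed

lemma fiber_push_mono:
  assumes "E \<subseteq> E'" "(t, p) \<in> E" "a \<in> H1 (fiber M \<pi> p)"
  shows "push22 (restricted E) (restricted E') id (fiber_push t p E a) = fiber_push t p E' a"
  using push_fiber_push[of UNIV "\<lambda>x. x" E E' t p a] assms by (auto simp: id_def)

lemma path_fiber_eq: "path_fiber M \<pi> \<gamma> = restricted (graph \<gamma>)"
proof -
  have "path_fiber M \<pi> \<gamma> = subtopology total_space (({0..1} \<times> topspace M) \<inter> {(x, y). \<gamma> x = \<pi> y})"
    unfolding path_fiber_def prod_topology_subtopology(1) subtopology_subtopology by simp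
  also have "({0..1} \<times> topspace M) \<inter> {(x, y). \<gamma> x = \<pi> y} = over (graph \<gamma>)"
    by (auto simp: over_def graph_def)
  finally show ?thesis .
qed

section \<open>Paths and consistency\<close>

definition consistent :: "('p \<Rightarrow> 'h) \<Rightarrow> (real \<Rightarrow> 'p) \<Rightarrow> bool" where
  "consistent a \<gamma> \<longleftrightarrow>
     push12 (fiber M \<pi> (\<gamma> 0)) (path_fiber M \<pi> \<gamma>) (\<lambda>y. (0, y)) (a (\<gamma> 0)) =
     push12 (fiber M \<pi> (\<gamma> 1)) (path_fiber M \<pi> \<gamma>) (\<lambda>y. (1, y)) (a (\<gamma> 1))"

lemma consistent_iff:
  "consistent a \<gamma> \<longleftrightarrow> fiber_push 0 (\<gamma> 0) (graph \<gamma>) (a (\<gamma> 0)) = fiber_push 1 (\<gamma> 1) (graph \<gamma>) (a (\<gamma> 1))"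
  by (simp add: consistent_def fiber_push_def path_fiber_eq)

definition consistent_on :: "('p \<Rightarrow> 'h) \<Rightarrow> 'p set \<Rightarrow> bool" where
  "consistent_on a S \<longleftrightarrow> (\<forall>p\<in>S. a p \<in> H1 (fiber M \<pi> p)) \<and>
     (\<forall>p\<in>S. \<forall>q\<in>S. \<forall>\<gamma>\<in>topspace (path_space P p q). consistent a \<gamma>)"

lemma mem_path_space_iff:
  "\<gamma> \<in> topspace (path_space P p q) \<longleftrightarrow> \<gamma> \<in> mspace (cfunspace (top_of_set {0..1}) P) \<and> \<gamma> 0 = p \<and> \<gamma> 1 = q"
  by (auto simp: path_space_def)

lemma path_spaceD:
  assumes "\<gamma> \<in> topspace (path_space P p q)"
  shows "continuous_map (top_of_set {0..1}) (mtopology_of P) \<gamma>" "\<gamma> 0 = p" "\<gamma> 1 = q"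
  using assms by (auto simp: mem_path_space_iff)

lemma restrict_mem_path_space:
  assumes "pathin (mtopology_of P) g"
  shows "restrict g {0..1} \<in> topspace (path_space P (g 0) (g 1))"
proof -
  have g: "continuous_map (top_of_set {0..1}) (mtopology_of P) g" using assms by (simp add: pathin_def)
  have g': "continuous_map (top_of_set {0..1}) (mtopology_of P) (restrict g {0..1})"
    by (rule continuous_map_eq[OF g]) simp
  \<comment> \<open>\<open>cfunspace\<close> consists of bounded functions; the image of a path is
    compact and therefore bounded.\<close>
  have "compactin (top_of_set {0..1::real}) {0..1}" by (simp add: compactin_subtopology)
  from image_compactin[OF this g'] have "compactin (mtopology_of P) (restrict g {0..1} ` {0..1})" .
  then have "Metric_space.mbounded (mspace P) (mdist P) (restrict g {0..1} ` {0..1})"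
    unfolding mtopology_of_def by (rule Metric_space.compactin_imp_mbounded[OF Metric_space_mspace_mdist])
  moreover have "restrict g {0..1} \<in> {0..1} \<rightarrow> mspace P"
    using continuous_map_funspace[OF g'] by simp
  ultimately show ?thesis using g' by (simp add: mem_path_space_iff)
qed

lemma compact_graph:
  assumes "continuous_map (top_of_set {0..1}) (mtopology_of P) \<gamma>" shows "compactin base_space (graph \<gamma>)"
  unfolding graph_def
proof (rule image_compactin)
  show "compactin (top_of_set {0..1::real}) {0..1}" by (simp add: compactin_subtopology)
  show "continuous_map (top_of_set {0..1}) base_space (\<lambda>x. (x, \<gamma> x))"
    using assms by (simp add: continuous_map_paired)
qed

text \<open>The path in \<open>E\<close> splits into a real coordinate and a path \<gamma> in
  \<open>P\<close>. Consistency along \<gamma> is an equality over its graph, and the map acting by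
  \<open>fst \<circ> g\<close> on the real coordinate carries it to \<open>E\<close>. Between its
  ends \<gamma> may leave \<open>S\<close>.\<close>

lemma fiber_push_eq_of_path_component:
  assumes a: "consistent_on a S" and S: "p \<in> S" "q \<in> S"
    and comp: "path_component_of (subtopology base_space E) (s, p) (t, q)"
  shows "fiber_push s p E (a p) = fiber_push t q E (a q)"
proof -
  obtain g where g: "pathin (subtopology base_space E) g" "g 0 = (s, p)" "g 1 = (t, q)"
    using comp unfolding path_component_of_def by blast
  then have gE: "g x \<in> E" if "x \<in> {0..1}" for x
    using that unfolding pathin_def continuous_map_in_subtopology by auto
  have gc: "continuous_map (top_of_set {0..1}) base_space g"
    using g(1) unfolding pathin_def continuous_map_in_subtopology by blast
  then have h: "continuous_on {0..1} (fst \<circ> g)" and sg: "pathin (mtopology_of P) (snd \<circ> g)"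
    unfolding continuous_map_pairwise pathin_def by simp_all
  define \<gamma> where "\<gamma> = restrict (snd \<circ> g) {0..1}"
  have \<gamma>: "\<gamma> \<in> topspace (path_space P p q)"
    using restrict_mem_path_space[OF sg] g(2,3) unfolding \<gamma>_def by simp
  have ends: "\<gamma> 0 = p" "\<gamma> 1 = q" using path_spaceD[OF \<gamma>] by blast+
  have "consistent a \<gamma>" using a S \<gamma> unfolding consistent_on_def by blast
  then have eq: "fiber_push 0 p (graph \<gamma>) (a p) = fiber_push 1 q (graph \<gamma>) (a q)"
    unfolding consistent_iff ends .
  have aH: "a p \<in> H1 (fiber M \<pi> p)" "a q \<in> H1 (fiber M \<pi> q)" using a S unfolding consistent_on_def by blast+
  have mem: "(0, p) \<in> graph \<gamma>" "(1, q) \<in> graph \<gamma>" using ends by (force simp: graph_def)+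
  have sub: "fst ` graph \<gamma> \<subseteq> {0..1}" by (auto simp: graph_def)
  have gr: "((fst \<circ> g) x, r) \<in> E" if "(x, r) \<in> graph \<gamma>" for x r
    using that gE by (auto simp: graph_def \<gamma>_def)
  have push: "push22 (restricted (graph \<gamma>)) (restricted E) (\<lambda>z. ((fst \<circ> g) (fst z), snd z))
      (fiber_push x r (graph \<gamma>) c) = fiber_push ((fst \<circ> g) x) r E c"
    if "(x, r) \<in> graph \<gamma>" "c \<in> H1 (fiber M \<pi> r)" for x r c
    by (rule push_fiber_push[OF h sub _ that]) (rule gr)
  show ?thesis using push[OF mem(1) aH(1)] push[OF mem(2) aH(2)] eq g(2,3) by simp
qed

lemma over_Inter: "over (\<Inter>k. E k) = (\<Inter>k::nat. over (E k))"
  by (auto simp: over_def)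

lemma compact_sequence_tail:
  assumes "converges_to base_space C K" shows "compact_sequence total_space (\<lambda>k. over (tail C K k))"
proof
  show "Hausdorff_space total_space" by (rule Hausdorff_total)
  show "compactin total_space (over (tail C K k))" for k by (rule compact_over[OF compactin_tail[OF assms]])
  show "decseq (\<lambda>k. over (tail C K k))"
    using decseqD[OF decseq_tail, of _ _ C K] by (intro antimonoI) (auto simp: over_def)
qed

lemma Inter_over_tail:
  assumes "converges_to base_space C K" shows "(\<Inter>k. over (tail C K k)) = over K"
  using Inter_tail[OF Hausdorff_base assms] over_Inter[of "tail C K"] by simp

lemma fiber_push_limit_inj:
  assumes C: "converges_to base_space C K" and mem: "(s, p) \<in> K" "(t, q) \<in> K"
    and a: "a \<in> H1 (fiber M \<pi> p)" and b: "b \<in> H1 (fiber M \<pi> q)"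
    and eq: "\<And>k. fiber_push s p (tail C K k) a = fiber_push t q (tail C K k) b"
  shows "fiber_push s p K a = fiber_push t q K b"
proof -
  have K: "K \<subseteq> tail C K k" for k unfolding tail_def by blast
  show ?thesis
    by (rule limit_inj[OF compact_sequence_tail[OF C], unfolded Inter_over_tail[OF C]])
       (simp_all add: fiber_push_closed mem a b fiber_push_mono[OF K] eq)
qed

text \<open>Over a single point the theory on the product gives back that of the fibre in
  \<open>M\<close>, so a limit class found over \<open>(t, p)\<close> can be read as a value at
  \<open>p\<close>.\<close>

lemma homeomorphic_fiber_point:
  assumes "p \<in> mspace P" shows "homeomorphic_map (fiber M \<pi> p) (restricted {(t, p)}) (\<lambda>y. (t, y))"
proof -
  have "continuous_map (restricted {(t, p)}) (fiber M \<pi> p) snd"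
    by (auto simp: fiber_def continuous_map_in_subtopology over_def
        intro: continuous_map_from_subtopology[OF continuous_map_snd])
  moreover have "snd ` {y. snd y \<in> topspace M} \<subseteq> topspace M" by auto
  ultimately have "homeomorphic_maps (fiber M \<pi> p) (restricted {(t, p)}) (\<lambda>y. (t, y)) snd"
    using continuous_fiber_push[of t p "{(t, p)}"]
    by (auto simp: homeomorphic_maps_def over_def)
  then show ?thesis using homeomorphic_map_maps by blast
qed

lemma fiber_push_point_bij:
  "p \<in> mspace P \<Longrightarrow> bij_betw (fiber_push t p {(t, p)}) (H1 (fiber M \<pi> p)) (H2 (restricted {(t, p)}))"
  unfolding fiber_push_def by (rule homeomorphism[OF homeomorphic_fiber_point])

lemma mtopology_P: "mtopology_of P = Metric_space.mtopology (mspace P) (mdist P)"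
  by (simp add: mtopology_of_def)

section \<open>Uniform limits of paths\<close>

lemma inverse_Suc_less: "0 < \<epsilon> \<Longrightarrow> \<exists>m. \<forall>j\<ge>m. 1 / (real j + 1) < (\<epsilon> :: real)"
proof -
  assume "0 < \<epsilon>"
  then obtain m where m: "1 / (real m + 1) < \<epsilon>"
    using reals_Archimedean[of \<epsilon>] by (auto simp: inverse_eq_divide add.commute)
  have "1 / (real j + 1) < \<epsilon>" if "m \<le> j" for j
    by (rule le_less_trans[OF _ m]) (use that in \<open>simp add: frac_le\<close>)
  then show ?thesis by blast
qed

lemma graphs_converge:
  assumes \<gamma>: "continuous_map (top_of_set {0..1}) (mtopology_of P) \<gamma>"
    and \<delta>: "\<And>j. continuous_map (top_of_set {0..1}) (mtopology_of P) (\<delta> j)"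
    and close: "\<And>j x. x \<in> {0..1} \<Longrightarrow> mdist P (\<gamma> x) (\<delta> j x) \<le> 1 / (real j + 1)"
  shows "converges_to base_space (\<lambda>j. graph (\<delta> j)) (graph \<gamma>)"
  unfolding converges_to_def
proof (intro conjI allI impI compact_graph \<gamma> \<delta>)
  fix U assume U: "openin base_space U \<and> graph \<gamma> \<subseteq> U"
  interpret PM: Metric_space "mspace (prod_metric euclidean_metric P)" "mdist (prod_metric euclidean_metric P)"
    by (rule Metric_space_mspace_mdist)
  have top: "PM.mtopology = base_space"
    using mtopology_of_prod_metric[of "euclidean_metric :: real metric" P] by (simp add: mtopology_of_def)
  \<comment> \<open>A Lebesgue number of this one-member cover is a radius by which the compact
    graph can be thickened uniformly inside \<open>U\<close>.\<close>
  have "\<exists>\<epsilon>>0. \<forall>z\<in>graph \<gamma>. \<exists>V\<in>{U}. PM.mball z \<epsilon> \<subseteq> V"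
  proof (rule PM.lebesgue_number)
    show "compactin PM.mtopology (graph \<gamma>)" unfolding top by (rule compact_graph[OF \<gamma>])
    show "graph \<gamma> \<subseteq> \<Union>{U}" using U by simp
    show "openin PM.mtopology V" if "V \<in> {U}" for V unfolding top using U that by simp
  qed
  then obtain \<epsilon> where \<epsilon>: "0 < \<epsilon>" "\<And>z. z \<in> graph \<gamma> \<Longrightarrow> PM.mball z \<epsilon> \<subseteq> U" by auto
  obtain m where m: "\<And>j. j \<ge> m \<Longrightarrow> 1 / (real j + 1) < \<epsilon>" using inverse_Suc_less[OF \<epsilon>(1)] by blast
  have "graph (\<delta> j) \<subseteq> U" if j: "j \<ge> m" for j
  proof
    fix z assume "z \<in> graph (\<delta> j)"
    then obtain x where x: "x \<in> {0..1}" "z = (x, \<delta> j x)" by (auto simp: graph_def)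
    have "\<gamma> x \<in> mspace P" "\<delta> j x \<in> mspace P"
      using continuous_map_funspace[OF \<gamma>] continuous_map_funspace[OF \<delta>[of j]] x(1) by auto
    moreover have "mdist P (\<gamma> x) (\<delta> j x) < \<epsilon>" using close[OF x(1), of j] m[OF j] by simp
    \<comment> \<open>Both points have first coordinate \<open>x\<close>, so their distance is the
      one in \<open>P\<close>.\<close>
    ultimately have "z \<in> PM.mball (x, \<gamma> x) \<epsilon>"
      unfolding PM.in_mball x(2) by (simp add: prod_dist_def)
    then show "z \<in> U" using \<epsilon>(2)[of "(x, \<gamma> x)"] x(1) by (auto simp: graph_def)
  qed
  then show "\<exists>m. \<forall>j\<ge>m. graph (\<delta> j) \<subseteq> U" by blast
qed

lemma dense_path_approximation:
  assumes D: "dense_in (path_space P p q) D" and \<gamma>: "\<gamma> \<in> topspace (path_space P p q)" and "0 < \<epsilon>"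
  shows "\<exists>\<delta>\<in>D. \<forall>x\<in>{0..1}. mdist P (\<gamma> x) (\<delta> x) \<le> \<epsilon>"
proof -
  let ?C = "cfunspace (top_of_set {0..1}) P"
  interpret C: Metric_space "mspace ?C" "mdist ?C" by (rule Metric_space_mspace_mdist)
  have \<gamma>C: "\<gamma> \<in> mspace ?C" using \<gamma> unfolding mem_path_space_iff by blast
  let ?T = "C.mball \<gamma> \<epsilon> \<inter> {\<gamma>. \<gamma> 0 = p \<and> \<gamma> 1 = q}"
  have "openin (path_space P p q) ?T"
    unfolding path_space_def mtopology_of_def by (rule openin_subtopology_Int[OF C.openin_mball])
  moreover have "\<gamma> \<in> C.mball \<gamma> \<epsilon>" unfolding C.centre_in_mball_iff using \<gamma>C \<open>0 < \<epsilon>\<close> by blast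
  then have "\<gamma> \<in> ?T" using \<gamma> unfolding mem_path_space_iff by blast
  moreover have "\<gamma> \<in> path_space P p q closure_of D" using D \<gamma> unfolding dense_in_def by simp
  then have "\<forall>T. \<gamma> \<in> T \<and> openin (path_space P p q) T \<longrightarrow> (\<exists>\<delta>. \<delta> \<in> D \<and> \<delta> \<in> T)"
    unfolding in_closure_of by (rule conjunct2)
  ultimately obtain \<delta> where \<delta>: "\<delta> \<in> D" "\<delta> \<in> C.mball \<gamma> \<epsilon>" by (meson IntD1)
  then have d: "\<delta> \<in> mspace ?C" "mdist ?C \<gamma> \<delta> \<le> \<epsilon>" unfolding C.in_mball by (blast, linarith)
  have "\<forall>x\<in>topspace (top_of_set {0..1}). mdist P (\<gamma> x) (\<delta> x) \<le> \<epsilon>"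
    using cfunspace_mdist_le[OF \<gamma>C d(1), of \<epsilon>] d(2) by simp
  with \<delta>(1) show ?thesis by (intro bexI[of _ \<delta>]) simp_all
qed

text \<open>All approximating paths have the ends \<open>p\<close> and \<open>q\<close>, so the two
  points compared stay in every tail. Equality over the \<open>k\<close>-th tail is inherited from
  the graph of the single path \<delta> k, and \<open>fiber_push_limit_inj\<close> passes to the
  limit.\<close>

lemma consistent_of_dense:
  assumes a: "a p \<in> H1 (fiber M \<pi> p)" "a q \<in> H1 (fiber M \<pi> q)"
    and D: "dense_in (path_space P p q) D" "\<And>\<delta>. \<delta> \<in> D \<Longrightarrow> consistent a \<delta>"
    and \<gamma>: "\<gamma> \<in> topspace (path_space P p q)"
  shows "consistent a \<gamma>"
proof -
  have "\<exists>\<delta>\<in>D. \<forall>x\<in>{0..1}. mdist P (\<gamma> x) (\<delta> x) \<le> 1 / (real j + 1)" for j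
    by (rule dense_path_approximation[OF D(1) \<gamma>]) simp
  then obtain \<delta> where \<delta>: "\<And>j. \<delta> j \<in> D"
    "\<And>j x. x \<in> {0..1} \<Longrightarrow> mdist P (\<gamma> x) (\<delta> j x) \<le> 1 / (real j + 1)"
    by metis
  have \<delta>p: "\<delta> j \<in> topspace (path_space P p q)" for j
    using D(1) \<delta>(1) unfolding dense_in_def by blast
  note conv = graphs_converge[OF path_spaceD(1)[OF \<gamma>] path_spaceD(1)[OF \<delta>p] \<delta>(2)]
  have mem: "(0, p) \<in> graph \<eta>" "(1, q) \<in> graph \<eta>" if "\<eta> \<in> topspace (path_space P p q)" for \<eta>
    using path_spaceD(2,3)[OF that] by (force simp: graph_def)+
  have "fiber_push 0 p (graph \<gamma>) (a p) = fiber_push 1 q (graph \<gamma>) (a q)"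
  proof (rule fiber_push_limit_inj[OF conv mem[OF \<gamma>] a])
    fix k
    have "graph (\<delta> k) \<subseteq> tail (\<lambda>j. graph (\<delta> j)) (graph \<gamma>) k" unfolding tail_def by auto
    note mono = fiber_push_mono[OF this]
    have "consistent a (\<delta> k)" by (rule D(2)[OF \<delta>(1)])
    then have "fiber_push 0 p (graph (\<delta> k)) (a p) = fiber_push 1 q (graph (\<delta> k)) (a q)"
      unfolding consistent_iff path_spaceD(2,3)[OF \<delta>p] .
    then show "fiber_push 0 p (tail (\<lambda>j. graph (\<delta> j)) (graph \<gamma>) k) (a p) =
        fiber_push 1 q (tail (\<lambda>j. graph (\<delta> j)) (graph \<gamma>) k) (a q)"
      using mono[OF mem(1)[OF \<delta>p] a(1)] mono[OF mem(2)[OF \<delta>p] a(2)] by simp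
  qed
  then show ?thesis unfolding consistent_iff path_spaceD(2,3)[OF \<gamma>] .
qed

section \<open>Short paths into the dense set and the extended values\<close>

text \<open>The path \<open>\<rho> j\<close> is drawn over an interval of length \<open>1 / (j + 1)\<close> that starts at \<open>t\<close> and
  goes to the right (\<open>c = 1\<close>) or to the left (\<open>c = -1\<close>).\<close>

definition whisker :: "real \<Rightarrow> real \<Rightarrow> (nat \<Rightarrow> real \<Rightarrow> 'p) \<Rightarrow> nat \<Rightarrow> (real \<times> 'p) set" where
  "whisker t c \<rho> j = (\<lambda>s. (t + c * (s / (real j + 1)), \<rho> j s)) ` {0..1}"

definition approaches :: "(nat \<Rightarrow> real \<Rightarrow> 'p) \<Rightarrow> 'p set \<Rightarrow> 'p \<Rightarrow> bool" where
  "approaches \<rho> S p \<longleftrightarrow> p \<in> mspace P \<and> (\<forall>j. pathin (mtopology_of P) (\<rho> j) \<and> \<rho> j 0 = p \<and> \<rho> j 1 \<in> S \<and>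
     (\<forall>s\<in>{0..1}. mdist P p (\<rho> j s) < 1 / (real j + 1)))"

lemma approachesD:
  assumes "approaches \<rho> S p"
  shows "p \<in> mspace P" "pathin (mtopology_of P) (\<rho> j)" "\<rho> j 0 = p" "\<rho> j 1 \<in> S"
    "s \<in> {0..1} \<Longrightarrow> mdist P p (\<rho> j s) < 1 / (real j + 1)"
  using assms unfolding approaches_def by simp_all

text \<open>Local path-connectedness gives an open path-connected set around \<open>p\<close> inside
  the ball of radius \<open>1 / (j + 1)\<close>, and density puts a point of \<open>S\<close> in
  it.\<close>

lemma approaches_exists:
  assumes S: "dense_in (mtopology_of P) S" and p: "p \<in> mspace P" shows "\<exists>\<rho>. approaches \<rho> S p"
proof -
  interpret PM: Metric_space "mspace P" "mdist P" by (rule Metric_space_mspace_mdist)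
  have "\<exists>g. pathin (mtopology_of P) g \<and> g 0 = p \<and> g 1 \<in> S \<and>
      (\<forall>s\<in>{0..1}. mdist P p (g s) < 1 / (real j + 1))" for j
  proof -
    let ?B = "PM.mball p (1 / (real j + 1))"
    have "openin (mtopology_of P) ?B" "p \<in> ?B" using p by (simp_all add: mtopology_P)
    then obtain V where V: "openin (mtopology_of P) V" "path_connectedin (mtopology_of P) V" "p \<in> V" "V \<subseteq> ?B"
      using lpc unfolding locally_path_connected_space by meson
    have "p \<in> mtopology_of P closure_of S" using S p unfolding dense_in_def by simp
    then obtain q where q: "q \<in> S" "q \<in> V" using V unfolding in_closure_of by blast
    obtain g where g: "pathin (mtopology_of P) g" "g \<in> {0..1} \<rightarrow> V" "g 0 = p" "g 1 = q"
      using V(2,3) q(2) unfolding path_connectedin by blast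
    have "mdist P p (g s) < 1 / (real j + 1)" if "s \<in> {0..1}" for s
    proof -
      have "g s \<in> ?B" using funcset_mem[OF g(2) that] V(4) by blast
      then show ?thesis by simp
    qed
    then show ?thesis using g q(1) by blast
  qed
  then obtain \<rho> where "\<forall>j. pathin (mtopology_of P) (\<rho> j) \<and> \<rho> j 0 = p \<and> \<rho> j 1 \<in> S \<and>
      (\<forall>s\<in>{0..1}. mdist P p (\<rho> j s) < 1 / (real j + 1))"
    by metis
  with p show ?thesis unfolding approaches_def by blast
qed

lemma continuous_whisker:
  assumes "pathin (mtopology_of P) (\<rho> j)"
  shows "continuous_map (top_of_set {0..1}) base_space (\<lambda>s. (t + c * (s / (real j + 1)), \<rho> j s))"
proof -
  have "continuous_on {0..1} (\<lambda>s. t + c * (s / (real j + 1)))" by (intro continuous_intros) simp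
  then show ?thesis using assms by (simp add: continuous_map_paired pathin_def)
qed

lemma whisker_converges:
  assumes \<rho>: "approaches \<rho> S p" and c: "\<bar>c\<bar> = 1"
  shows "converges_to base_space (whisker t c \<rho>) {(t, p)}"
  unfolding converges_to_def
proof (intro conjI allI impI)
  show "compactin base_space {(t, p)}" using \<rho> by (simp add: approaches_def)
  show "compactin base_space (whisker t c \<rho> j)" for j
    unfolding whisker_def
  proof (rule image_compactin)
    show "compactin (top_of_set {0..1::real}) {0..1}" by (simp add: compactin_subtopology)
    show "continuous_map (top_of_set {0..1}) base_space (\<lambda>s. (t + c * (s / (real j + 1)), \<rho> j s))"
      by (rule continuous_whisker[OF approachesD(2)[OF \<rho>]])
  qed
  interpret PM: Metric_space "mspace P" "mdist P" by (rule Metric_space_mspace_mdist)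
  fix U assume U: "openin base_space U \<and> {(t, p)} \<subseteq> U"
  then have "\<forall>x y. (x, y) \<in> U \<longrightarrow> (\<exists>V W. openin euclideanreal V \<and> openin (mtopology_of P) W \<and>
      x \<in> V \<and> y \<in> W \<and> V \<times> W \<subseteq> U)"
    unfolding openin_prod_topology_alt by (rule conjunct1)
  moreover have "(t, p) \<in> U" using U by blast
  ultimately obtain V W where V: "openin euclideanreal V" and VW: "openin (mtopology_of P) W" "t \<in> V" "p \<in> W" "V \<times> W \<subseteq> U"
    by meson
  have "open V" using V by simp
  obtain \<epsilon> where \<epsilon>: "0 < \<epsilon>" "ball t \<epsilon> \<subseteq> V" using openE[OF \<open>open V\<close> VW(2)] .
  obtain \<epsilon>' where \<epsilon>': "0 < \<epsilon>'" "PM.mball p \<epsilon>' \<subseteq> W"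
    using VW(1,3) unfolding mtopology_P PM.openin_mtopology by meson
  \<comment> \<open>The bound \<open>1 / (j + 1)\<close> controls both the width of a whisker and
    its distance from \<open>p\<close> in \<open>P\<close>.\<close>
  obtain m where m: "\<And>j. j \<ge> m \<Longrightarrow> 1 / (real j + 1) < min \<epsilon> \<epsilon>'"
    using inverse_Suc_less[of "min \<epsilon> \<epsilon>'"] \<epsilon>(1) \<epsilon>'(1) by auto
  have "whisker t c \<rho> j \<subseteq> U" if j: "j \<ge> m" for j
  proof
    fix z assume "z \<in> whisker t c \<rho> j"
    then obtain s where s: "s \<in> {0..1}" "z = (t + c * (s / (real j + 1)), \<rho> j s)"
      by (auto simp: whisker_def)
    have "\<bar>c * (s / (real j + 1))\<bar> \<le> 1 / (real j + 1)"
      using s(1) c by (simp add: abs_mult divide_right_mono)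
    then have "t + c * (s / (real j + 1)) \<in> V" using m[OF j] \<epsilon>(2) by (auto simp: dist_real_def)
    moreover have "\<rho> j s \<in> mspace P"
      using continuous_map_funspace[OF approachesD(2)[OF \<rho>, of j, unfolded pathin_def]] s(1) by auto
    then have "\<rho> j s \<in> PM.mball p \<epsilon>'"
      using approachesD(1)[OF \<rho>] approachesD(5)[OF \<rho> s(1), of j] m[OF j]
      unfolding PM.in_mball by simp
    then have "\<rho> j s \<in> W" using \<epsilon>'(2) by blast
    ultimately show "z \<in> U" using VW(4) s(2) by blast
  qed
  then show "\<exists>m. \<forall>j\<ge>m. whisker t c \<rho> j \<subseteq> U" by blast
qed

lemma whisker_path_component:
  assumes \<rho>: "approaches \<rho> S p" and E: "whisker t c \<rho> j \<subseteq> E"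
  shows "path_component_of (subtopology base_space E) (t, p) (t + c / (real j + 1), \<rho> j 1)"
proof -
  let ?g = "\<lambda>s. (t + c * (s / (real j + 1)), \<rho> j s)"
  have "continuous_map (top_of_set {0..1}) base_space ?g"
    by (rule continuous_whisker[OF approachesD(2)[OF \<rho>]])
  then have "pathin (subtopology base_space E) ?g"
    using E by (auto simp: pathin_def continuous_map_in_subtopology whisker_def)
  moreover have "?g 0 = (t, p)" using \<rho> by (simp add: approaches_def)
  ultimately show ?thesis unfolding path_component_of_def by (intro exI[of _ ?g]) simp
qed

text \<open>The inverse-limit description of the value at \<open>p\<close>, with whiskers that start
  at 0 and go right as the standard position. Other positions are reached by a reflection or a
  translation of the real coordinate.\<close>

definition limit_value :: "('p \<Rightarrow> 'h) \<Rightarrow> (nat \<Rightarrow> real \<Rightarrow> 'p) \<Rightarrow> 'p \<Rightarrow> 'h \<Rightarrow> bool" where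
  "limit_value a \<rho> p b \<longleftrightarrow> b \<in> H1 (fiber M \<pi> p) \<and>
     (\<forall>k. fiber_push 0 p (tail (whisker 0 1 \<rho>) {(0, p)} k) b =
          fiber_push (1 / (real k + 1)) (\<rho> k 1) (tail (whisker 0 1 \<rho>) {(0, p)} k) (a (\<rho> k 1)))"

lemma whisker_tail: "k \<le> j \<Longrightarrow> whisker t c \<rho> j \<subseteq> tail (whisker t c \<rho>) K k"
  by (auto simp: tail_def)

lemma whisker_end: "(t + c / (real j + 1), \<rho> j 1) \<in> whisker t c \<rho> j"
  by (force simp: whisker_def)

lemma whisker_end_tail: "k \<le> j \<Longrightarrow> (1 / (real j + 1), \<rho> j 1) \<in> tail (whisker 0 1 \<rho>) K k"
  using subsetD[OF whisker_tail whisker_end, of k j 0 1 \<rho> K] by simp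

lemma limit_value_exists:
  assumes a: "consistent_on a S" and \<rho>: "approaches \<rho> S p"
  shows "\<exists>b. limit_value a \<rho> p b"
proof -
  let ?W = "tail (whisker 0 1 \<rho>) {(0, p)}"
  define e where "e k = fiber_push (1 / (real k + 1)) (\<rho> k 1) (?W k) (a (\<rho> k 1))" for k
  have conv: "converges_to base_space (whisker 0 1 \<rho>) {(0, p)}" by (rule whisker_converges[OF \<rho>]) simp
  note S = approachesD(4)[OF \<rho>]
  then have aH: "a (\<rho> k 1) \<in> H1 (fiber M \<pi> (\<rho> k 1))" for k using a unfolding consistent_on_def by blast
  note mem = whisker_end_tail[of _ _ \<rho> "{(0, p)}"]
  have comp: "path_component_of (subtopology base_space (?W k)) (0, p) (1 / (real j + 1), \<rho> j 1)"
    if "k \<le> j" for j k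
    using whisker_path_component[OF \<rho> whisker_tail[OF that], of 0 1] by simp
  have "\<exists>c\<in>H2 (restricted {(0, p)}). \<forall>k. push22 (restricted {(0, p)}) (restricted (?W k)) id c = e k"
  proof (rule limit_surj[OF compact_sequence_tail[OF conv], unfolded Inter_over_tail[OF conv]])
    fix k
    show "e k \<in> H2 (restricted (?W k))"
      unfolding e_def by (rule fiber_push_closed[OF mem aH]) simp
    have "?W (Suc k) \<subseteq> ?W k" using decseqD[OF decseq_tail, of k "Suc k"] by simp
    then have "push22 (restricted (?W (Suc k))) (restricted (?W k)) id (e (Suc k)) =
        fiber_push (1 / (real (Suc k) + 1)) (\<rho> (Suc k) 1) (?W k) (a (\<rho> (Suc k) 1))"
      unfolding e_def by (rule fiber_push_mono[OF _ mem aH]) simp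
    \<comment> \<open>The ends of the whiskers \<open>k\<close> and \<open>k + 1\<close> are joined
      inside the \<open>k\<close>-th tail through \<open>(0, p)\<close>. Both lie over
      \<open>S\<close> even if \<open>p\<close> does not, so consistency applies to the joining
      path.\<close>
    also have "\<dots> = e k"
      unfolding e_def
      by (rule fiber_push_eq_of_path_component[OF a S S
            path_component_of_trans[OF path_component_of_sym[OF comp] comp]]) simp_all
    finally show "push22 (restricted (?W (Suc k))) (restricted (?W k)) id (e (Suc k)) = e k" .
  qed
  then obtain c where c: "c \<in> H2 (restricted {(0, p)})"
    "\<And>k. push22 (restricted {(0, p)}) (restricted (?W k)) id c = e k" by blast
  have "p \<in> mspace P" by (rule approachesD(1)[OF \<rho>])
  then obtain b where b: "b \<in> H1 (fiber M \<pi> p)" "c = fiber_push 0 p {(0, p)} b"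
    using fiber_push_point_bij[of p 0] c(1) unfolding bij_betw_def by blast
  have "fiber_push 0 p (?W k) b = e k" for k
    using fiber_push_mono[OF _ _ b(1), of "{(0, p)}" "?W k" 0] c(2)[of k] b(2) by (simp add: tail_def)
  then show ?thesis using b(1) unfolding limit_value_def e_def by blast
qed

text \<open>Consistency of \<open>a'\<close> along the whiskers forces \<open>a' p\<close> and
  \<open>b\<close> to have equal images in every tail, and limits are detected there. With
  \<open>a' = a\<close> and \<open>S' = S\<close> it shows that values on \<open>S\<close> are
  unchanged; with an arbitrary extension to all of \<open>P\<close> it gives uniqueness.\<close>

lemma limit_value_unique:
  assumes a': "consistent_on a' S'" and "S \<subseteq> S'" "\<And>q. q \<in> S \<Longrightarrow> a' q = a q"
    and \<rho>: "approaches \<rho> S p" and p: "p \<in> S'" and b: "limit_value a \<rho> p b"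
  shows "b = a' p"
proof -
  let ?W = "tail (whisker 0 1 \<rho>) {(0, p)}"
  have conv: "converges_to base_space (whisker 0 1 \<rho>) {(0, p)}" by (rule whisker_converges[OF \<rho>]) simp
  note S = approachesD(4)[OF \<rho>]
  have bH: "b \<in> H1 (fiber M \<pi> p)" using b unfolding limit_value_def by blast
  have a'H: "a' p \<in> H1 (fiber M \<pi> p)" using a' p unfolding consistent_on_def by blast
  have "fiber_push 0 p {(0, p)} b = fiber_push 0 p {(0, p)} (a' p)"
  proof (rule fiber_push_limit_inj[OF conv _ _ bH a'H])
    fix k
    have comp: "path_component_of (subtopology base_space (?W k)) (0, p) (1 / (real k + 1), \<rho> k 1)"
      using whisker_path_component[OF \<rho> whisker_tail[OF order_refl], of 0 1] by simp
    have "fiber_push 0 p (?W k) (a' p) = fiber_push (1 / (real k + 1)) (\<rho> k 1) (?W k) (a' (\<rho> k 1))"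
      by (rule fiber_push_eq_of_path_component[OF a' p subsetD[OF assms(2) S] comp])
    then show "fiber_push 0 p (?W k) b = fiber_push 0 p (?W k) (a' p)"
      using b S assms(3) unfolding limit_value_def by simp
  qed simp_all
  moreover have "p \<in> mspace P" by (rule approachesD(1)[OF \<rho>])
  ultimately show ?thesis
    using fiber_push_point_bij[of p 0] bH a'H unfolding bij_betw_def inj_on_def by blast
qed

lemma limit_value_consistent:
  assumes a: "consistent_on a S"
    and \<rho>: "approaches \<rho> S p" "limit_value a \<rho> p (b p)" and \<sigma>: "approaches \<sigma> S q" "limit_value a \<sigma> q (b q)"
    and \<gamma>: "\<gamma> \<in> topspace (path_space P p q)"
  shows "consistent b \<gamma>"
proof -
  \<comment> \<open>Whiskers at \<open>p\<close> run left from 0 and those at \<open>q\<close> right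
    from 1, so that whisker, graph and whisker together are the graph of one path over
    \<open>[-1/(j+1), 1 + 1/(j+1)]\<close>.\<close>
  let ?C = "\<lambda>j. whisker 0 (-1) \<rho> j \<union> whisker 1 1 \<sigma> j" and ?K = "graph \<gamma>"
  let ?F = "tail ?C ?K"
  note ends = path_spaceD(2,3)[OF \<gamma>] and \<gamma>c = path_spaceD(1)[OF \<gamma>]
  have mem: "(0, p) \<in> ?K" "(1, q) \<in> ?K" using ends by (force simp: graph_def)+
  have "converges_to base_space (whisker 0 (-1) \<rho>) ?K" "converges_to base_space (whisker 1 1 \<sigma>) ?K"
    using converges_to_mono[OF whisker_converges[OF \<rho>(1), of "-1" 0] _ compact_graph[OF \<gamma>c]]
      converges_to_mono[OF whisker_converges[OF \<sigma>(1), of 1 1] _ compact_graph[OF \<gamma>c]] mem by simp_all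
  then have conv: "converges_to base_space ?C ?K" by (rule converges_to_Un)
  have bH: "b p \<in> H1 (fiber M \<pi> p)" "b q \<in> H1 (fiber M \<pi> q)"
    using \<rho>(2) \<sigma>(2) unfolding limit_value_def by blast+
  note S = approachesD(4)[OF \<rho>(1)] approachesD(4)[OF \<sigma>(1)]
  have aH: "a (\<rho> k 1) \<in> H1 (fiber M \<pi> (\<rho> k 1))" "a (\<sigma> k 1) \<in> H1 (fiber M \<pi> (\<sigma> k 1))" for k
    using a S unfolding consistent_on_def by blast+
  have "fiber_push 0 p ?K (b p) = fiber_push 1 q ?K (b q)"
  proof (rule fiber_push_limit_inj[OF conv mem bH])
    fix k
    have end_mem: "(1 / (real k + 1), \<tau> k 1) \<in> tail (whisker 0 1 \<tau>) {(0, r)} k"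
      "(0, r) \<in> tail (whisker 0 1 \<tau>) {(0, r)} k" for \<tau> r
      by (rule whisker_end_tail[OF order_refl], simp add: tail_def)
    have left: "(- x, r) \<in> ?F k" if "(x, r) \<in> tail (whisker 0 1 \<rho>) {(0, p)} k" for x r
      using that mem by (auto simp: tail_def whisker_def)
    have right: "(1 + x, r) \<in> ?F k" if "(x, r) \<in> tail (whisker 0 1 \<sigma>) {(0, q)} k" for x r
      using that mem by (auto simp: tail_def whisker_def)
    \<comment> \<open>Reflecting the real coordinate moves the standard whiskers at \<open>p\<close>
      to the left of the graph; translating it by 1 moves those at \<open>q\<close> to the right
      end. The forms \<open>- 0\<close> and \<open>1 + 0\<close> are the images of the base points
      under these two maps.\<close>
    have "fiber_push (- 0) p (?F k) (b p) = fiber_push (- (1 / (real k + 1))) (\<rho> k 1) (?F k) (a (\<rho> k 1))"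
    proof -
      have "push22 (restricted (tail (whisker 0 1 \<rho>) {(0, p)} k)) (restricted (?F k)) (\<lambda>z. (- fst z, snd z))
          (fiber_push x r (tail (whisker 0 1 \<rho>) {(0, p)} k) d) = fiber_push (- x) r (?F k) d"
        if "(x, r) \<in> tail (whisker 0 1 \<rho>) {(0, p)} k" "d \<in> H1 (fiber M \<pi> r)" for x r d
        by (rule push_fiber_push[OF _ subset_UNIV _ that]) (auto intro: continuous_intros left)
      from this[OF end_mem(2) bH(1)] this[OF end_mem(1) aH(1)] show ?thesis
        using \<rho>(2) unfolding limit_value_def by simp
    qed
    moreover have "fiber_push (1 + 0) q (?F k) (b q) = fiber_push (1 + 1 / (real k + 1)) (\<sigma> k 1) (?F k) (a (\<sigma> k 1))"
    proof -
      have "push22 (restricted (tail (whisker 0 1 \<sigma>) {(0, q)} k)) (restricted (?F k)) (\<lambda>z. (1 + fst z, snd z))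
          (fiber_push x r (tail (whisker 0 1 \<sigma>) {(0, q)} k) d) = fiber_push (1 + x) r (?F k) d"
        if "(x, r) \<in> tail (whisker 0 1 \<sigma>) {(0, q)} k" "d \<in> H1 (fiber M \<pi> r)" for x r d
        by (rule push_fiber_push[OF _ subset_UNIV _ that]) (auto intro: continuous_intros right)
      from this[OF end_mem(2) bH(2)] this[OF end_mem(1) aH(2)] show ?thesis
        using \<sigma>(2) unfolding limit_value_def by simp
    qed
    moreover have "fiber_push (- (1 / (real k + 1))) (\<rho> k 1) (?F k) (a (\<rho> k 1)) =
        fiber_push (1 + 1 / (real k + 1)) (\<sigma> k 1) (?F k) (a (\<sigma> k 1))"
    \<comment> \<open>The path runs from the end of the left whisker to \<open>p\<close>, along
      \<gamma>, and from \<open>q\<close> to the end of the right whisker. Its ends lie over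
      \<open>S\<close>, so consistency of the original \<open>a\<close> decides.\<close>
    proof (rule fiber_push_eq_of_path_component[OF a S])
      have "whisker 0 (-1) \<rho> k \<subseteq> ?F k" "whisker 1 1 \<sigma> k \<subseteq> ?F k" by (auto simp: tail_def)
      note w = whisker_path_component[OF \<rho>(1) this(1)] whisker_path_component[OF \<sigma>(1) this(2)]
      have "graph \<gamma> \<subseteq> ?F k" by (auto simp: tail_def)
      moreover have "continuous_map (top_of_set {0..1}) base_space (\<lambda>x. (x, \<gamma> x))"
        using \<gamma>c by (simp add: continuous_map_paired)
      ultimately have "pathin (subtopology base_space (?F k)) (\<lambda>x. (x, \<gamma> x))"
        by (auto simp: pathin_def continuous_map_in_subtopology graph_def)
      then have "path_component_of (subtopology base_space (?F k)) (0, p) (1, q)"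
        unfolding path_component_of_def using ends by (intro exI[of _ "\<lambda>x. (x, \<gamma> x)"]) simp
      from path_component_of_trans[OF path_component_of_trans[OF path_component_of_sym[OF w(1)] this] w(2)]
      show "path_component_of (subtopology base_space (?F k)) (- (1 / (real k + 1)), \<rho> k 1)
          (1 + 1 / (real k + 1), \<sigma> k 1)" by simp
    qed
    ultimately show "fiber_push 0 p (?F k) (b p) = fiber_push 1 q (?F k) (b q)" by simp
  qed
  then show ?thesis unfolding consistent_iff ends .
qed

text \<open>Approaching paths are fixed once for each point. Consistency along every path holds for
  whatever was chosen, because the whiskers at the two ends of a path may be selected
  independently.\<close>

theorem consistent_extension:
  assumes S: "dense_in (mtopology_of P) S" and aH: "\<And>p. p \<in> S \<Longrightarrow> a p \<in> H1 (fiber M \<pi> p)"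
    and D: "\<And>p q. p \<in> S \<Longrightarrow> q \<in> S \<Longrightarrow> \<exists>D. dense_in (path_space P p q) D \<and> (\<forall>\<gamma>\<in>D. consistent a \<gamma>)"
  shows "\<exists>b. consistent_on b (mspace P) \<and> (\<forall>p\<in>S. b p = a p) \<and>
    (\<forall>b'. consistent_on b' (mspace P) \<longrightarrow> (\<forall>p\<in>S. b' p = a p) \<longrightarrow> (\<forall>p\<in>mspace P. b' p = b p))"
proof -
  have a: "consistent_on a S"
    unfolding consistent_on_def using aH D consistent_of_dense by meson
  have SP: "S \<subseteq> mspace P" using S by (simp add: dense_in_def)
  have "\<exists>\<rho> b. approaches \<rho> S p \<and> limit_value a \<rho> p b" if "p \<in> mspace P" for p
    using approaches_exists[OF S that] limit_value_exists[OF a] by blast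
  then obtain \<rho> b where b: "\<And>p. p \<in> mspace P \<Longrightarrow> approaches (\<rho> p) S p"
      "\<And>p. p \<in> mspace P \<Longrightarrow> limit_value a (\<rho> p) p (b p)"
    by metis
  have "consistent_on b (mspace P)"
    unfolding consistent_on_def
  proof (intro conjI ballI)
    fix p assume p: "p \<in> mspace P"
    show "b p \<in> H1 (fiber M \<pi> p)" using b(2)[OF p] unfolding limit_value_def by blast
    fix q \<gamma> assume q: "q \<in> mspace P" and \<gamma>: "\<gamma> \<in> topspace (path_space P p q)"
    show "consistent b \<gamma>"
      by (rule limit_value_consistent[OF a b(1)[OF p] b(2)[OF p] b(1)[OF q] b(2)[OF q] \<gamma>])
  qed
  moreover have "b p = a p" if "p \<in> S" for p
    using limit_value_unique[OF a subset_refl refl b(1) that b(2)] that SP by blast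
  moreover have "b' p = b p" if b': "consistent_on b' (mspace P)" "\<forall>p\<in>S. b' p = a p" and p: "p \<in> mspace P" for b' p
    using limit_value_unique[OF b'(1) SP _ b(1)[OF p] p b(2)[OF p]] b'(2) by simp
  ultimately show ?thesis by blast
qed

end

section \<open>The three Cech theories\<close>

text \<open>Functoriality makes the maps induced by a homeomorphism and by its inverse mutually
  inverse. \<open>push\<close> and \<open>pull\<close> stand for one induced map, whose instances in
  the two directions have different types.\<close>

lemma functorial_bij_betw:
  assumes f: "homeomorphic_map X Y f"
    and closed: "\<And>a. a \<in> HX \<Longrightarrow> push f a \<in> HY" "\<And>g b. continuous_map Y X g \<Longrightarrow> b \<in> HY \<Longrightarrow> pull g b \<in> HX"
    and comp: "\<And>g a. continuous_map X Y f \<Longrightarrow> continuous_map Y X g \<Longrightarrow> a \<in> HX \<Longrightarrow>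
        (\<And>x. x \<in> topspace X \<Longrightarrow> g (f x) = x) \<Longrightarrow> pull g (push f a) = a"
      "\<And>g b. continuous_map X Y f \<Longrightarrow> continuous_map Y X g \<Longrightarrow> b \<in> HY \<Longrightarrow>
        (\<And>y. y \<in> topspace Y \<Longrightarrow> f (g y) = y) \<Longrightarrow> push f (pull g b) = b"
  shows "bij_betw (push f) HX HY"
proof -
  obtain g where "homeomorphic_maps X Y f g" using f homeomorphic_map_maps by blast
  then have fg: "continuous_map X Y f" "continuous_map Y X g"
    "\<And>x. x \<in> topspace X \<Longrightarrow> g (f x) = x" "\<And>y. y \<in> topspace Y \<Longrightarrow> f (g y) = y"
    by (auto simp: homeomorphic_maps_def)
  show ?thesis
    by (rule bij_betwI[where g = "pull g"])
       (use closed comp(1)[OF fg(1,2) _ fg(3)] comp(2)[OF fg(1,2) _ fg(4)] fg(2) in auto)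
qed

lemma cech_homology_induced_bij:
  assumes f: "homeomorphic_map X Y f"
  shows "bij_betw (cech_homology_induced n X Y f) (carrier (cech_homology n X)) (carrier (cech_homology n Y))"
proof (rule functorial_bij_betw[OF f, where push = "cech_homology_induced n X Y" and pull = "cech_homology_induced n Y X"])
  note cf = homeomorphic_imp_continuous_map[OF f]
  show "cech_homology_induced n X Y f a \<in> carrier (cech_homology n Y)"
    if "a \<in> carrier (cech_homology n X)" for a :: "('a, 'c::comm_ring_1) cech_class"
    by (rule cech_homology_induced_closed[OF that cf])
qed (simp_all add: cech_homology_induced_closed cech_homology_induced_compose cech_homology_induced_id)

lemma dual_cech_cohomology_induced_bij:
  assumes f: "homeomorphic_map X Y f"
  shows "bij_betw (dual_cech_cohomology_induced n X Y f)
    (carrier (dual_cech_cohomology n X)) (carrier (dual_cech_cohomology n Y))"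
proof (rule functorial_bij_betw[OF f, where push = "dual_cech_cohomology_induced n X Y"
      and pull = "dual_cech_cohomology_induced n Y X"])
  note cf = homeomorphic_imp_continuous_map[OF f]
  show "dual_cech_cohomology_induced n X Y f a \<in> carrier (dual_cech_cohomology n Y)"
    if "a \<in> carrier (dual_cech_cohomology n X)" for a
    by (rule dual_cech_cohomology_induced_closed[OF that cf])
qed (simp_all add: dual_cech_cohomology_induced_closed dual_cech_cohomology_induced_compose
    dual_cech_cohomology_induced_id)

lemma continuous_homology_theory_cech_homology:
  "continuous_homology_theory (\<lambda>X. carrier (cech_homology n X :: ('m, 'c::comm_ring_1) cech_class monoid))
     (\<lambda>X. carrier (cech_homology n X)) (cech_homology_induced n) (cech_homology_induced n)"
proof
  show "\<exists>c\<in>carrier (cech_homology n (subtopology Z (\<Inter>k. A k))).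
      \<forall>k. cech_homology_induced n (subtopology Z (\<Inter>k. A k)) (subtopology Z (A k)) id c = e k"
    if "compact_sequence Z A" "\<And>k. e k \<in> carrier (cech_homology n (subtopology Z (A k)))"
      "\<And>k. cech_homology_induced n (subtopology Z (A (Suc k))) (subtopology Z (A k)) id (e (Suc k)) = e k"
    for Z A and e :: "nat \<Rightarrow> (real \<times> 'm, 'c) cech_class"
    by (rule compact_sequence.cech_homology_limit_surj[OF that])
  show "c = d" if "compact_sequence Z A"
    "c \<in> carrier (cech_homology n (subtopology Z (\<Inter>k. A k)))"
    "d \<in> carrier (cech_homology n (subtopology Z (\<Inter>k. A k)))"
    "\<And>k. cech_homology_induced n (subtopology Z (\<Inter>k. A k)) (subtopology Z (A k)) id c =
         cech_homology_induced n (subtopology Z (\<Inter>k. A k)) (subtopology Z (A k)) id d"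
    for Z A and c d :: "(real \<times> 'm, 'c) cech_class"
    by (rule compact_sequence.cech_homology_limit_inj[OF that])
qed (simp_all add: cech_homology_induced_closed cech_homology_induced_compose cech_homology_induced_bij)

lemma continuous_homology_theory_dual_cech_cohomology:
  "continuous_homology_theory (\<lambda>X :: 'm topology. carrier (dual_cech_cohomology n X))
     (\<lambda>X. carrier (dual_cech_cohomology n X))
     (dual_cech_cohomology_induced n) (dual_cech_cohomology_induced n)"
proof
  show "\<exists>c\<in>carrier (dual_cech_cohomology n (subtopology Z (\<Inter>k. A k))).
      \<forall>k. dual_cech_cohomology_induced n (subtopology Z (\<Inter>k. A k)) (subtopology Z (A k)) id c = e k"
    if "compact_sequence Z A" "\<And>k. e k \<in> carrier (dual_cech_cohomology n (subtopology Z (A k)))"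
      "\<And>k. dual_cech_cohomology_induced n (subtopology Z (A (Suc k))) (subtopology Z (A k)) id (e (Suc k)) = e k"
    for Z A and e :: "nat \<Rightarrow> (real \<times> 'm) cech_coclass \<Rightarrow> int"
    by (rule compact_sequence.dual_cech_cohomology_limit_surj[OF that])
  show "c = d" if "compact_sequence Z A"
    "c \<in> carrier (dual_cech_cohomology n (subtopology Z (\<Inter>k. A k)))"
    "d \<in> carrier (dual_cech_cohomology n (subtopology Z (\<Inter>k. A k)))"
    "\<And>k. dual_cech_cohomology_induced n (subtopology Z (\<Inter>k. A k)) (subtopology Z (A k)) id c =
         dual_cech_cohomology_induced n (subtopology Z (\<Inter>k. A k)) (subtopology Z (A k)) id d"
    for Z A and c d :: "(real \<times> 'm) cech_coclass \<Rightarrow> int"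
    by (rule compact_sequence.dual_cech_cohomology_limit_inj[OF that])
qed (simp_all add: dual_cech_cohomology_induced_closed dual_cech_cohomology_induced_compose
    dual_cech_cohomology_induced_bij)

section \<open>From single degrees to graded assignments\<close>

lemma mem_assignments_iff:
  "\<alpha> \<in> assignments H M \<pi> S \<longleftrightarrow>
     (\<forall>p\<in>S. \<forall>n. \<alpha> p n \<in> carrier (H n (fiber M \<pi> p))) \<and> \<alpha> \<in> extensional S"
  unfolding assignments_def PiE_def by (simp add: Pi_iff)

text \<open>Consistency is a condition in each degree separately, so the extension is built degree
  by degree. Extensionality outside \<open>P\<close> turns uniqueness of the values into equality of
  functions.\<close>

lemma unique_consistent_extension:
  assumes family: "\<And>n. proper_family (\<lambda>X. carrier (H n X)) (H2 n) (push n) (push2 n) P M \<pi>"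
    and S: "dense_in (mtopology_of P) S" and \<alpha>: "\<alpha> \<in> assignments H M \<pi> S"
    and D: "\<forall>p\<in>S. \<forall>q\<in>S. \<exists>D. dense_in (path_space P p q) D \<and> (\<forall>\<gamma>\<in>D. consistent_along push M \<pi> \<gamma> \<alpha>)"
  shows "\<exists>!\<beta>. \<beta> \<in> assignments H M \<pi> (mspace P) \<and> (\<forall>p\<in>S. \<beta> p = \<alpha> p) \<and>
    (\<forall>p\<in>mspace P. \<forall>q\<in>mspace P. \<forall>\<gamma>\<in>topspace (path_space P p q). consistent_along push M \<pi> \<gamma> \<beta>)"
proof -
  let ?con = "\<lambda>n. proper_family.consistent (push n) M \<pi>"
    and ?con_on = "\<lambda>n. proper_family.consistent_on (\<lambda>X. carrier (H n X)) (push n) P M \<pi>"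
  have con: "consistent_along push M \<pi> \<gamma> \<beta> \<longleftrightarrow> (\<forall>n. ?con n (\<lambda>p. \<beta> p n) \<gamma>)" for \<gamma> \<beta>
    by (simp add: consistent_along_def proper_family.consistent_def[OF family])
  have ends: "\<gamma> 0 = p" "\<gamma> 1 = q" if "\<gamma> \<in> topspace (path_space P p q)" for \<gamma> p q
    using proper_family.path_spaceD(2,3)[OF family[of 0] that] by blast+
  have SP: "S \<subseteq> mspace P" using S by (simp add: dense_in_def)
  have "\<exists>b. ?con_on n b (mspace P) \<and> (\<forall>p\<in>S. b p = \<alpha> p n) \<and>
      (\<forall>b'. ?con_on n b' (mspace P) \<longrightarrow> (\<forall>p\<in>S. b' p = \<alpha> p n) \<longrightarrow> (\<forall>p\<in>mspace P. b' p = b p))" for n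
  proof (rule proper_family.consistent_extension[OF family S])
    show "\<alpha> p n \<in> carrier (H n (fiber M \<pi> p))" if "p \<in> S" for p
      using \<alpha> that by (simp add: mem_assignments_iff)
    show "\<exists>D. dense_in (path_space P p q) D \<and> (\<forall>\<gamma>\<in>D. ?con n (\<lambda>p. \<alpha> p n) \<gamma>)" if "p \<in> S" "q \<in> S" for p q
      using D that unfolding con by meson
  qed
  then obtain b where b: "\<And>n. ?con_on n (b n) (mspace P)" "\<And>n p. p \<in> S \<Longrightarrow> b n p = \<alpha> p n"
    "\<And>n b' p. ?con_on n b' (mspace P) \<Longrightarrow> (\<forall>p\<in>S. b' p = \<alpha> p n) \<Longrightarrow> p \<in> mspace P \<Longrightarrow> b' p = b n p"
    by metis
  note b_on = b(1)[unfolded proper_family.consistent_on_def[OF family]]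
  define \<beta> where "\<beta> = (\<lambda>p\<in>mspace P. \<lambda>n. b n p)"
  show ?thesis
  proof (rule ex1I[of _ \<beta>], intro conjI ballI)
    show "\<beta> \<in> assignments H M \<pi> (mspace P)"
      using b_on by (simp add: mem_assignments_iff \<beta>_def)
    show "\<beta> p = \<alpha> p" if "p \<in> S" for p using that SP b(2) by (auto simp: \<beta>_def)
    show "consistent_along push M \<pi> \<gamma> \<beta>"
      if "p \<in> mspace P" "q \<in> mspace P" "\<gamma> \<in> topspace (path_space P p q)" for p q \<gamma>
      unfolding con
    proof
      fix n
      \<comment> \<open>Consistency reads the values at the two ends only, and there \<beta> in
        degree \<open>n\<close> agrees with \<open>b n\<close>.\<close>
      have "?con n (b n) \<gamma>" using b_on that by blast
      then show "?con n (\<lambda>p. \<beta> p n) \<gamma>"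
        using that(1,2) ends[OF that(3)] by (simp add: proper_family.consistent_def[OF family] \<beta>_def)
    qed
    fix \<beta>' assume \<beta>': "\<beta>' \<in> assignments H M \<pi> (mspace P) \<and> (\<forall>p\<in>S. \<beta>' p = \<alpha> p) \<and>
      (\<forall>p\<in>mspace P. \<forall>q\<in>mspace P. \<forall>\<gamma>\<in>topspace (path_space P p q). consistent_along push M \<pi> \<gamma> \<beta>')"
    have "?con_on n (\<lambda>p. \<beta>' p n) (mspace P)" for n
      using \<beta>' unfolding con proper_family.consistent_on_def[OF family] mem_assignments_iff by blast
    then have "\<beta>' p n = b n p" if "p \<in> mspace P" for p n
      using b(3)[of n "\<lambda>p. \<beta>' p n"] \<beta>' that by simp
    moreover have "\<beta>' \<in> extensional (mspace P)" using \<beta>' by (simp add: mem_assignments_iff)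
    ultimately show "\<beta>' = \<beta>"
      by (intro extensionalityI[of _ "mspace P"]) (auto simp: \<beta>_def)
  qed
qed

theorem mainTheorem4:
  fixes P :: "'p metric" and M :: "'m topology" and \<pi> :: "'m \<Rightarrow> 'p" and Pstar :: "'p set"
  assumes "locally_path_connected_space (mtopology_of P)"
    and "Hausdorff_space M"
    and "continuous_map M (mtopology_of P) \<pi>"
    and "proper_map M (mtopology_of P) \<pi>"
    and "dense_in (mtopology_of P) Pstar"
  shows "(\<forall>\<alpha> :: 'p \<Rightarrow> nat \<Rightarrow> ('m, int) cech_class.
           \<alpha> \<in> assignments cech_homology M \<pi> Pstar \<longrightarrow>
           (\<forall>p\<in>Pstar. \<forall>q\<in>Pstar. \<exists>D. dense_in (path_space P p q) D \<and>
              (\<forall>\<gamma>\<in>D. consistent_along cech_homology_induced M \<pi> \<gamma> \<alpha>)) \<longrightarrow>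
           (\<exists>!\<beta>. \<beta> \<in> assignments cech_homology M \<pi> (mspace P) \<and>
              (\<forall>p\<in>Pstar. \<beta> p = \<alpha> p) \<and>
              (\<forall>p\<in>mspace P. \<forall>q\<in>mspace P. \<forall>\<gamma>\<in>topspace (path_space P p q).
                 consistent_along cech_homology_induced M \<pi> \<gamma> \<beta>))) \<and>
         (\<forall>\<alpha> :: 'p \<Rightarrow> nat \<Rightarrow> ('m cech_coclass \<Rightarrow> int).
           \<alpha> \<in> assignments dual_cech_cohomology M \<pi> Pstar \<longrightarrow>
           (\<forall>p\<in>Pstar. \<forall>q\<in>Pstar. \<exists>D. dense_in (path_space P p q) D \<and>
              (\<forall>\<gamma>\<in>D. consistent_along dual_cech_cohomology_induced M \<pi> \<gamma> \<alpha>)) \<longrightarrow>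
           (\<exists>!\<beta>. \<beta> \<in> assignments dual_cech_cohomology M \<pi> (mspace P) \<and>
              (\<forall>p\<in>Pstar. \<beta> p = \<alpha> p) \<and>
              (\<forall>p\<in>mspace P. \<forall>q\<in>mspace P. \<forall>\<gamma>\<in>topspace (path_space P p q).
                 consistent_along dual_cech_cohomology_induced M \<pi> \<gamma> \<beta>))) \<and>
         (\<forall>\<alpha> :: 'p \<Rightarrow> nat \<Rightarrow> ('m, rat) cech_class.
           \<alpha> \<in> assignments cech_homology M \<pi> Pstar \<longrightarrow>
           (\<forall>p\<in>Pstar. \<forall>q\<in>Pstar. \<exists>D. dense_in (path_space P p q) D \<and>
              (\<forall>\<gamma>\<in>D. consistent_along cech_homology_induced M \<pi> \<gamma> \<alpha>)) \<longrightarrow>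
           (\<exists>!\<beta>. \<beta> \<in> assignments cech_homology M \<pi> (mspace P) \<and>
              (\<forall>p\<in>Pstar. \<beta> p = \<alpha> p) \<and>
              (\<forall>p\<in>mspace P. \<forall>q\<in>mspace P. \<forall>\<gamma>\<in>topspace (path_space P p q).
                 consistent_along cech_homology_induced M \<pi> \<gamma> \<beta>)))"
proof -
  note axioms = proper_family_axioms.intro[OF assms(1-4)]
  note homology = proper_family.intro[OF continuous_homology_theory_cech_homology axioms]
    and dual = proper_family.intro[OF continuous_homology_theory_dual_cech_cohomology axioms]
  show ?thesis
    by (intro conjI allI impI unique_consistent_extension[OF homology assms(5)]
        unique_consistent_extension[OF dual assms(5)])
qed

end
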